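(* Let $\mathcal{C}$ be a triangulated category and let $\mathcal{P}=((\mathcal{S},\mathcal{T}),(\mathcal{U},\mathcal{V}))$ be a concentric twin cotorsion pair on $\mathcal{C}$ satisfying conditions (I) and (II) (stated in the context). Put $\mathcal{Z}=\mathcal{T}\cap\mathcal{U}$ and $\mathcal{I}=\mathcal{S}\cap\mathcal{T}=\mathcal{U}\cap\mathcal{V}$. Then the following maps are well defined and are mutually inverse bijections: $$\mathbb{R}\colon\mathfrak{M}_{\mathcal{P}}\to\mathfrak{CP}(\mathcal{Z}/\mathcal{I}),\quad(\mathcal{A},\mathcal{B})\mapsto(\overline{\sigma}(\mathcal{A}),\overline{\omega}(\mathcal{B})),$$ $$\mathbb{I}\colon\mathfrak{CP}(\mathcal{Z}/\mathcal{I})\to\mathfrak{M}_{\mathcal{P}},\quad(\mathscr{L},\mathscr{R})\mapsto(\overline{\sigma}^{-1}(\mathscr{L}),\overline{\omega}^{-1}(\mathscr{R})).$$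
   Context: $\mathcal{C}$ is a triangulated category with shift $[1]$; $\mathrm{Ext}^1(X,Y)=\mathcal{C}(X,Y[1])$. For full subcategories $\mathcal{X},\mathcal{Y}$ of a triangulated category, $\mathcal{X}\ast\mathcal{Y}$ is the full subcategory of objects $C$ admitting a distinguished triangle $X\to C\to Y\to X[1]$ with $X\in\mathcal{X},Y\in\mathcal{Y}$. A cotorsion pair on $\mathcal{C}$ is a pair $(\mathcal{U},\mathcal{V})$ of full additive subcategories closed under isomorphisms and direct summands with $\mathcal{C}=\mathcal{U}\ast\mathcal{V}[1]$ and $\mathrm{Ext}^1(\mathcal{U},\mathcal{V})=0$; $\mathfrak{CP}(\mathcal{C})$ is the class of cotorsion pairs on $\mathcal{C}$ (same notation for any triangulated category). A twin cotorsion pair (TCP) is a pair $((\mathcal{S},\mathcal{T}),(\mathcal{U},\mathcal{V}))$ of cotorsion pairs with $\mathrm{Ext}^1(\mathcal{S},\mathcal{V})=0$ (equivalently $\mathcal{S}\subseteq\mathcal{U}$, equivalently $\mathcal{V}\subseteq\mathcal{T}$). It is concentric if $\mathcal{S}\cap\mathcal{T}=\mathcal{U}\cap\mathcal{V}=:\mathcal{I}$. Put $\mathcal{Z}=\mathcal{T}\cap\mathcal{U}$, $\mathcal{N}^i=\mathcal{S}\ast\mathcal{V}[1]$, $\mathcal{N}^f=\mathcal{S}[-1]\ast\mathcal{V}$. For $\mathcal{I}\subseteq\mathcal{X}\subseteq\mathcal{C}$, $\mathcal{X}/\mathcal{I}$ is the ideal quotient (same objects; morphisms modulo those factoring through an object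 of $\mathcal{I}$); $\underline{f}$ is the class of $f$. Adjoints. $\mathcal{U}/\mathcal{I}\hookrightarrow\mathcal{C}/\mathcal{I}$ has a right adjoint $\omega_{\mathcal{U}}$ with counit $\varepsilon_{\mathcal{U}}$: for a triangle $U\overset{u}{\to}C\to V[1]\to U[1]$ with $U\in\mathcal{U},V\in\mathcal{V}$, $\omega_{\mathcal{U}}(C)=U$ and $(\varepsilon_{\mathcal{U}})_C=\underline{u}$. $\mathcal{T}/\mathcal{I}\hookrightarrow\mathcal{C}/\mathcal{I}$ has a left adjoint $\sigma_{\mathcal{T}}$ with unit $\eta_{\mathcal{T}}$: for a triangle $S[-1]\to C\overset{t}{\to}T\to S$ with $S\in\mathcal{S},T\in\mathcal{T}$, $\sigma_{\mathcal{T}}(C)=T$ and $(\eta_{\mathcal{T}})_C=\underline{t}$. These restrict to a right adjoint $\omega\colon\mathcal{T}/\mathcal{I}\to\mathcal{Z}/\mathcal{I}$ (counit $\varepsilon$) and a left adjoint $\sigma\colon\mathcal{U}/\mathcal{I}\to\mathcal{Z}/\mathcal{I}$ (unit $\eta$) of the inclusions. There is a unique natural transformation $\mu\colon\sigma\circ\omega_{\mathcal{U}}\Rightarrow\omega\circ\sigma_{\mathcal{T}}$ of functors $\mathcal{C}/\mathcal{I}\to\mathcal{Z}/\mathcal{I}$ with $\varepsilon_{\sigma_{\mathcal{T}}(X)}\circ\mu_X\circ\eta_{\omega_{\mathcal{U}}(X)}=(\eta_{\mathcal{T}})_X\circ(\varepsilon_{\mathcal{U}})_X$ in $\mathcal{C}/\mathcal{I}$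 for all $X\in\mathcal{C}$. Condition (I): for every $X\in\mathcal{T}\ast\mathcal{U}$, $\mu_X\colon\sigma(\omega_{\mathcal{U}}(X))\to\omega(\sigma_{\mathcal{T}}(X))$ is an isomorphism in $\mathcal{Z}/\mathcal{I}$. Condition (II): $\mathcal{U}\cap\mathcal{N}^f=\mathcal{S}$ and $\mathcal{T}\cap\mathcal{N}^i=\mathcal{V}$. Shift on $\mathcal{Z}/\mathcal{I}$. For $Z\in\mathcal{Z}$ choose a triangle $Z\to I\to U\to Z[1]$ with $I\in\mathcal{I}$, $U\in\mathcal{U}$, and put $Z\langle1\rangle=U$; a morphism $\underline{z}$ is sent to $\underline{u}$, where $(z,i,u)$ is a morphism between the chosen triangles. This is a functor $\langle1\rangle\colon\mathcal{Z}/\mathcal{I}\to\mathcal{U}/\mathcal{I}$. Put $\Sigma=\sigma\circ\langle1\rangle$ and $\mathrm{Ext}^1_{\mathcal{Z}/\mathcal{I}}(X,Y)=(\mathcal{Z}/\mathcal{I})(X,\Sigma Y)$. Triangles in $\mathcal{Z}/\mathcal{I}$. Let $X\overset{f}{\to}Y\overset{a}{\to}U\overset{b}{\to}X[1]$ be a distinguished triangle in $\mathcal{C}$ with $X,Y\in\mathcal{Z}$, $U\in\mathcal{U}$. Take a triangle $X\to I_X\to U_X\to X[1]$ with $I_X\in\mathcal{I}$, $U_X\in\mathcal{U}$ (so $\Sigma X=\sigma(U_X)$) and a morphism of triangles $(\mathrm{id}_X,y,c)$ from the former to the latter. The associated standard triangle is $X\overset{\underline{f}}{\to}Y\overset{\eta_U\circ\underline{a}}{\to}\sigma(U)\overset{\sigma(\underline{c})}{\to}\Sigma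 X$. Distinguished triangles in $\mathcal{Z}/\mathcal{I}$ are those isomorphic to standard ones. Under (I) and (II), $\mathcal{Z}/\mathcal{I}$ is a triangulated category with shift $\Sigma$ and these triangles; $\mathfrak{CP}(\mathcal{Z}/\mathcal{I})$ refers to this structure. The functors $\overline{\sigma}\colon\mathcal{U}\to\mathcal{Z}/\mathcal{I}$ and $\overline{\omega}\colon\mathcal{T}\to\mathcal{Z}/\mathcal{I}$ are the composites of the residue functors $\mathcal{U}\to\mathcal{U}/\mathcal{I}$, $\mathcal{T}\to\mathcal{T}/\mathcal{I}$ with $\sigma$, $\omega$. Images $\overline{\sigma}(\mathcal{A})$, $\overline{\omega}(\mathcal{B})$ are taken as essential images (closed under isomorphism); $\overline{\sigma}^{-1}(\mathscr{L})=\{U\in\mathcal{U}\mid\sigma(U)\in\mathscr{L}\}$, $\overline{\omega}^{-1}(\mathscr{R})=\{T\in\mathcal{T}\mid\omega(T)\in\mathscr{R}\}$. The class of mutable cotorsion pairs is $$\mathfrak{M}_{\mathcal{P}}=\{(\mathcal{A},\mathcal{B})\in\mathfrak{CP}(\mathcal{C})\mid \mathcal{S}\subseteq\mathcal{A}\subseteq\mathcal{U},\ \mathcal{V}\subseteq\mathcal{B}\subseteq\mathcal{T},\ \mathrm{Ext}^1_{\mathcal{Z}/\mathcal{I}}(\sigma(\mathcal{A}/\mathcal{I}),\omega(\mathcal{B}/\mathcal{I}))=0\}.$$ *)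

theory Defs
  imports "HOL-Algebra.Group" "HOL-Library.FuncSet"
begin

text \<open>Morphisms carry their domain and codomain, so distinct hom-sets are disjoint, and
  the composition \<open>g \<cdot> f\<close> means \<open>g\<close> after \<open>f\<close>.  A full subcategory is represented by its set of
  objects.  Outside the intended domains (non-composable or non-parallel morphisms) the operations
  are unconstrained.\<close>

section \<open>Additive categories\<close>

record ('o, 'm) cat_data =
  Obj :: "'o set"
  Arr :: "'m set"
  Dom :: "'m \<Rightarrow> 'o"
  Cod :: "'m \<Rightarrow> 'o"
  Idn :: "'o \<Rightarrow> 'm"
  Comp :: "'m \<Rightarrow> 'm \<Rightarrow> 'm"  (infixr "\<cdot>\<index>" 70)
  Plus :: "'m \<Rightarrow> 'm \<Rightarrow> 'm"
  Zer :: "'o \<Rightarrow> 'o \<Rightarrow> 'm"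

definition Hom :: "('o, 'm, 'z) cat_data_scheme \<Rightarrow> 'o \<Rightarrow> 'o \<Rightarrow> 'm set" where
  "Hom D X Y = {f \<in> Arr D. Dom D f = X \<and> Cod D f = Y}"

definition hom_group :: "('o, 'm, 'z) cat_data_scheme \<Rightarrow> 'o \<Rightarrow> 'o \<Rightarrow> 'm monoid" where
  "hom_group D X Y = \<lparr>carrier = Hom D X Y, monoid.mult = Plus D, one = Zer D X Y\<rparr>"

definition neg :: "('o, 'm, 'z) cat_data_scheme \<Rightarrow> 'm \<Rightarrow> 'm" where
  "neg D f = inv\<^bsub>hom_group D (Dom D f) (Cod D f)\<^esub> f"

definition is_iso :: "('o, 'm, 'z) cat_data_scheme \<Rightarrow> 'm \<Rightarrow> bool" where
  "is_iso D f \<longleftrightarrow> f \<in> Arr D \<and>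
     (\<exists>g \<in> Hom D (Cod D f) (Dom D f).
        g \<cdot>\<^bsub>D\<^esub> f = Idn D (Dom D f) \<and> f \<cdot>\<^bsub>D\<^esub> g = Idn D (Cod D f))"

definition isomorphic :: "('o, 'm, 'z) cat_data_scheme \<Rightarrow> 'o \<Rightarrow> 'o \<Rightarrow> bool" where
  "isomorphic D X Y \<longleftrightarrow> (\<exists>f \<in> Hom D X Y. is_iso D f)"

definition is_zero :: "('o, 'm, 'z) cat_data_scheme \<Rightarrow> 'o \<Rightarrow> bool" where
  "is_zero D N \<longleftrightarrow> N \<in> Obj D \<and>
     (\<forall>X \<in> Obj D. Hom D N X = {Zer D N X} \<and> Hom D X N = {Zer D X N})"

definition is_biproduct :: "('o, 'm, 'z) cat_data_scheme \<Rightarrow> 'o \<Rightarrow> 'o \<Rightarrow> 'o \<Rightarrow> bool" where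
  "is_biproduct D X Y B \<longleftrightarrow> X \<in> Obj D \<and> Y \<in> Obj D \<and> B \<in> Obj D \<and>
     (\<exists>i \<in> Hom D X B. \<exists>j \<in> Hom D Y B. \<exists>p \<in> Hom D B X. \<exists>q \<in> Hom D B Y.
        p \<cdot>\<^bsub>D\<^esub> i = Idn D X \<and> q \<cdot>\<^bsub>D\<^esub> j = Idn D Y \<and>
        p \<cdot>\<^bsub>D\<^esub> j = Zer D Y X \<and> q \<cdot>\<^bsub>D\<^esub> i = Zer D X Y \<and>
        Plus D (i \<cdot>\<^bsub>D\<^esub> p) (j \<cdot>\<^bsub>D\<^esub> q) = Idn D B)"

locale additive_category =
  fixes \<C> :: "('o, 'm, 'z) cat_data_scheme" (structure)
  assumes dom_cod_obj: "f \<in> Arr \<C> \<Longrightarrow> Dom \<C> f \<in> Obj \<C> \<and> Cod \<C> f \<in> Obj \<C>"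
    and idn_hom: "X \<in> Obj \<C> \<Longrightarrow> Idn \<C> X \<in> Hom \<C> X X"
    and comp_hom: "\<lbrakk>f \<in> Hom \<C> X Y; g \<in> Hom \<C> Y Z\<rbrakk> \<Longrightarrow> g \<cdot> f \<in> Hom \<C> X Z"
    and comp_assoc: "\<lbrakk>f \<in> Hom \<C> W X; g \<in> Hom \<C> X Y; h \<in> Hom \<C> Y Z\<rbrakk>
      \<Longrightarrow> (h \<cdot> g) \<cdot> f = h \<cdot> (g \<cdot> f)"
    and idn_right: "f \<in> Hom \<C> X Y \<Longrightarrow> f \<cdot> Idn \<C> X = f"
    and idn_left: "f \<in> Hom \<C> X Y \<Longrightarrow> Idn \<C> Y \<cdot> f = f"
    and hom_comm_group: "\<lbrakk>X \<in> Obj \<C>; Y \<in> Obj \<C>\<rbrakk> \<Longrightarrow> comm_group (hom_group \<C> X Y)"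
    and comp_plus_left: "\<lbrakk>f \<in> Hom \<C> X Y; g \<in> Hom \<C> Y Z; g' \<in> Hom \<C> Y Z\<rbrakk>
      \<Longrightarrow> Plus \<C> g g' \<cdot> f = Plus \<C> (g \<cdot> f) (g' \<cdot> f)"
    and comp_plus_right: "\<lbrakk>f \<in> Hom \<C> X Y; f' \<in> Hom \<C> X Y; g \<in> Hom \<C> Y Z\<rbrakk>
      \<Longrightarrow> g \<cdot> Plus \<C> f f' = Plus \<C> (g \<cdot> f) (g \<cdot> f')"
    and ex_zero: "\<exists>N. is_zero \<C> N"
    and ex_biproduct: "\<lbrakk>X \<in> Obj \<C>; Y \<in> Obj \<C>\<rbrakk> \<Longrightarrow> \<exists>B. is_biproduct \<C> X Y B"

text \<open>Additive, and closed under isomorphisms and direct summands.\<close>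

definition additive_subcat :: "('o, 'm, 'z) cat_data_scheme \<Rightarrow> 'o set \<Rightarrow> bool" where
  "additive_subcat D \<A> \<longleftrightarrow> \<A> \<subseteq> Obj D \<and>
     (\<exists>N \<in> \<A>. is_zero D N) \<and>
     (\<forall>X Y B. X \<in> \<A> \<longrightarrow> Y \<in> \<A> \<longrightarrow> is_biproduct D X Y B \<longrightarrow> B \<in> \<A>) \<and>
     (\<forall>X Y. X \<in> \<A> \<longrightarrow> isomorphic D X Y \<longrightarrow> Y \<in> \<A>) \<and>
     (\<forall>X Y B. B \<in> \<A> \<longrightarrow> is_biproduct D X Y B \<longrightarrow> X \<in> \<A> \<and> Y \<in> \<A>)"

section \<open>Ideal quotients\<close>

definition ideal_class :: "('o, 'm, 'z) cat_data_scheme \<Rightarrow> 'o set \<Rightarrow> 'm \<Rightarrow> 'm set" where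
  "ideal_class D \<J> f = {g \<in> Hom D (Dom D f) (Cod D f).
     \<exists>J \<in> \<J>. \<exists>a \<in> Hom D (Dom D f) J. \<exists>b \<in> Hom D J (Cod D f). g = Plus D f (b \<cdot>\<^bsub>D\<^esub> a)}"

definition rep :: "'m set \<Rightarrow> 'm" where
  "rep F = (SOME f. f \<in> F)"

text \<open>\<open>\<X>/\<J>\<close> for \<open>\<J> \<subseteq> \<X>\<close>: for \<open>X, Y \<in> \<X>\<close> the hom-set is the same set of classes
  whichever such \<open>\<X>\<close> is taken, and composition does not depend on \<open>\<X>\<close> either.\<close>

definition ideal_quotient ::
    "('o, 'm, 'z) cat_data_scheme \<Rightarrow> 'o set \<Rightarrow> 'o set \<Rightarrow> ('o, 'm set) cat_data" where
  "ideal_quotient D \<J> \<X> =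
    \<lparr>Obj = \<X>,
     Arr = ideal_class D \<J> ` {f \<in> Arr D. Dom D f \<in> \<X> \<and> Cod D f \<in> \<X>},
     Dom = (\<lambda>F. Dom D (rep F)),
     Cod = (\<lambda>F. Cod D (rep F)),
     Idn = (\<lambda>X. ideal_class D \<J> (Idn D X)),
     Comp = (\<lambda>G F. ideal_class D \<J> (rep G \<cdot>\<^bsub>D\<^esub> rep F)),
     Plus = (\<lambda>F G. ideal_class D \<J> (Plus D (rep F) (rep G))),
     Zer = (\<lambda>X Y. ideal_class D \<J> (Zer D X Y))\<rparr>"

section \<open>Triangulated categories\<close>

type_synonym 'm triangle = "'m \<times> 'm \<times> 'm"

record ('o, 'm) shift_cat_data = "('o, 'm) cat_data" +
  sh_obj :: "'o \<Rightarrow> 'o"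
  sh_arr :: "'m \<Rightarrow> 'm"

record ('o, 'm) tri_cat_data = "('o, 'm) shift_cat_data" +
  Tri :: "'m triangle set"

definition candidate_triangle :: "('o, 'm, 'z) shift_cat_data_scheme \<Rightarrow> 'm triangle \<Rightarrow> bool" where
  "candidate_triangle D = (\<lambda>(f, g, h). f \<in> Arr D \<and> g \<in> Arr D \<and> h \<in> Arr D \<and>
     Cod D f = Dom D g \<and> Cod D g = Dom D h \<and> Cod D h = sh_obj D (Dom D f))"

definition tri_mor ::
    "('o, 'm, 'z) shift_cat_data_scheme \<Rightarrow> 'm triangle \<Rightarrow> 'm triangle \<Rightarrow> 'm \<times> 'm \<times> 'm \<Rightarrow> bool" where
  "tri_mor D = (\<lambda>(f, g, h) (f', g', h') (x, y, z).
     x \<in> Hom D (Dom D f) (Dom D f') \<and>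
     y \<in> Hom D (Dom D g) (Dom D g') \<and>
     z \<in> Hom D (Dom D h) (Dom D h') \<and>
     y \<cdot>\<^bsub>D\<^esub> f = f' \<cdot>\<^bsub>D\<^esub> x \<and> z \<cdot>\<^bsub>D\<^esub> g = g' \<cdot>\<^bsub>D\<^esub> y \<and> sh_arr D x \<cdot>\<^bsub>D\<^esub> h = h' \<cdot>\<^bsub>D\<^esub> z)"

definition tri_iso ::
    "('o, 'm, 'z) shift_cat_data_scheme \<Rightarrow> 'm triangle \<Rightarrow> 'm triangle \<Rightarrow> bool" where
  "tri_iso D t t' \<longleftrightarrow>
     (\<exists>x y z. tri_mor D t t' (x, y, z) \<and> is_iso D x \<and> is_iso D y \<and> is_iso D z)"

text \<open>The shift is only required to be an autoequivalence; it need not be an automorphism.\<close>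

locale triangulated_category = additive_category \<C>
  for \<C> :: "('o, 'm, 'z) tri_cat_data_scheme" (structure) +
  assumes sh_obj_closed: "X \<in> Obj \<C> \<Longrightarrow> sh_obj \<C> X \<in> Obj \<C>"
    and sh_idn: "X \<in> Obj \<C> \<Longrightarrow> sh_arr \<C> (Idn \<C> X) = Idn \<C> (sh_obj \<C> X)"
    and sh_comp: "\<lbrakk>f \<in> Hom \<C> X Y; g \<in> Hom \<C> Y Z\<rbrakk>
      \<Longrightarrow> sh_arr \<C> (g \<cdot> f) = sh_arr \<C> g \<cdot> sh_arr \<C> f"
    and sh_plus: "\<lbrakk>f \<in> Hom \<C> X Y; g \<in> Hom \<C> X Y\<rbrakk>
      \<Longrightarrow> sh_arr \<C> (Plus \<C> f g) = Plus \<C> (sh_arr \<C> f) (sh_arr \<C> g)"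
    and sh_full_faithful: "\<lbrakk>X \<in> Obj \<C>; Y \<in> Obj \<C>\<rbrakk>
      \<Longrightarrow> bij_betw (sh_arr \<C>) (Hom \<C> X Y) (Hom \<C> (sh_obj \<C> X) (sh_obj \<C> Y))"
    and sh_ess_surj: "Y \<in> Obj \<C> \<Longrightarrow> \<exists>X \<in> Obj \<C>. isomorphic \<C> (sh_obj \<C> X) Y"
    and tri_candidate: "t \<in> Tri \<C> \<Longrightarrow> candidate_triangle \<C> t"
    and TR1_iso: "\<lbrakk>t \<in> Tri \<C>; candidate_triangle \<C> t'; tri_iso \<C> t t'\<rbrakk> \<Longrightarrow> t' \<in> Tri \<C>"
    and TR1_idn: "\<lbrakk>X \<in> Obj \<C>; is_zero \<C> N\<rbrakk>
      \<Longrightarrow> (Idn \<C> X, Zer \<C> X N, Zer \<C> N (sh_obj \<C> X)) \<in> Tri \<C>"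
    and TR1_complete: "f \<in> Arr \<C> \<Longrightarrow> \<exists>g h. (f, g, h) \<in> Tri \<C>"
    and TR2: "candidate_triangle \<C> (f, g, h)
      \<Longrightarrow> (f, g, h) \<in> Tri \<C> \<longleftrightarrow> (g, h, neg \<C> (sh_arr \<C> f)) \<in> Tri \<C>"
    and TR3: "\<lbrakk>(f, g, h) \<in> Tri \<C>; (f', g', h') \<in> Tri \<C>;
        x \<in> Hom \<C> (Dom \<C> f) (Dom \<C> f'); y \<in> Hom \<C> (Cod \<C> f) (Cod \<C> f'); y \<cdot> f = f' \<cdot> x\<rbrakk>
      \<Longrightarrow> \<exists>z. tri_mor \<C> (f, g, h) (f', g', h') (x, y, z)"
    and TR4: "\<lbrakk>Cod \<C> f = Dom \<C> g;
        (f, f', f'') \<in> Tri \<C>; (g, g', g'') \<in> Tri \<C>; (g \<cdot> f, h', h'') \<in> Tri \<C>\<rbrakk>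
      \<Longrightarrow> \<exists>u v. (u, v, sh_arr \<C> f' \<cdot> g'') \<in> Tri \<C> \<and>
            Dom \<C> u = Cod \<C> f' \<and> Cod \<C> u = Cod \<C> h' \<and> Cod \<C> v = Cod \<C> g' \<and>
            u \<cdot> f' = h' \<cdot> g \<and> h'' \<cdot> u = f'' \<and> v \<cdot> h' = g' \<and> g'' \<cdot> v = sh_arr \<C> f \<cdot> h''"

definition star :: "('o, 'm, 'z) tri_cat_data_scheme \<Rightarrow> 'o set \<Rightarrow> 'o set \<Rightarrow> 'o set" where
  "star D \<X> \<Y> = {C \<in> Obj D. \<exists>f g h. (f, g, h) \<in> Tri D \<and>
     Dom D f \<in> \<X> \<and> Cod D f = C \<and> Cod D g \<in> \<Y>}"

definition sh_subcat :: "('o, 'm, 'z) shift_cat_data_scheme \<Rightarrow> 'o set \<Rightarrow> 'o set" where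
  "sh_subcat D \<X> = sh_obj D ` \<X>"

text \<open>The inverse shift of a subcategory closed under isomorphisms.\<close>

definition unsh_subcat :: "('o, 'm, 'z) shift_cat_data_scheme \<Rightarrow> 'o set \<Rightarrow> 'o set" where
  "unsh_subcat D \<X> = {X \<in> Obj D. sh_obj D X \<in> \<X>}"

definition Ext1 :: "('o, 'm, 'z) shift_cat_data_scheme \<Rightarrow> 'o \<Rightarrow> 'o \<Rightarrow> 'm set" where
  "Ext1 D X Y = Hom D X (sh_obj D Y)"

definition Ext1_vanishes ::
    "('o, 'm, 'z) shift_cat_data_scheme \<Rightarrow> 'o set \<Rightarrow> 'o set \<Rightarrow> bool" where
  "Ext1_vanishes D \<X> \<Y> \<longleftrightarrow> (\<forall>X \<in> \<X>. \<forall>Y \<in> \<Y>. Ext1 D X Y = {Zer D X (sh_obj D Y)})"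

definition cotorsion_pairs :: "('o, 'm, 'z) tri_cat_data_scheme \<Rightarrow> ('o set \<times> 'o set) set" where
  "cotorsion_pairs D = {(\<U>, \<V>). additive_subcat D \<U> \<and> additive_subcat D \<V> \<and>
     Obj D = star D \<U> (sh_subcat D \<V>) \<and> Ext1_vanishes D \<U> \<V>}"

section \<open>Concentric twin cotorsion pairs\<close>

locale concentric_tcp = triangulated_category \<C>
  for \<C> :: "('o, 'm, 'z) tri_cat_data_scheme" (structure) +
  fixes \<S> \<T> \<U> \<V> :: "'o set"
  assumes ST_cotorsion: "(\<S>, \<T>) \<in> cotorsion_pairs \<C>"
    and UV_cotorsion: "(\<U>, \<V>) \<in> cotorsion_pairs \<C>"
    and twin: "Ext1_vanishes \<C> \<S> \<V>"
    and concentric: "\<S> \<inter> \<T> = \<U> \<inter> \<V>"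

text \<open>The functors below depend on chosen triangles:
  \<open>triU X\<close> is \<open>U \<rightarrow> X \<rightarrow> V[1] \<rightarrow> U[1]\<close>,
  \<open>triT X\<close> is the triangle \<open>X \<rightarrow> T \<rightarrow> S \<rightarrow> X[1]\<close> obtained by rotating
  \<open>S[-1] \<rightarrow> X \<rightarrow> T \<rightarrow> S\<close>, and for \<open>Z\<close> in \<open>\<T> \<inter> \<U>\<close>,
  \<open>triI Z\<close> is \<open>Z \<rightarrow> I \<rightarrow> U \<rightarrow> Z[1]\<close>.  Such triangles exist for every
  concentric twin cotorsion pair; the choice is arbitrary.\<close>

locale concentric_tcp_choice = concentric_tcp \<C> \<S> \<T> \<U> \<V>
  for \<C> :: "('o, 'm, 'z) tri_cat_data_scheme" (structure)
    and \<S> \<T> \<U> \<V> :: "'o set" +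
  fixes triU triT triI :: "'o \<Rightarrow> 'm triangle"
  assumes triU: "\<lbrakk>X \<in> Obj \<C>; triU X = (u, v, w)\<rbrakk>
      \<Longrightarrow> (u, v, w) \<in> Tri \<C> \<and> Cod \<C> u = X \<and> Dom \<C> u \<in> \<U> \<and> Cod \<C> v \<in> sh_subcat \<C> \<V>"
    and triT: "\<lbrakk>X \<in> Obj \<C>; triT X = (t, s, r)\<rbrakk>
      \<Longrightarrow> (t, s, r) \<in> Tri \<C> \<and> Dom \<C> t = X \<and> Cod \<C> t \<in> \<T> \<and> Cod \<C> s \<in> \<S>"
    and triI: "\<lbrakk>Z \<in> \<T> \<inter> \<U>; triI Z = (i, p, q)\<rbrakk>
      \<Longrightarrow> (i, p, q) \<in> Tri \<C> \<and> Dom \<C> i = Z \<and> Cod \<C> i \<in> \<S> \<inter> \<T> \<and> Cod \<C> p \<in> \<U>"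
begin

definition \<Z> :: "'o set" where
  "\<Z> = \<T> \<inter> \<U>"

definition \<I> :: "'o set" where
  "\<I> = \<S> \<inter> \<T>"

definition N_i :: "'o set" where
  "N_i = star \<C> \<S> (sh_subcat \<C> \<V>)"

definition N_f :: "'o set" where
  "N_f = star \<C> (unsh_subcat \<C> \<S>) \<V>"

definition C_I :: "('o, 'm set) cat_data" where
  "C_I = ideal_quotient \<C> \<I> (Obj \<C>)"

definition residue :: "'m \<Rightarrow> 'm set" where
  "residue f = ideal_class \<C> \<I> f"

subsection \<open>The adjoints and the comparison transformation\<close>

text \<open>The functors \<open>\<omega>\<close> on \<open>\<T>/\<I>\<close> and \<open>\<sigma>\<close> on \<open>\<U>/\<I>\<close> are
  restrictions of \<open>\<omega>\<^sub>\<U>\<close> and \<open>\<sigma>\<^sub>\<T>\<close>, likewise \<open>\<epsilon>\<close> and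
  \<open>\<eta>\<close>; no separate constants are introduced for the restrictions.\<close>

definition omega_obj :: "'o \<Rightarrow> 'o" where
  "omega_obj X = Dom \<C> (fst (triU X))"

definition eps :: "'o \<Rightarrow> 'm set" where
  "eps X = residue (fst (triU X))"

definition omega_arr :: "'m set \<Rightarrow> 'm set" where
  "omega_arr F = (let X = Dom C_I F; Y = Cod C_I F in
     THE G. G \<in> Hom C_I (omega_obj X) (omega_obj Y) \<and>
       eps Y \<cdot>\<^bsub>C_I\<^esub> G = F \<cdot>\<^bsub>C_I\<^esub> eps X)"

definition sigma_obj :: "'o \<Rightarrow> 'o" where
  "sigma_obj X = Cod \<C> (fst (triT X))"

definition eta :: "'o \<Rightarrow> 'm set" where
  "eta X = residue (fst (triT X))"

definition sigma_arr :: "'m set \<Rightarrow> 'm set" where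
  "sigma_arr F = (let X = Dom C_I F; Y = Cod C_I F in
     THE G. G \<in> Hom C_I (sigma_obj X) (sigma_obj Y) \<and>
       G \<cdot>\<^bsub>C_I\<^esub> eta X = eta Y \<cdot>\<^bsub>C_I\<^esub> F)"

text \<open>\<open>extensional\<close> only makes the components at non-objects definite, so that the
  transformation is unique as a function.\<close>

definition mu :: "'o \<Rightarrow> 'm set" where
  "mu = (THE m. m \<in> extensional (Obj \<C>) \<and>
     (\<forall>X \<in> Obj \<C>. m X \<in> Hom (ideal_quotient \<C> \<I> \<Z>)
        (sigma_obj (omega_obj X)) (omega_obj (sigma_obj X))) \<and>
     (\<forall>X Y. \<forall>F \<in> Hom C_I X Y.
        m Y \<cdot>\<^bsub>C_I\<^esub> sigma_arr (omega_arr F) = omega_arr (sigma_arr F) \<cdot>\<^bsub>C_I\<^esub> m X) \<and>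
     (\<forall>X \<in> Obj \<C>. eps (sigma_obj X) \<cdot>\<^bsub>C_I\<^esub> m X \<cdot>\<^bsub>C_I\<^esub> eta (omega_obj X)
        = eta X \<cdot>\<^bsub>C_I\<^esub> eps X))"

definition condition_I :: bool where
  "condition_I \<longleftrightarrow> (\<forall>X \<in> star \<C> \<T> \<U>. is_iso (ideal_quotient \<C> \<I> \<Z>) (mu X))"

definition condition_II :: bool where
  "condition_II \<longleftrightarrow> \<U> \<inter> N_f = \<S> \<and> \<T> \<inter> N_i = \<V>"

subsection \<open>The triangulated structure on the quotient\<close>

definition step_obj :: "'o \<Rightarrow> 'o" where
  "step_obj Z = (case triI Z of (i, p, q) \<Rightarrow> Cod \<C> p)"

definition step_arr :: "'m set \<Rightarrow> 'm set" where
  "step_arr F = (THE G. \<exists>z \<in> F. \<exists>i u.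
     tri_mor \<C> (triI (Dom \<C> z)) (triI (Cod \<C> z)) (z, i, u) \<and> G = residue u)"

definition Z_I_shift :: "('o, 'm set) shift_cat_data" where
  "Z_I_shift = cat_data.extend (ideal_quotient \<C> \<I> \<Z>)
     (shift_cat_data.fields (\<lambda>X. sigma_obj (step_obj X)) (\<lambda>F. sigma_arr (step_arr F)))"

definition standard_triangle :: "('m set) triangle \<Rightarrow> bool" where
  "standard_triangle t \<longleftrightarrow> (\<exists>f a b y c.
     (f, a, b) \<in> Tri \<C> \<and> Dom \<C> f \<in> \<Z> \<and> Cod \<C> f \<in> \<Z> \<and> Cod \<C> a \<in> \<U> \<and>
     tri_mor \<C> (f, a, b) (triI (Dom \<C> f)) (Idn \<C> (Dom \<C> f), y, c) \<and>
     t = (residue f, eta (Cod \<C> a) \<cdot>\<^bsub>C_I\<^esub> residue a, sigma_arr (residue c)))"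

definition Z_I :: "('o, 'm set) tri_cat_data" where
  "Z_I = shift_cat_data.extend Z_I_shift (tri_cat_data.fields
     {t. candidate_triangle Z_I_shift t \<and>
         (\<exists>t'. standard_triangle t' \<and> tri_iso Z_I_shift t' t)})"

subsection \<open>Mutable cotorsion pairs\<close>

definition mutable_pairs :: "('o set \<times> 'o set) set" where
  "mutable_pairs = {(\<A>, \<B>) \<in> cotorsion_pairs \<C>. \<S> \<subseteq> \<A> \<and> \<A> \<subseteq> \<U> \<and> \<V> \<subseteq> \<B> \<and> \<B> \<subseteq> \<T> \<and>
     Ext1_vanishes Z_I (sigma_obj ` \<A>) (omega_obj ` \<B>)}"

definition sigma_bar :: "'o set \<Rightarrow> 'o set" where
  "sigma_bar \<A> = {Z \<in> \<Z>. \<exists>A \<in> \<A>. isomorphic Z_I (sigma_obj A) Z}"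

definition omega_bar :: "'o set \<Rightarrow> 'o set" where
  "omega_bar \<B> = {Z \<in> \<Z>. \<exists>B \<in> \<B>. isomorphic Z_I (omega_obj B) Z}"

definition sigma_bar_inv :: "'o set \<Rightarrow> 'o set" where
  "sigma_bar_inv \<L> = {U \<in> \<U>. sigma_obj U \<in> \<L>}"

definition omega_bar_inv :: "'o set \<Rightarrow> 'o set" where
  "omega_bar_inv \<R> = {T \<in> \<T>. omega_obj T \<in> \<R>}"

definition R_map :: "'o set \<times> 'o set \<Rightarrow> 'o set \<times> 'o set" where
  "R_map = (\<lambda>(\<A>, \<B>). (sigma_bar \<A>, omega_bar \<B>))"

definition I_map :: "'o set \<times> 'o set \<Rightarrow> 'o set \<times> 'o set" where
  "I_map = (\<lambda>(\<L>, \<R>). (sigma_bar_inv \<L>, omega_bar_inv \<R>))"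

end

end

theory Submission
  imports Defs
begin

text \<open>The triangulated structure of \<open>\<Z>/\<I>\<close> is never needed as a whole.  The proof manipulates
  triangles of \<open>\<C>\<close> with the octahedral axiom, up to isomorphism modulo \<open>\<I>\<close>.

  The key point is that, for a triangle \<open>T \<rightarrow> V \<rightarrow> U \<rightarrow> T[1]\<close> with objects in \<open>\<T>\<close>, \<open>\<V>\<close>, \<open>\<U>\<close>,
  conditions (I) and (II) give \<open>\<sigma>(U) \<cong> \<Sigma>\<omega>(T)\<close>.  Hence a triangle \<open>L \<rightarrow> Z \<rightarrow> \<Sigma>R \<rightarrow> \<Sigma>L\<close> in
  \<open>\<Z>/\<I>\<close> lifts to a triangle \<open>B \<rightarrow> L \<rightarrow> Z \<rightarrow> B[1]\<close> in \<open>\<C>\<close> with \<open>\<omega>(B) \<cong> R\<close>, and conversely.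
  Pulling it back along \<open>U \<rightarrow> \<sigma>(U)\<close> yields an object of \<open>\<T> \<ast> \<U>\<close>, and (I) identifies its
  \<open>\<U>\<close>-cover as an object of \<open>\<sigma>\<^sup>-\<^sup>1(L)\<close>.  This resolves all of \<open>\<U>\<close>, and dually \<open>\<T>\<close>, by the two
  preimages; the general case follows by splitting off a summand.  Extensions of \<open>\<sigma>\<^sup>-\<^sup>1(L)\<close> by
  \<open>\<omega>\<^sup>-\<^sup>1(R)\<close> split because the classifying morphism, when it vanishes in \<open>\<Z>/\<I>\<close>, factors
  through \<open>\<S>\<close>, again by (I) and (II).\<close>

section \<open>Additive categories and morphisms modulo an ideal\<close>

text \<open>The classes involved contain \<I> and are stable under isomorphism modulo \<I>, so it
  suffices to follow objects: (I) is used as an isomorphism between the two ends of \<mu>. The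
  obstacle is a mismatch of shapes. In a triangle B -> L -> Z -> B[1] of \<C> the object B[1] is
  usually outside \<U>, while a standard triangle of the quotient comes from a third vertex U in
  \<U>. Triangles T -> V -> U -> T[1] bridge the gap: pushing a hull \<omega>(T) -> I out along
  \<omega>(T) -> T gives X in \<T> * \<U> whose \<U>-cover is I. By (I) the \<U>-cover of the
  reflection of X is zero modulo \<I>, and by (II) that reflection lies in \<V>. It is thus a second
  \<V>-hull of T, now with a cone whose reflection is \<Sigma>\<omega>(T). Every statement about
  \<S>, \<U>, \<sigma> has a mirror about \<V>, \<T>, \<omega>. The mirror is obtained from the
  opposite category, which here is plain \<open>cat_data\<close>: it carries no shift, and this is
  why the calculus avoids the shift.\<close>

definition op_cat :: "('o, 'm, 'z) cat_data_scheme \<Rightarrow> ('o, 'm) cat_data" where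
  "op_cat D = \<lparr>Obj = Obj D, Arr = Arr D, Dom = Cod D, Cod = Dom D, Idn = Idn D,
     Comp = (\<lambda>g f. f \<cdot>\<^bsub>D\<^esub> g), Plus = Plus D, Zer = (\<lambda>X Y. Zer D Y X)\<rparr>"

lemma op_cat_simps [simp]:
  "Obj (op_cat D) = Obj D" "Arr (op_cat D) = Arr D"
  "Idn (op_cat D) = Idn D" "g \<cdot>\<^bsub>op_cat D\<^esub> f = f \<cdot>\<^bsub>D\<^esub> g" "Plus (op_cat D) = Plus D"
  "Zer (op_cat D) X Y = Zer D Y X" "Hom (op_cat D) X Y = Hom D Y X"
  by (auto simp: op_cat_def Hom_def)

lemma is_zero_op_cat [simp]: "is_zero (op_cat D) N \<longleftrightarrow> is_zero D N"
  by (auto simp: is_zero_def)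

lemma is_biproduct_op_cat [simp]: "is_biproduct (op_cat D) X Y B \<longleftrightarrow> is_biproduct D X Y B"
  unfolding is_biproduct_def by simp blast

definition arr_minus :: "('o, 'm, 'z) cat_data_scheme \<Rightarrow> 'm \<Rightarrow> 'm \<Rightarrow> 'm" where
  "arr_minus D f g = Plus D f (neg D g)"

section \<open>Arithmetic of hom-groups and the opposite additive category\<close>

context additive_category
begin

lemma op_additive: "additive_category (op_cat \<C>)"
proof (rule additive_category.intro)
  fix X Y assume "X \<in> Obj (op_cat \<C>)" "Y \<in> Obj (op_cat \<C>)"
  moreover have "hom_group (op_cat \<C>) X Y = hom_group \<C> Y X"
    by (simp add: hom_group_def)
  ultimately show "comm_group (hom_group (op_cat \<C>) X Y)"
    using hom_comm_group by simp
next
  fix f assume "f \<in> Arr (op_cat \<C>)"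
  then show "Dom (op_cat \<C>) f \<in> Obj (op_cat \<C>) \<and> Cod (op_cat \<C>) f \<in> Obj (op_cat \<C>)"
    using dom_cod_obj by (simp add: op_cat_def)
qed (simp_all add: idn_hom comp_hom comp_assoc idn_left idn_right comp_plus_left comp_plus_right
    ex_zero ex_biproduct)

lemma hom_obj: "f \<in> Hom \<C> X Y \<Longrightarrow> X \<in> Obj \<C>" "f \<in> Hom \<C> X Y \<Longrightarrow> Y \<in> Obj \<C>"
  using dom_cod_obj by (auto simp: Hom_def)

lemma plus_hom: "\<lbrakk>f \<in> Hom \<C> X Y; g \<in> Hom \<C> X Y\<rbrakk> \<Longrightarrow> Plus \<C> f g \<in> Hom \<C> X Y"
  using hom_comm_group[of X Y] hom_obj[of f X Y] monoid.m_closed[of "hom_group \<C> X Y" f g]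
  by (auto simp: hom_group_def comm_group_def group_def)

lemma zer_hom: "\<lbrakk>X \<in> Obj \<C>; Y \<in> Obj \<C>\<rbrakk> \<Longrightarrow> Zer \<C> X Y \<in> Hom \<C> X Y"
  using hom_comm_group[of X Y] monoid.one_closed[of "hom_group \<C> X Y"]
  by (auto simp: hom_group_def comm_group_def group_def)

lemma neg_hom: "f \<in> Hom \<C> X Y \<Longrightarrow> neg \<C> f \<in> Hom \<C> X Y"
  using hom_comm_group[of X Y] hom_obj[of f X Y] group.inv_closed[of "hom_group \<C> X Y" f]
  by (auto simp: hom_group_def comm_group_def neg_def Hom_def)

lemma plus_assoc: "\<lbrakk>f \<in> Hom \<C> X Y; g \<in> Hom \<C> X Y; h \<in> Hom \<C> X Y\<rbrakk>
    \<Longrightarrow> Plus \<C> (Plus \<C> f g) h = Plus \<C> f (Plus \<C> g h)"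
  using hom_comm_group[of X Y] hom_obj[of f X Y] monoid.m_assoc[of "hom_group \<C> X Y" f g h]
  by (auto simp: hom_group_def comm_group_def group_def)

lemma plus_commute: "\<lbrakk>f \<in> Hom \<C> X Y; g \<in> Hom \<C> X Y\<rbrakk> \<Longrightarrow> Plus \<C> f g = Plus \<C> g f"
  using hom_comm_group[of X Y] hom_obj[of f X Y] comm_monoid.m_comm[of "hom_group \<C> X Y" f g]
  by (auto simp: hom_group_def comm_group_def)

lemma plus_zer: "f \<in> Hom \<C> X Y \<Longrightarrow> Plus \<C> f (Zer \<C> X Y) = f"
  using hom_comm_group[of X Y] hom_obj[of f X Y] monoid.r_one[of "hom_group \<C> X Y" f]
  by (auto simp: hom_group_def comm_group_def group_def)

lemma zer_plus: "f \<in> Hom \<C> X Y \<Longrightarrow> Plus \<C> (Zer \<C> X Y) f = f"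
  using hom_comm_group[of X Y] hom_obj[of f X Y] monoid.l_one[of "hom_group \<C> X Y" f]
  by (auto simp: hom_group_def comm_group_def group_def)

lemma plus_neg: "f \<in> Hom \<C> X Y \<Longrightarrow> Plus \<C> f (neg \<C> f) = Zer \<C> X Y"
  using hom_comm_group[of X Y] hom_obj[of f X Y] group.r_inv[of "hom_group \<C> X Y" f]
  by (auto simp: hom_group_def comm_group_def neg_def Hom_def)

lemma neg_plus: "f \<in> Hom \<C> X Y \<Longrightarrow> Plus \<C> (neg \<C> f) f = Zer \<C> X Y"
  using plus_neg plus_commute neg_hom by metis

lemma plus_cancel:
  assumes "f \<in> Hom \<C> X Y" "g \<in> Hom \<C> X Y" "h \<in> Hom \<C> X Y" "Plus \<C> f h = Plus \<C> g h"
  shows "f = g"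
proof -
  have "Plus \<C> (Plus \<C> x h) (neg \<C> h) = x" if x: "x \<in> Hom \<C> X Y" for x
    using plus_assoc[OF x assms(3) neg_hom[OF assms(3)]] plus_neg[OF assms(3)] plus_zer[OF x] by simp
  from this[OF assms(1)] this[OF assms(2)] show ?thesis unfolding assms(4) by (rule trans[OF sym])
qed

lemma comp_zer: assumes "g \<in> Hom \<C> Y Z" "X \<in> Obj \<C>" shows "g \<cdot> Zer \<C> X Y = Zer \<C> X Z"
proof -
  note z = zer_hom[OF assms(2) hom_obj(1)[OF assms(1)]]
  have "g \<cdot> Zer \<C> X Y = Plus \<C> (g \<cdot> Zer \<C> X Y) (g \<cdot> Zer \<C> X Y)"
    using comp_plus_right[OF z z assms(1)] plus_zer[OF z] by simp
  then show ?thesis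
    using plus_cancel[OF comp_hom[OF z assms(1)] _ comp_hom[OF z assms(1)], of "Zer \<C> X Z"]
      zer_plus[OF comp_hom[OF z assms(1)]] zer_hom[OF assms(2) hom_obj(2)[OF assms(1)]] by simp
qed

lemma zer_comp: assumes "f \<in> Hom \<C> X Y" "Z \<in> Obj \<C>" shows "Zer \<C> Y Z \<cdot> f = Zer \<C> X Z"
proof -
  note z = zer_hom[OF hom_obj(2)[OF assms(1)] assms(2)]
  have "Zer \<C> Y Z \<cdot> f = Plus \<C> (Zer \<C> Y Z \<cdot> f) (Zer \<C> Y Z \<cdot> f)"
    using comp_plus_left[OF assms(1) z z] plus_zer[OF z] by simp
  then show ?thesis
    using plus_cancel[OF comp_hom[OF assms(1) z] _ comp_hom[OF assms(1) z], of "Zer \<C> X Z"]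
      zer_plus[OF comp_hom[OF assms(1) z]] zer_hom[OF hom_obj(1)[OF assms(1)] assms(2)] by simp
qed

lemma comp_neg: assumes "f \<in> Hom \<C> X Y" "g \<in> Hom \<C> Y Z" shows "g \<cdot> neg \<C> f = neg \<C> (g \<cdot> f)"
proof -
  note h = comp_hom[OF assms] comp_hom[OF neg_hom[OF assms(1)] assms(2)]
  have "Plus \<C> (g \<cdot> neg \<C> f) (g \<cdot> f) = Plus \<C> (neg \<C> (g \<cdot> f)) (g \<cdot> f)"
    using comp_plus_right[OF neg_hom[OF assms(1)] assms] neg_plus[OF assms(1)]
      neg_plus[OF h(1)] comp_zer[OF assms(2) hom_obj(1)[OF assms(1)]] by simp
  then show ?thesis by (rule plus_cancel[OF h(2) neg_hom[OF h(1)] h(1)])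
qed

lemma neg_comp: assumes "f \<in> Hom \<C> X Y" "g \<in> Hom \<C> Y Z" shows "neg \<C> g \<cdot> f = neg \<C> (g \<cdot> f)"
proof -
  note h = comp_hom[OF assms] comp_hom[OF assms(1) neg_hom[OF assms(2)]]
  have "Plus \<C> (neg \<C> g \<cdot> f) (g \<cdot> f) = Plus \<C> (neg \<C> (g \<cdot> f)) (g \<cdot> f)"
    using comp_plus_left[OF assms(1) neg_hom[OF assms(2)] assms(2)] neg_plus[OF assms(2)]
      neg_plus[OF h(1)] zer_comp[OF assms(1) hom_obj(2)[OF assms(2)]] by simp
  then show ?thesis by (rule plus_cancel[OF h(2) neg_hom[OF h(1)] h(1)])
qed

lemma neg_neg: "f \<in> Hom \<C> X Y \<Longrightarrow> neg \<C> (neg \<C> f) = f"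
  using plus_cancel[of "neg \<C> (neg \<C> f)" X Y f "neg \<C> f"] neg_plus[of "neg \<C> f" X Y]
  by (simp add: neg_hom plus_neg)

lemma neg_zer: "X \<in> Obj \<C> \<Longrightarrow> Y \<in> Obj \<C> \<Longrightarrow> neg \<C> (Zer \<C> X Y) = Zer \<C> X Y"
  using plus_neg[of "Zer \<C> X Y" X Y] zer_plus[of "neg \<C> (Zer \<C> X Y)" X Y]
  by (simp add: neg_hom zer_hom)

lemma minus_hom: "\<lbrakk>f \<in> Hom \<C> X Y; g \<in> Hom \<C> X Y\<rbrakk> \<Longrightarrow> arr_minus \<C> f g \<in> Hom \<C> X Y"
  by (simp add: arr_minus_def plus_hom neg_hom)

lemma minus_plus: "\<lbrakk>f \<in> Hom \<C> X Y; g \<in> Hom \<C> X Y\<rbrakk> \<Longrightarrow> Plus \<C> (arr_minus \<C> f g) g = f"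
  unfolding arr_minus_def using plus_assoc[of f X Y "neg \<C> g" g]
  by (simp add: neg_hom neg_plus plus_zer)

lemma plus_minus: "\<lbrakk>f \<in> Hom \<C> X Y; g \<in> Hom \<C> X Y\<rbrakk> \<Longrightarrow> Plus \<C> g (arr_minus \<C> f g) = f"
  using plus_commute[of g X Y "arr_minus \<C> f g"] by (simp add: minus_hom minus_plus)

lemma minus_self: "f \<in> Hom \<C> X Y \<Longrightarrow> arr_minus \<C> f f = Zer \<C> X Y"
  by (simp add: arr_minus_def plus_neg)

lemma minus_zer: "f \<in> Hom \<C> X Y \<Longrightarrow> arr_minus \<C> f (Zer \<C> X Y) = f"
  unfolding arr_minus_def using neg_zer[of X Y] hom_obj[of f X Y] by (simp add: plus_zer)

lemma minus_zerD: "\<lbrakk>f \<in> Hom \<C> X Y; g \<in> Hom \<C> X Y; arr_minus \<C> f g = Zer \<C> X Y\<rbrakk> \<Longrightarrow> f = g"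
  using minus_plus[of f X Y g] by (simp add: zer_plus)

lemma minusI: "\<lbrakk>f \<in> Hom \<C> X Y; g \<in> Hom \<C> X Y; h \<in> Hom \<C> X Y; Plus \<C> h g = f\<rbrakk> \<Longrightarrow> arr_minus \<C> f g = h"
  using plus_cancel[of "arr_minus \<C> f g" X Y h g] by (simp add: minus_hom minus_plus)

lemma comp_minus: "\<lbrakk>f \<in> Hom \<C> X Y; f' \<in> Hom \<C> X Y; g \<in> Hom \<C> Y Z\<rbrakk>
    \<Longrightarrow> g \<cdot> arr_minus \<C> f f' = arr_minus \<C> (g \<cdot> f) (g \<cdot> f')"
  unfolding arr_minus_def using comp_plus_right[of f X Y "neg \<C> f'" g Z] by (simp add: neg_hom comp_neg)

lemma minus_comp: "\<lbrakk>f \<in> Hom \<C> X Y; g \<in> Hom \<C> Y Z; g' \<in> Hom \<C> Y Z\<rbrakk>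
    \<Longrightarrow> arr_minus \<C> g g' \<cdot> f = arr_minus \<C> (g \<cdot> f) (g' \<cdot> f)"
  unfolding arr_minus_def using comp_plus_left[of f X Y g Z "neg \<C> g'"] by (simp add: neg_hom neg_comp)

lemma zero_obj_hom:
  "\<lbrakk>is_zero \<C> N; f \<in> Hom \<C> N X\<rbrakk> \<Longrightarrow> f = Zer \<C> N X"
  "\<lbrakk>is_zero \<C> N; f \<in> Hom \<C> X N\<rbrakk> \<Longrightarrow> f = Zer \<C> X N"
  unfolding is_zero_def using hom_obj by blast+

end

section \<open>Morphisms modulo those that factor through a given class of objects\<close>

locale ideal_category = additive_category \<C>
  for \<C> :: "('o, 'm, 'z) cat_data_scheme" (structure) +
  fixes \<J> :: "'o set"
  assumes J_obj: "\<J> \<subseteq> Obj \<C>"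
    and J_nonempty: "\<J> \<noteq> {}"
    and J_biproduct: "\<lbrakk>X \<in> \<J>; Y \<in> \<J>; is_biproduct \<C> X Y B\<rbrakk> \<Longrightarrow> B \<in> \<J>"
begin

lemma op_ideal: "ideal_category (op_cat \<C>) \<J>"
  by (intro ideal_category.intro ideal_category_axioms.intro op_additive)
    (simp_all add: J_obj J_nonempty, rule J_biproduct)

definition null :: "'o \<Rightarrow> 'o \<Rightarrow> 'm \<Rightarrow> bool" where
  "null X Y f \<longleftrightarrow> (\<exists>J \<in> \<J>. \<exists>a \<in> Hom \<C> X J. \<exists>b \<in> Hom \<C> J Y. f = b \<cdot> a)"

definition eqv :: "'o \<Rightarrow> 'o \<Rightarrow> 'm \<Rightarrow> 'm \<Rightarrow> bool" where
  "eqv X Y f g \<longleftrightarrow> f \<in> Hom \<C> X Y \<and> g \<in> Hom \<C> X Y \<and> null X Y (arr_minus \<C> f g)"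

text \<open>Isomorphism in the quotient by \<open>\<J>\<close>, expressed through representatives;
  the quotient category itself enters only when the results are read back.\<close>

definition isoJ :: "'o \<Rightarrow> 'o \<Rightarrow> bool" where
  "isoJ X Y \<longleftrightarrow> (\<exists>f \<in> Hom \<C> X Y. \<exists>g \<in> Hom \<C> Y X.
     eqv X X (g \<cdot> f) (Idn \<C> X) \<and> eqv Y Y (f \<cdot> g) (Idn \<C> Y))"

lemma nullI: "\<lbrakk>J \<in> \<J>; a \<in> Hom \<C> X J; b \<in> Hom \<C> J Y\<rbrakk> \<Longrightarrow> null X Y (b \<cdot> a)"
  unfolding null_def by blast

lemma null_hom: "null X Y f \<Longrightarrow> f \<in> Hom \<C> X Y"
  unfolding null_def using comp_hom by blast

lemma null_comp_left: "\<lbrakk>null X Y f; g \<in> Hom \<C> Y Z\<rbrakk> \<Longrightarrow> null X Z (g \<cdot> f)"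
  unfolding null_def using comp_assoc[symmetric] comp_hom by fast

lemma null_comp_right: "\<lbrakk>null Y Z g; f \<in> Hom \<C> X Y\<rbrakk> \<Longrightarrow> null X Z (g \<cdot> f)"
  unfolding null_def using comp_assoc comp_hom by fast

lemma null_zer: assumes "X \<in> Obj \<C>" "Y \<in> Obj \<C>" shows "null X Y (Zer \<C> X Y)"
proof -
  obtain J where J: "J \<in> \<J>" "J \<in> Obj \<C>" using J_nonempty J_obj by blast
  show ?thesis using nullI[OF J(1) zer_hom[OF assms(1) J(2)] zer_hom[OF J(2) assms(2)]]
    comp_zer[OF zer_hom[OF J(2) assms(2)] assms(1)] by simp
qed

lemma null_neg: "null X Y f \<Longrightarrow> null X Y (neg \<C> f)"
  unfolding null_def using neg_comp[symmetric] neg_hom by fast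

text \<open>Factorisations through J and J' combine into one through their biproduct, with
  components (a, a') and [b, b']. Closure of \<open>\<J>\<close> under biproducts enters
  here.\<close>

lemma null_plus: assumes "null X Y f" "null X Y g" shows "null X Y (Plus \<C> f g)"
proof -
  obtain J a b where 1: "J \<in> \<J>" "a \<in> Hom \<C> X J" "b \<in> Hom \<C> J Y" "f = b \<cdot> a"
    using assms(1) unfolding null_def by blast
  obtain J' a' b' where 2: "J' \<in> \<J>" "a' \<in> Hom \<C> X J'" "b' \<in> Hom \<C> J' Y" "g = b' \<cdot> a'"
    using assms(2) unfolding null_def by blast
  obtain B where B: "is_biproduct \<C> J J' B" using ex_biproduct J_obj 1 2 by blast
  then obtain i j p q where h: "i \<in> Hom \<C> J B" "j \<in> Hom \<C> J' B" "p \<in> Hom \<C> B J" "q \<in> Hom \<C> B J'"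
    and e: "p \<cdot> i = Idn \<C> J" "q \<cdot> j = Idn \<C> J'" "p \<cdot> j = Zer \<C> J' J" "q \<cdot> i = Zer \<C> J J'"
    unfolding is_biproduct_def by blast
  have BJ: "B \<in> \<J>" using J_biproduct B 1 2 by blast
  define x where "x = Plus \<C> (i \<cdot> a) (j \<cdot> a')"
  define y where "y = Plus \<C> (b \<cdot> p) (b' \<cdot> q)"
  have ia: "i \<cdot> a \<in> Hom \<C> X B" "j \<cdot> a' \<in> Hom \<C> X B" using comp_hom 1 2 h by blast+
  have bp: "b \<cdot> p \<in> Hom \<C> B Y" "b' \<cdot> q \<in> Hom \<C> B Y" using comp_hom 1 2 h by blast+
  have x: "x \<in> Hom \<C> X B" and y: "y \<in> Hom \<C> B Y"
    unfolding x_def y_def using plus_hom ia bp by blast+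
  have a0: "X \<in> Obj \<C>" "J \<in> Obj \<C>" "J' \<in> Obj \<C>" using 1 2 hom_obj by blast+
  have px: "p \<cdot> x = a"
    unfolding x_def using comp_plus_right[OF ia h(3)] comp_assoc[OF 1(2) h(1) h(3)]
      comp_assoc[OF 2(2) h(2) h(3)] e idn_left[OF 1(2)] zer_comp[OF 2(2) a0(2)] plus_zer[OF 1(2)]
    by simp
  have qx: "q \<cdot> x = a'"
    unfolding x_def using comp_plus_right[OF ia h(4)] comp_assoc[OF 1(2) h(1) h(4)]
      comp_assoc[OF 2(2) h(2) h(4)] e idn_left[OF 2(2)] zer_comp[OF 1(2) a0(3)] zer_plus[OF 2(2)]
    by simp
  have "y \<cdot> x = Plus \<C> f g"
    unfolding y_def using comp_plus_left[OF x bp] comp_assoc[OF x h(3) 1(3)]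
      comp_assoc[OF x h(4) 2(3)] px qx 1 2 by simp
  then show ?thesis using nullI[OF BJ x y] by simp
qed

lemma null_minus: "\<lbrakk>null X Y f; null X Y g\<rbrakk> \<Longrightarrow> null X Y (arr_minus \<C> f g)"
  unfolding arr_minus_def by (simp add: null_neg null_plus)

lemma eqv_hom: "eqv X Y f g \<Longrightarrow> f \<in> Hom \<C> X Y" "eqv X Y f g \<Longrightarrow> g \<in> Hom \<C> X Y"
  by (auto simp: eqv_def)

lemma eqvI: assumes "g \<in> Hom \<C> X Y" "null X Y n" "f = Plus \<C> g n" shows "eqv X Y f g"
proof -
  note n = null_hom[OF assms(2)]
  have f: "f \<in> Hom \<C> X Y" using assms n plus_hom by blast
  have "arr_minus \<C> f g = n" using minusI[OF f assms(1) n] assms(3) plus_commute[OF assms(1) n] by simp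
  then show ?thesis using f assms unfolding eqv_def by simp
qed

lemma eqvD: "eqv X Y f g \<Longrightarrow> \<exists>n. null X Y n \<and> f = Plus \<C> g n"
  unfolding eqv_def using plus_minus[of f X Y g, symmetric] by blast

lemma eqv_refl: "f \<in> Hom \<C> X Y \<Longrightarrow> eqv X Y f f"
  by (rule eqvI[OF _ null_zer[OF hom_obj(1,2)], where f = f]) (simp_all add: plus_zer)

lemma eqv_sym: assumes "eqv X Y f g" shows "eqv X Y g f"
proof -
  obtain n where n: "null X Y n" "f = Plus \<C> g n" using eqvD[OF assms] by blast
  note h = eqv_hom[OF assms] null_hom[OF n(1)]
  have "g = Plus \<C> f (neg \<C> n)"
    using n(2) plus_assoc[OF h(2) h(3) neg_hom[OF h(3)]] plus_neg[OF h(3)] plus_zer[OF h(2)] by simp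
  then show ?thesis using eqvI[OF h(1) null_neg[OF n(1)]] by blast
qed

lemma eqv_trans [trans]: assumes "eqv X Y f g" "eqv X Y g h" shows "eqv X Y f h"
proof -
  obtain n where n: "null X Y n" "f = Plus \<C> g n" using eqvD[OF assms(1)] by blast
  obtain m where m: "null X Y m" "g = Plus \<C> h m" using eqvD[OF assms(2)] by blast
  have "f = Plus \<C> h (Plus \<C> m n)"
    using n m plus_assoc[OF eqv_hom(2)[OF assms(2)] null_hom[OF m(1)] null_hom[OF n(1)]] by simp
  then show ?thesis using eqvI[OF eqv_hom(2)[OF assms(2)] null_plus[OF m(1) n(1)]] by blast
qed

lemma eqv_comp: assumes "eqv X Y f f'" "eqv Y Z g g'" shows "eqv X Z (g \<cdot> f) (g' \<cdot> f')"
proof -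
  note h = eqv_hom[OF assms(1)] eqv_hom[OF assms(2)]
  have "eqv X Z (g \<cdot> f) (g \<cdot> f')"
    using assms(1) comp_minus[OF h(1,2,3)] null_comp_left[OF _ h(3), of X "arr_minus \<C> f f'"]
      comp_hom[OF h(1,3)] comp_hom[OF h(2,3)] unfolding eqv_def by simp
  also have "eqv X Z (g \<cdot> f') (g' \<cdot> f')"
    using assms(2) minus_comp[OF h(2,3,4)] null_comp_right[OF _ h(2), of Z "arr_minus \<C> g g'"]
      comp_hom[OF h(2,3)] comp_hom[OF h(2,4)] unfolding eqv_def by simp
  finally show ?thesis .
qed

lemma eqv_comp_left: "\<lbrakk>eqv X Y f f'; g \<in> Hom \<C> Y Z\<rbrakk> \<Longrightarrow> eqv X Z (g \<cdot> f) (g \<cdot> f')"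
  by (rule eqv_comp[OF _ eqv_refl])

lemma eqv_comp_right: "\<lbrakk>f \<in> Hom \<C> X Y; eqv Y Z g g'\<rbrakk> \<Longrightarrow> eqv X Z (g \<cdot> f) (g' \<cdot> f)"
  by (rule eqv_comp[OF eqv_refl])

lemma eqv_plus: assumes "eqv X Y f f'" "eqv X Y g g'"
  shows "eqv X Y (Plus \<C> f g) (Plus \<C> f' g')"
proof -
  have *: "eqv X Y (Plus \<C> a c) (Plus \<C> b c)" if ab: "eqv X Y a b" and c: "c \<in> Hom \<C> X Y" for a b c
  proof -
    obtain n where n: "null X Y n" "a = Plus \<C> b n" using eqvD[OF ab] by blast
    note h = eqv_hom[OF ab] null_hom[OF n(1)]
    have "Plus \<C> a c = Plus \<C> (Plus \<C> b c) n"
      using n(2) plus_assoc[OF h(2) h(3) c] plus_assoc[OF h(2) c h(3)] plus_commute[OF c h(3)] by simp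
    then show ?thesis using eqvI[OF plus_hom[OF h(2) c] n(1)] by blast
  qed
  note h = eqv_hom[OF assms(1)] eqv_hom[OF assms(2)]
  have "eqv X Y (Plus \<C> f g) (Plus \<C> f' g)" using * assms(1) h by blast
  also have "eqv X Y (Plus \<C> f' g) (Plus \<C> f' g')"
    using *[OF assms(2) h(2)] plus_commute[OF h(2,3)] plus_commute[OF h(2,4)] by simp
  finally show ?thesis .
qed

lemma eqv_null: "eqv X Y f g \<Longrightarrow> null X Y g \<Longrightarrow> null X Y f"
  using eqvD null_plus by blast

lemma null_eqv: "null X Y f \<longleftrightarrow> eqv X Y f (Zer \<C> X Y)"
  (is "?l = ?r")
proof
  assume ?l
  note h = null_hom[OF \<open>?l\<close>]
  show ?r unfolding eqv_def using h minus_zer[OF h] \<open>?l\<close> zer_hom[OF hom_obj(1,2)[OF h]] by simp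
next
  assume ?r
  then show ?l using eqv_null null_zer hom_obj[OF eqv_hom(1)[OF \<open>?r\<close>]] by blast
qed

lemma isoJ_obj: "isoJ X Y \<Longrightarrow> X \<in> Obj \<C>" "isoJ X Y \<Longrightarrow> Y \<in> Obj \<C>"
  unfolding isoJ_def using hom_obj by blast+

lemma isoJ_refl: "X \<in> Obj \<C> \<Longrightarrow> isoJ X X"
  unfolding isoJ_def using idn_hom[of X] idn_left[OF idn_hom[of X]] eqv_refl[OF idn_hom[of X]]
  by (intro bexI[of _ "Idn \<C> X"]) auto

lemma isoJ_sym: "isoJ X Y \<Longrightarrow> isoJ Y X"
  unfolding isoJ_def by blast

lemma isoJ_trans [trans]: assumes "isoJ X Y" "isoJ Y Z" shows "isoJ X Z"
proof -
  obtain f g where 1: "f \<in> Hom \<C> X Y" "g \<in> Hom \<C> Y X" "eqv X X (g \<cdot> f) (Idn \<C> X)" "eqv Y Y (f \<cdot> g) (Idn \<C> Y)"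
    using assms(1) unfolding isoJ_def by blast
  obtain h k where 2: "h \<in> Hom \<C> Y Z" "k \<in> Hom \<C> Z Y" "eqv Y Y (k \<cdot> h) (Idn \<C> Y)" "eqv Z Z (h \<cdot> k) (Idn \<C> Z)"
    using assms(2) unfolding isoJ_def by blast
  have "eqv X X (g \<cdot> (k \<cdot> h) \<cdot> f) (g \<cdot> Idn \<C> Y \<cdot> f)"
    using 1 2 by (intro eqv_comp_left[OF eqv_comp_right])
  moreover have "(g \<cdot> k) \<cdot> (h \<cdot> f) = g \<cdot> (k \<cdot> h) \<cdot> f"
    using comp_assoc[OF comp_hom[OF 1(1) 2(1)] 2(2) 1(2)] comp_assoc[OF 1(1) 2(1,2)] by simp
  ultimately have "eqv X X ((g \<cdot> k) \<cdot> (h \<cdot> f)) (Idn \<C> X)"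
    using idn_left[OF 1(1)] 1(3) eqv_trans by simp
  moreover have "eqv Z Z (h \<cdot> (f \<cdot> g) \<cdot> k) (h \<cdot> Idn \<C> Y \<cdot> k)"
    using 1 2 by (intro eqv_comp_left[OF eqv_comp_right])
  then have "eqv Z Z ((h \<cdot> f) \<cdot> (g \<cdot> k)) (Idn \<C> Z)"
    using comp_assoc[OF comp_hom[OF 2(2) 1(2)] 1(1) 2(1)] comp_assoc[OF 2(2) 1(2,1)]
      idn_left[OF 2(2)] 2(4) eqv_trans by simp
  ultimately show ?thesis
    unfolding isoJ_def using comp_hom[OF 1(1) 2(1)] comp_hom[OF 2(2) 1(2)] by blast
qed

definition null_obj :: "'o \<Rightarrow> bool" where
  "null_obj X \<longleftrightarrow> X \<in> Obj \<C> \<and> null X X (Idn \<C> X)"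

lemma J_null_obj: "X \<in> \<J> \<Longrightarrow> null_obj X"
  unfolding null_obj_def using J_obj nullI[of X "Idn \<C> X" X "Idn \<C> X" X] idn_hom[of X] idn_left by auto

lemma null_obj_iso: assumes "null_obj X" "isoJ X Y" shows "null_obj Y"
proof -
  obtain f g where 1: "f \<in> Hom \<C> X Y" "g \<in> Hom \<C> Y X" "eqv X X (g \<cdot> f) (Idn \<C> X)" "eqv Y Y (f \<cdot> g) (Idn \<C> Y)"
    using assms(2) unfolding isoJ_def by blast
  have "null Y Y (f \<cdot> Idn \<C> X \<cdot> g)"
    using assms(1) 1 null_comp_left null_comp_right unfolding null_obj_def by blast
  then have "null Y Y (f \<cdot> g)" using idn_left[OF 1(2)] by simp
  then show ?thesis
    using eqv_null[OF eqv_sym[OF 1(4)]] hom_obj(2)[OF 1(1)] unfolding null_obj_def by blast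
qed

lemma null_objs_iso: assumes "null_obj X" "null_obj Y" shows "isoJ X Y"
proof -
  have o: "X \<in> Obj \<C>" "Y \<in> Obj \<C>" using assms unfolding null_obj_def by auto
  have "eqv X X (Zer \<C> Y X \<cdot> Zer \<C> X Y) (Idn \<C> X)" "eqv Y Y (Zer \<C> X Y \<cdot> Zer \<C> Y X) (Idn \<C> Y)"
    using assms eqv_sym unfolding null_obj_def null_eqv
    by (simp_all add: comp_zer[OF zer_hom[OF o] o(2)] comp_zer[OF zer_hom[OF o(2,1)] o(1)])
  then show ?thesis unfolding isoJ_def using zer_hom o by blast
qed

end

context additive_category
begin

text \<open>Here and below the hom-set rules are restated with conditions on \<open>Arr\<close>,
  \<open>Dom\<close> and \<open>Cod\<close>. All objects are then determined by the morphisms, so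
  the simplifier can discharge the side conditions.\<close>

lemma arr_comp:
  "\<lbrakk>f \<in> Arr \<C>; g \<in> Arr \<C>; Cod \<C> f = Dom \<C> g\<rbrakk> \<Longrightarrow> g \<cdot> f \<in> Arr \<C>"
  "\<lbrakk>f \<in> Arr \<C>; g \<in> Arr \<C>; Cod \<C> f = Dom \<C> g\<rbrakk> \<Longrightarrow> Dom \<C> (g \<cdot> f) = Dom \<C> f"
  "\<lbrakk>f \<in> Arr \<C>; g \<in> Arr \<C>; Cod \<C> f = Dom \<C> g\<rbrakk> \<Longrightarrow> Cod \<C> (g \<cdot> f) = Cod \<C> g"
  using comp_hom[of f "Dom \<C> f" "Cod \<C> f" g "Cod \<C> g"] by (auto simp: Hom_def)

lemma arr_assoc:
  "\<lbrakk>f \<in> Arr \<C>; g \<in> Arr \<C>; h \<in> Arr \<C>; Cod \<C> f = Dom \<C> g; Cod \<C> g = Dom \<C> h\<rbrakk>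
    \<Longrightarrow> (h \<cdot> g) \<cdot> f = h \<cdot> (g \<cdot> f)"
  using comp_assoc[of f "Dom \<C> f" "Cod \<C> f" g "Cod \<C> g" h "Cod \<C> h"] by (auto simp: Hom_def)

lemma arr_plus:
  "\<lbrakk>f \<in> Arr \<C>; g \<in> Arr \<C>; Dom \<C> f = Dom \<C> g; Cod \<C> f = Cod \<C> g\<rbrakk> \<Longrightarrow> Plus \<C> f g \<in> Arr \<C>"
  "\<lbrakk>f \<in> Arr \<C>; g \<in> Arr \<C>; Dom \<C> f = Dom \<C> g; Cod \<C> f = Cod \<C> g\<rbrakk> \<Longrightarrow> Dom \<C> (Plus \<C> f g) = Dom \<C> f"
  "\<lbrakk>f \<in> Arr \<C>; g \<in> Arr \<C>; Dom \<C> f = Dom \<C> g; Cod \<C> f = Cod \<C> g\<rbrakk> \<Longrightarrow> Cod \<C> (Plus \<C> f g) = Cod \<C> f"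
  "\<lbrakk>f \<in> Arr \<C>; g \<in> Arr \<C>; Dom \<C> f = Dom \<C> g; Cod \<C> f = Cod \<C> g\<rbrakk> \<Longrightarrow> arr_minus \<C> f g \<in> Arr \<C>"
  "\<lbrakk>f \<in> Arr \<C>; g \<in> Arr \<C>; Dom \<C> f = Dom \<C> g; Cod \<C> f = Cod \<C> g\<rbrakk> \<Longrightarrow> Dom \<C> (arr_minus \<C> f g) = Dom \<C> f"
  "\<lbrakk>f \<in> Arr \<C>; g \<in> Arr \<C>; Dom \<C> f = Dom \<C> g; Cod \<C> f = Cod \<C> g\<rbrakk> \<Longrightarrow> Cod \<C> (arr_minus \<C> f g) = Cod \<C> f"
  using plus_hom[of f "Dom \<C> f" "Cod \<C> f" g] minus_hom[of f "Dom \<C> f" "Cod \<C> f" g]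
  by (auto simp: Hom_def)

lemma arr_idn:
  "X \<in> Obj \<C> \<Longrightarrow> Idn \<C> X \<in> Arr \<C>"
  "X \<in> Obj \<C> \<Longrightarrow> Dom \<C> (Idn \<C> X) = X"
  "X \<in> Obj \<C> \<Longrightarrow> Cod \<C> (Idn \<C> X) = X"
  "\<lbrakk>f \<in> Arr \<C>; Dom \<C> f = X\<rbrakk> \<Longrightarrow> f \<cdot> Idn \<C> X = f"
  "\<lbrakk>f \<in> Arr \<C>; Cod \<C> f = X\<rbrakk> \<Longrightarrow> Idn \<C> X \<cdot> f = f"
  using idn_hom[of X] idn_left[of f] idn_right[of f] by (auto simp: Hom_def)

lemma arr_zer:
  "\<lbrakk>X \<in> Obj \<C>; Y \<in> Obj \<C>\<rbrakk> \<Longrightarrow> Zer \<C> X Y \<in> Arr \<C>"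
  "\<lbrakk>X \<in> Obj \<C>; Y \<in> Obj \<C>\<rbrakk> \<Longrightarrow> Dom \<C> (Zer \<C> X Y) = X"
  "\<lbrakk>X \<in> Obj \<C>; Y \<in> Obj \<C>\<rbrakk> \<Longrightarrow> Cod \<C> (Zer \<C> X Y) = Y"
  "\<lbrakk>f \<in> Arr \<C>; Dom \<C> f = Y; X \<in> Obj \<C>\<rbrakk> \<Longrightarrow> f \<cdot> Zer \<C> X Y = Zer \<C> X (Cod \<C> f)"
  "\<lbrakk>f \<in> Arr \<C>; Cod \<C> f = Y; Z \<in> Obj \<C>\<rbrakk> \<Longrightarrow> Zer \<C> Y Z \<cdot> f = Zer \<C> (Dom \<C> f) Z"
  "\<lbrakk>f \<in> Arr \<C>; Dom \<C> f = X; Cod \<C> f = Y\<rbrakk> \<Longrightarrow> Plus \<C> f (Zer \<C> X Y) = f"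
  "\<lbrakk>f \<in> Arr \<C>; Dom \<C> f = X; Cod \<C> f = Y\<rbrakk> \<Longrightarrow> Plus \<C> (Zer \<C> X Y) f = f"
  "\<lbrakk>f \<in> Arr \<C>; Dom \<C> f = X; Cod \<C> f = Y\<rbrakk> \<Longrightarrow> arr_minus \<C> f (Zer \<C> X Y) = f"
  "\<lbrakk>f \<in> Arr \<C>\<rbrakk> \<Longrightarrow> arr_minus \<C> f f = Zer \<C> (Dom \<C> f) (Cod \<C> f)"
  using zer_hom[of X Y] comp_zer[of f Y] zer_comp[of f _ Y Z] plus_zer[of f X Y] zer_plus[of f X Y]
    minus_zer[of f X Y] minus_self[of f] by (auto simp: Hom_def)

lemma arr_dist:
  "\<lbrakk>f \<in> Arr \<C>; f' \<in> Arr \<C>; g \<in> Arr \<C>; Dom \<C> f = Dom \<C> f'; Cod \<C> f = Cod \<C> f'; Cod \<C> f = Dom \<C> g\<rbrakk>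
    \<Longrightarrow> g \<cdot> Plus \<C> f f' = Plus \<C> (g \<cdot> f) (g \<cdot> f')"
  "\<lbrakk>f \<in> Arr \<C>; f' \<in> Arr \<C>; g \<in> Arr \<C>; Dom \<C> f = Dom \<C> f'; Cod \<C> f = Cod \<C> f'; Cod \<C> f = Dom \<C> g\<rbrakk>
    \<Longrightarrow> g \<cdot> arr_minus \<C> f f' = arr_minus \<C> (g \<cdot> f) (g \<cdot> f')"
  "\<lbrakk>f \<in> Arr \<C>; g \<in> Arr \<C>; g' \<in> Arr \<C>; Dom \<C> g = Dom \<C> g'; Cod \<C> g = Cod \<C> g'; Cod \<C> f = Dom \<C> g\<rbrakk>
    \<Longrightarrow> Plus \<C> g g' \<cdot> f = Plus \<C> (g \<cdot> f) (g' \<cdot> f)"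
  "\<lbrakk>f \<in> Arr \<C>; g \<in> Arr \<C>; g' \<in> Arr \<C>; Dom \<C> g = Dom \<C> g'; Cod \<C> g = Cod \<C> g'; Cod \<C> f = Dom \<C> g\<rbrakk>
    \<Longrightarrow> arr_minus \<C> g g' \<cdot> f = arr_minus \<C> (g \<cdot> f) (g' \<cdot> f)"
  using comp_plus_right[of f "Dom \<C> f" "Cod \<C> f" f' g "Cod \<C> g"]
    comp_minus[of f "Dom \<C> f" "Cod \<C> f" f' g "Cod \<C> g"]
    comp_plus_left[of f "Dom \<C> f" "Cod \<C> f" g "Cod \<C> g" g']
    minus_comp[of f "Dom \<C> f" "Cod \<C> f" g "Cod \<C> g" g'] by (auto simp: Hom_def)

lemmas arr_simps = arr_comp arr_assoc arr_plus arr_idn arr_zer arr_dist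

end

section \<open>A self-dual calculus of distinguished pairs\<close>

text \<open>\<open>tri X f Y g Z\<close> stands for a triangle \<open>X \<rightarrow> Y \<rightarrow> Z \<rightarrow> X[1]\<close> whose third morphism is not
  recorded.  Formulated without the shift, the octahedral axiom splits into several instances, but
  the axioms are then invariant under passing to the opposite category, so that every lemma
  below also yields its dual.\<close>

locale pair_category = ideal_category \<C> \<J>
  for \<C> :: "('o, 'm, 'z) cat_data_scheme" (structure) and \<J> :: "'o set" +
  fixes tri :: "'o \<Rightarrow> 'm \<Rightarrow> 'o \<Rightarrow> 'm \<Rightarrow> 'o \<Rightarrow> bool"
  assumes tri_hom: "tri X f Y g Z \<Longrightarrow> f \<in> Hom \<C> X Y \<and> g \<in> Hom \<C> Y Z"
    and tri_cone: "f \<in> Hom \<C> X Y \<Longrightarrow> \<exists>g Z. tri X f Y g Z"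
    and tri_fiber: "g \<in> Hom \<C> Y Z \<Longrightarrow> \<exists>X f. tri X f Y g Z"
    and tri_comp: "tri X f Y g Z \<Longrightarrow> g \<cdot> f = Zer \<C> X Z"
    and tri_lift: "\<lbrakk>tri X f Y g Z; x \<in> Hom \<C> W Y; g \<cdot> x = Zer \<C> W Z\<rbrakk>
      \<Longrightarrow> \<exists>x' \<in> Hom \<C> W X. x = f \<cdot> x'"
    and tri_extend: "\<lbrakk>tri X f Y g Z; x \<in> Hom \<C> Y W; x \<cdot> f = Zer \<C> X W\<rbrakk>
      \<Longrightarrow> \<exists>x' \<in> Hom \<C> Z W. x = x' \<cdot> g"
    \<comment> \<open>Both splittings mean that the unrecorded third morphism vanishes; the two
      axioms express this without naming it.\<close>
    and split_epi: "\<lbrakk>tri X f Y g Z; s \<in> Hom \<C> Z Y; g \<cdot> s = Idn \<C> Z\<rbrakk>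
      \<Longrightarrow> \<exists>r \<in> Hom \<C> Y X. r \<cdot> f = Idn \<C> X"
    and split_mono: "\<lbrakk>tri X f Y g Z; r \<in> Hom \<C> Y X; r \<cdot> f = Idn \<C> X\<rbrakk>
      \<Longrightarrow> \<exists>s \<in> Hom \<C> Z Y. g \<cdot> s = Idn \<C> Z"
    and tri_biproduct: "\<lbrakk>X \<in> Obj \<C>; Y \<in> Obj \<C>\<rbrakk>
      \<Longrightarrow> \<exists>B i j p q. tri X i B q Y \<and> tri Y j B p X \<and> p \<cdot> i = Idn \<C> X \<and> q \<cdot> j = Idn \<C> Y \<and>
        Plus \<C> (i \<cdot> p) (j \<cdot> q) = Idn \<C> B"
    and tri_idn: "\<lbrakk>X \<in> Obj \<C>; is_zero \<C> N\<rbrakk>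
      \<Longrightarrow> tri X (Idn \<C> X) X (Zer \<C> X N) N \<and> tri N (Zer \<C> N X) X (Idn \<C> X) X"
    \<comment> \<open>The last clause is half of a weak pull-back property: morphisms into Z' and Y
      that agree in Z lift to Y' over Z'. It stands in for an argument with the connecting
      morphism.\<close>
    and oct_comp: "\<lbrakk>tri X f Y g Z; tri Z' z Z w W\<rbrakk> \<Longrightarrow> \<exists>Y' y f' g'.
      tri Y' y Y (w \<cdot> g) W \<and> tri X f' Y' g' Z' \<and> y \<cdot> f' = f \<and>
      (\<forall>A a b. a \<in> Hom \<C> A Z' \<longrightarrow> b \<in> Hom \<C> A Y \<longrightarrow> g \<cdot> b = z \<cdot> a \<longrightarrow>
        (\<exists>c \<in> Hom \<C> A Y'. g' \<cdot> c = a))"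
    and oct_comp_op: "\<lbrakk>tri X f Y g Z; tri W w X x X'\<rbrakk> \<Longrightarrow> \<exists>Y' y f' g'.
      tri W (f \<cdot> w) Y y Y' \<and> tri X' f' Y' g' Z \<and> g' \<cdot> y = g \<and>
      (\<forall>A a b. a \<in> Hom \<C> X' A \<longrightarrow> b \<in> Hom \<C> Y A \<longrightarrow> b \<cdot> f = a \<cdot> x \<longrightarrow>
        (\<exists>c \<in> Hom \<C> Y' A. c \<cdot> f' = a))"
    and oct_pull: "\<lbrakk>tri X f Y g Z; tri K k Z' z Z\<rbrakk> \<Longrightarrow> \<exists>P f' g' k' y.
      tri X f' P g' Z' \<and> tri K k' P y Y \<and> y \<cdot> f' = f \<and> g' \<cdot> k' = k \<and> g \<cdot> y = z \<cdot> g'"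
    and oct_push: "\<lbrakk>tri X f Y g Z; tri X x X' c K\<rbrakk> \<Longrightarrow> \<exists>P f' g' y c'.
      tri X' f' P g' Z \<and> tri Y y P c' K \<and> g' \<cdot> y = g \<and> c' \<cdot> f' = c \<and> y \<cdot> f = f' \<cdot> x"
begin

abbreviation tri_op :: "'o \<Rightarrow> 'm \<Rightarrow> 'o \<Rightarrow> 'm \<Rightarrow> 'o \<Rightarrow> bool" where
  "tri_op X f Y g Z \<equiv> tri Z g Y f X"

text \<open>The axioms are self-dual or come in mirror pairs, so each obligation is the partner
  axiom with f and g exchanged.\<close>

lemma op_pair: "pair_category (op_cat \<C>) \<J> tri_op"
proof (intro pair_category.intro pair_category_axioms.intro op_ideal, unfold op_cat_simps is_zero_op_cat)
  show "tri Z g Y f X \<Longrightarrow> f \<in> Hom \<C> Y X \<and> g \<in> Hom \<C> Z Y" for X f Y g Z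
    using tri_hom by blast
  show "f \<in> Hom \<C> Y X \<Longrightarrow> \<exists>g Z. tri Z g Y f X" for f Y X using tri_fiber by blast
  show "g \<in> Hom \<C> Z Y \<Longrightarrow> \<exists>X f. tri Z g Y f X" for g Y Z using tri_cone by blast
  show "tri Z g Y f X \<Longrightarrow> f \<cdot> g = Zer \<C> Z X" for X f Y g Z using tri_comp by blast
  show "\<exists>x' \<in> Hom \<C> X W. x = x' \<cdot> f"
    if "tri Z g Y f X" "x \<in> Hom \<C> Y W" "x \<cdot> g = Zer \<C> Z W" for X f Y g Z x W
    using tri_extend that by blast
  show "\<exists>x' \<in> Hom \<C> W Z. x = g \<cdot> x'"
    if "tri Z g Y f X" "x \<in> Hom \<C> W Y" "f \<cdot> x = Zer \<C> W X" for X f Y g Z x W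
    using tri_lift that by blast
  show "\<exists>r \<in> Hom \<C> X Y. f \<cdot> r = Idn \<C> X"
    if "tri Z g Y f X" "s \<in> Hom \<C> Y Z" "s \<cdot> g = Idn \<C> Z" for X f Y g Z s
    using split_mono that by blast
  show "\<exists>s \<in> Hom \<C> Y Z. s \<cdot> g = Idn \<C> Z"
    if "tri Z g Y f X" "r \<in> Hom \<C> X Y" "f \<cdot> r = Idn \<C> X" for X f Y g Z r
    using split_epi that by blast
  show "\<exists>B i j p q. tri Y q B i X \<and> tri X p B j Y \<and> i \<cdot> p = Idn \<C> X \<and> j \<cdot> q = Idn \<C> Y \<and>
        Plus \<C> (p \<cdot> i) (q \<cdot> j) = Idn \<C> B" if "X \<in> Obj \<C>" "Y \<in> Obj \<C>" for X Y
    using tri_biproduct[OF that] by blast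
  show "tri N (Zer \<C> N X) X (Idn \<C> X) X \<and> tri X (Idn \<C> X) X (Zer \<C> X N) N"
    if "X \<in> Obj \<C>" "is_zero \<C> N" for X N using tri_idn that by blast
  show "\<exists>Y' y f' g'.
      tri W (g \<cdot> w) Y y Y' \<and> tri Z' g' Y' f' X \<and> f' \<cdot> y = f \<and>
      (\<forall>A a b. a \<in> Hom \<C> Z' A \<longrightarrow> b \<in> Hom \<C> Y A \<longrightarrow> b \<cdot> g = a \<cdot> z \<longrightarrow>
        (\<exists>c \<in> Hom \<C> Y' A. c \<cdot> g' = a))"
    if "tri Z g Y f X" "tri W w Z z Z'" for X f Y g Z Z' z W w
    using oct_comp_op[OF that] by blast
  show "\<exists>Y' y f' g'.
      tri Y' y Y (w \<cdot> f) W \<and> tri Z g' Y' f' X' \<and> y \<cdot> g' = g \<and>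
      (\<forall>A a b. a \<in> Hom \<C> A X' \<longrightarrow> b \<in> Hom \<C> A Y \<longrightarrow> f \<cdot> b = x \<cdot> a \<longrightarrow>
        (\<exists>c \<in> Hom \<C> A Y'. f' \<cdot> c = a))"
    if "tri Z g Y f X" "tri X' x X w W" for X f Y g Z X' x W w
    using oct_comp[OF that] by blast
  show "\<exists>P f' g' k' y.
      tri Z' g' P f' X \<and> tri Y y P k' K \<and> f' \<cdot> y = f \<and> k' \<cdot> g' = k \<and> y \<cdot> g = g' \<cdot> z"
    if "tri Z g Y f X" "tri Z z Z' k K" for X f Y g Z K k Z' z
    using oct_push[OF that] by blast
  show "\<exists>P f' g' y c'.
      tri Z g' P f' X' \<and> tri K c' P y Y \<and> y \<cdot> g' = g \<and> f' \<cdot> c' = c \<and> f \<cdot> y = x \<cdot> f'"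
    if "tri Z g Y f X" "tri K c X' x X" for X f Y g Z X' x K c
    using oct_pull[OF that] by blast
qed

lemma tri_homs:
  assumes "tri X f Y g Z"
  shows "f \<in> Hom \<C> X Y" "g \<in> Hom \<C> Y Z" "X \<in> Obj \<C>" "Y \<in> Obj \<C>" "Z \<in> Obj \<C>"
  using tri_hom[OF assms] hom_obj by blast+

text \<open>The retraction supplied by \<open>split_epi\<close> need not vanish on s. The right one
  is the factorisation through f of id - s g, a morphism killed by g.\<close>

lemma tri_split:
  assumes t: "tri X f Y g Z" and s: "s \<in> Hom \<C> Z Y" "g \<cdot> s = Idn \<C> Z"
  shows "\<exists>r \<in> Hom \<C> Y X. r \<cdot> f = Idn \<C> X \<and> r \<cdot> s = Zer \<C> Z X \<and> Plus \<C> (f \<cdot> r) (s \<cdot> g) = Idn \<C> Y"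
proof -
  note h = tri_homs[OF t] s(1)
  obtain r0 where r0: "r0 \<in> Hom \<C> Y X" "r0 \<cdot> f = Idn \<C> X" using split_epi[OF t s] by blast
  have sg: "s \<cdot> g \<in> Hom \<C> Y Y" "Idn \<C> Y \<in> Hom \<C> Y Y" using comp_hom h idn_hom by blast+
  have "g \<cdot> s \<cdot> g = g" using comp_assoc[OF h(2) s(1) h(2)] s(2) idn_left[OF h(2)] by simp
  then have "g \<cdot> arr_minus \<C> (Idn \<C> Y) (s \<cdot> g) = Zer \<C> Y Z"
    using comp_minus[OF sg(2,1) h(2)] minus_self[OF h(2)] idn_right[OF h(2)] by simp
  then obtain r where r: "r \<in> Hom \<C> Y X" "arr_minus \<C> (Idn \<C> Y) (s \<cdot> g) = f \<cdot> r"
    using tri_lift[OF t minus_hom[OF sg(2,1)]] by blast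
  \<comment> \<open>Since r0 is a left inverse of f, r equals r0 (id - s g), and the equations for r
    f and r s can be computed.\<close>
  have r': "r = r0 \<cdot> arr_minus \<C> (Idn \<C> Y) (s \<cdot> g)"
    unfolding r(2) using comp_assoc[OF r(1) h(1) r0(1)] r0(2) idn_left[OF r(1)] by simp
  have gf: "g \<cdot> f = Zer \<C> X Z" by (rule tri_comp[OF t])
  have "r \<cdot> f = r0 \<cdot> f" unfolding r'
    using h gf r0(1) by (simp add: Hom_def arr_simps)
  moreover have "r \<cdot> s = Zer \<C> Z X" unfolding r'
    using h s(2) r0(1) by (simp add: Hom_def arr_simps)
  moreover have "Plus \<C> (f \<cdot> r) (s \<cdot> g) = Idn \<C> Y"
    unfolding r(2)[symmetric] by (rule minus_plus[OF sg(2,1)])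
  ultimately show ?thesis using r(1) r0(2) by auto
qed

text \<open>Vanishing of \<open>Ext\<^sup>1(X, Y)\<close>: every triangle \<open>Y \<rightarrow> E \<rightarrow> X \<rightarrow> Y[1]\<close> splits.\<close>

definition ext0 :: "'o \<Rightarrow> 'o \<Rightarrow> bool" where
  "ext0 X Y \<longleftrightarrow> (\<forall>E f g. tri Y f E g X \<longrightarrow> (\<exists>s \<in> Hom \<C> X E. g \<cdot> s = Idn \<C> X))"

lemma ext0D: "\<lbrakk>ext0 X Y; tri Y f E g X\<rbrakk> \<Longrightarrow> \<exists>s \<in> Hom \<C> X E. g \<cdot> s = Idn \<C> X"
  unfolding ext0_def by blast

lemma ext0_op: "pair_category.ext0 (op_cat \<C>) tri_op X Y \<longleftrightarrow> ext0 Y X"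
  unfolding pair_category.ext0_def[OF op_pair] ext0_def op_cat_simps
  using split_epi split_mono by blast

text \<open>The obstruction to lifting x along g is an extension of X by A, namely the pull-back of
  the triangle along x. It splits, and its section composed with P -> E is the lift.\<close>

lemma ext_lift:
  assumes e: "ext0 X A" and t: "tri A f E g Z" and x: "x \<in> Hom \<C> X Z"
  shows "\<exists>x' \<in> Hom \<C> X E. g \<cdot> x' = x"
proof -
  obtain K k where "tri K k X x Z" using tri_fiber[OF x] by blast
  from oct_pull[OF t this] obtain P f' g' k' y where
    P: "tri A f' P g' X" "tri K k' P y E" "g \<cdot> y = x \<cdot> g'" by blast
  obtain s where s: "s \<in> Hom \<C> X P" "g' \<cdot> s = Idn \<C> X" using ext0D[OF e P(1)] by blast
  have "g \<cdot> (y \<cdot> s) = x"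
    using comp_assoc[OF s(1) tri_homs(2)[OF P(2)] tri_homs(2)[OF t]] P(3)
      comp_assoc[OF s(1) tri_homs(2)[OF P(1)] x] s(2) idn_right[OF x] by simp
  then show ?thesis using comp_hom[OF s(1) tri_homs(2)[OF P(2)]] by blast
qed

lemma ext_extend:
  assumes "ext0 X A" "tri W f E g X" "h \<in> Hom \<C> W A"
  shows "\<exists>h' \<in> Hom \<C> E A. h' \<cdot> f = h"
  using pair_category.ext_lift[OF op_pair, where X = A and A = X and f = g and E = E and g = f
      and Z = W and x = h] assms by (simp add: ext0_op)

text \<open>Half-exactness of Ext^1(X, -): an extension of X by B induces one by D, whose section
  then lifts because Ext^1(X, A) vanishes.\<close>

lemma ext0_right: assumes t: "tri A f B g D" and e: "ext0 X A" "ext0 X D" shows "ext0 X B"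
  unfolding ext0_def
proof (intro allI impI)
  fix E i p assume E: "tri B i E p X"
  from oct_comp_op[OF this t] obtain Y y f' g' where
    Y: "tri A (i \<cdot> f) E y Y" "tri D f' Y g' X" "g' \<cdot> y = p" by blast
  obtain s' where s': "s' \<in> Hom \<C> X Y" "g' \<cdot> s' = Idn \<C> X" using ext0D[OF e(2) Y(2)] by blast
  obtain s where s: "s \<in> Hom \<C> X E" "y \<cdot> s = s'" using ext_lift[OF e(1) Y(1) s'(1)] by blast
  have "p \<cdot> s = Idn \<C> X"
    using comp_assoc[OF s(1) tri_homs(2)[OF Y(1)] tri_homs(2)[OF Y(2)]] Y(3) s(2) s'(2) by simp
  then show "\<exists>s \<in> Hom \<C> X E. p \<cdot> s = Idn \<C> X" using s by blast
qed

lemma ext0_left: "\<lbrakk>tri A f B g D; ext0 A Y; ext0 D Y\<rbrakk> \<Longrightarrow> ext0 B Y"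
  using pair_category.ext0_right[OF op_pair, where A = D and f = g and B = B and g = f and D = A
      and X = Y] by (simp add: ext0_op)

text \<open>Modulo \<open>\<J>\<close> the object X is a retract of X', that is, id = b a + d c with
  d defined on an object of \<open>\<J>\<close>. Lifting b and d separately gives the
  section.\<close>

lemma ext0_retract_left:
  assumes a: "a \<in> Hom \<C> X X'" "b \<in> Hom \<C> X' X" "eqv X X (Idn \<C> X) (b \<cdot> a)"
    and e: "ext0 X' Y" "\<And>J. J \<in> \<J> \<Longrightarrow> ext0 J Y"
  shows "ext0 X Y"
  unfolding ext0_def
proof (intro allI impI)
  fix E i p assume E: "tri Y i E p X"
  obtain n where n: "null X X n" "Idn \<C> X = Plus \<C> (b \<cdot> a) n" using eqvD[OF a(3)] by blast
  then obtain J c d where J: "J \<in> \<J>" "c \<in> Hom \<C> X J" "d \<in> Hom \<C> J X" "n = d \<cdot> c"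
    unfolding null_def by blast
  obtain b' where b': "b' \<in> Hom \<C> X' E" "p \<cdot> b' = b" using ext_lift[OF e(1) E a(2)] by blast
  obtain d' where d': "d' \<in> Hom \<C> J E" "p \<cdot> d' = d" using ext_lift[OF e(2)[OF J(1)] E J(3)] by blast
  have "p \<cdot> Plus \<C> (b' \<cdot> a) (d' \<cdot> c) = Idn \<C> X"
    using comp_plus_right[OF comp_hom[OF a(1) b'(1)] comp_hom[OF J(2) d'(1)] tri_homs(2)[OF E]]
      comp_assoc[OF a(1) b'(1) tri_homs(2)[OF E]] comp_assoc[OF J(2) d'(1) tri_homs(2)[OF E]]
      b'(2) d'(2) n(2) J(4) by simp
  then show "\<exists>s \<in> Hom \<C> X E. p \<cdot> s = Idn \<C> X"
    using plus_hom[OF comp_hom[OF a(1) b'(1)] comp_hom[OF J(2) d'(1)]] by blast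
qed

lemma ext0_isoJ_left:
  assumes "isoJ X X'" "ext0 X' Y" "\<And>J. J \<in> \<J> \<Longrightarrow> ext0 J Y"
  shows "ext0 X Y"
proof -
  obtain f g where "f \<in> Hom \<C> X X'" "g \<in> Hom \<C> X' X" "eqv X X (g \<cdot> f) (Idn \<C> X)"
    using assms(1) unfolding isoJ_def by blast
  then show ?thesis using ext0_retract_left assms(2,3) eqv_sym by blast
qed

lemma op_neg: "neg (op_cat \<C>) f = neg \<C> f" if "f \<in> Hom \<C> X Y"
proof -
  interpret op: additive_category "op_cat \<C>" by (rule op_additive)
  have f: "f \<in> Hom (op_cat \<C>) Y X" using that by simp
  have "Plus \<C> (neg (op_cat \<C>) f) f = Plus \<C> (neg \<C> f) f"
    using op.neg_plus[OF f] neg_plus[OF that] by simp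
  then show ?thesis
    using plus_cancel[OF _ neg_hom[OF that] that] op.neg_hom[OF f] by simp
qed

lemma op_null: "ideal_category.null (op_cat \<C>) \<J> X Y f \<longleftrightarrow> null Y X f"
  unfolding ideal_category.null_def[OF op_ideal] null_def by auto

lemma op_eqv: "ideal_category.eqv (op_cat \<C>) \<J> X Y f g \<longleftrightarrow> eqv Y X f g"
  unfolding ideal_category.eqv_def[OF op_ideal] eqv_def
  by (auto simp: op_null arr_minus_def op_neg)

lemma op_isoJ: "ideal_category.isoJ (op_cat \<C>) \<J> X Y \<longleftrightarrow> isoJ X Y"
  unfolding ideal_category.isoJ_def[OF op_ideal] isoJ_def by (auto simp: op_eqv)

lemma op_null_obj: "ideal_category.null_obj (op_cat \<C>) \<J> X \<longleftrightarrow> null_obj X"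
  unfolding ideal_category.null_obj_def[OF op_ideal] null_obj_def by (auto simp: op_null)

lemmas op_simps = ext0_op op_null op_eqv op_isoJ op_null_obj op_cat_simps

lemma ext0_isoJ_right:
  "\<lbrakk>isoJ X X'; ext0 Y X'; \<And>J. J \<in> \<J> \<Longrightarrow> ext0 Y J\<rbrakk> \<Longrightarrow> ext0 Y X"
  using pair_category.ext0_isoJ_left[OF op_pair, of X X' Y] by (simp add: op_simps)

lemma null_obj_ext0: "\<lbrakk>null_obj X; \<And>J. J \<in> \<J> \<Longrightarrow> ext0 J Y\<rbrakk> \<Longrightarrow> ext0 X Y"
proof -
  assume X: "null_obj X" and e: "\<And>J. J \<in> \<J> \<Longrightarrow> ext0 J Y"
  obtain J where J: "J \<in> \<J>" using J_nonempty by blast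
  show ?thesis using ext0_isoJ_left[OF null_objs_iso[OF X J_null_obj[OF J]]] e J by blast
qed

text \<open>The triangle splits, so Q is the biproduct of K and X, and the summand K vanishes modulo
  \<open>\<J>\<close>.\<close>

lemma split_isoJ:
  assumes t: "tri K f Q g X" and "K \<in> \<J>" "ext0 X K" shows "isoJ Q X"
proof -
  note h = tri_homs[OF t]
  obtain s where s: "s \<in> Hom \<C> X Q" "g \<cdot> s = Idn \<C> X" using ext0D[OF assms(3) t] by blast
  obtain r where r: "r \<in> Hom \<C> Q K" "Plus \<C> (f \<cdot> r) (s \<cdot> g) = Idn \<C> Q"
    using tri_split[OF t s] by blast
  have sg: "s \<cdot> g \<in> Hom \<C> Q Q" "f \<cdot> r \<in> Hom \<C> Q Q" using comp_hom s r h by blast+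
  have "eqv Q Q (Idn \<C> Q) (s \<cdot> g)"
    using eqvI[OF sg(1) nullI[OF assms(2) r(1) h(1)]] r(2) plus_commute[OF sg] by simp
  moreover have "eqv X X (g \<cdot> s) (Idn \<C> X)" using s(2) eqv_refl idn_hom h by simp
  ultimately show ?thesis unfolding isoJ_def using h s eqv_sym by blast
qed

lemma split_isoJ_op: "\<lbrakk>tri X f Q g K; K \<in> \<J>; ext0 K X\<rbrakk> \<Longrightarrow> isoJ Q X"
  using pair_category.split_isoJ[OF op_pair, where K = K and f = g and Q = Q and g = f and X = X]
  by (simp add: op_simps)

lemma ext0_zero: assumes "is_zero \<C> N" "Y \<in> Obj \<C>" shows "ext0 N Y"
  unfolding ext0_def
proof (intro allI impI)
  fix E i p assume E: "tri Y i E p N"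
  note h = tri_homs[OF E]
  have "p \<cdot> Zer \<C> N E = Idn \<C> N"
    using zero_obj_hom(1)[OF assms(1) idn_hom] comp_zer[OF h(2) h(5)] h by simp
  then show "\<exists>s \<in> Hom \<C> N E. p \<cdot> s = Idn \<C> N" using zer_hom h by blast
qed

end

section \<open>Concentric twin cotorsion pairs\<close>

text \<open>Each class is given as a full Ext-orthogonal, from which closure under extensions,
  summands and isomorphism modulo \<open>\<J>\<close> follows. In this form reversing all arrows
  just exchanges S with V and T with U.\<close>

locale twin = pair_category \<C> \<J> tri
  for \<C> :: "('o, 'm, 'z) cat_data_scheme" (structure) and \<J> :: "'o set"
    and tri :: "'o \<Rightarrow> 'm \<Rightarrow> 'o \<Rightarrow> 'm \<Rightarrow> 'o \<Rightarrow> bool" +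
  fixes S T U V :: "'o set"
  assumes S_iff: "X \<in> S \<longleftrightarrow> X \<in> Obj \<C> \<and> (\<forall>Y \<in> T. ext0 X Y)"
    and T_iff: "Y \<in> T \<longleftrightarrow> Y \<in> Obj \<C> \<and> (\<forall>X \<in> S. ext0 X Y)"
    and U_iff: "X \<in> U \<longleftrightarrow> X \<in> Obj \<C> \<and> (\<forall>Y \<in> V. ext0 X Y)"
    and V_iff: "Y \<in> V \<longleftrightarrow> Y \<in> Obj \<C> \<and> (\<forall>X \<in> U. ext0 X Y)"
    and S_cover: "X \<in> Obj \<C> \<Longrightarrow> \<exists>Y f A g. Y \<in> T \<and> A \<in> S \<and> tri Y f A g X"
    and T_hull: "X \<in> Obj \<C> \<Longrightarrow> \<exists>f A g Y. A \<in> T \<and> Y \<in> S \<and> tri X f A g Y"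
    and U_cover: "X \<in> Obj \<C> \<Longrightarrow> \<exists>Y f A g. Y \<in> V \<and> A \<in> U \<and> tri Y f A g X"
    and V_hull: "X \<in> Obj \<C> \<Longrightarrow> \<exists>f A g Y. A \<in> V \<and> Y \<in> U \<and> tri X f A g Y"
    and S_U: "S \<subseteq> U" and V_T: "V \<subseteq> T"
    and J_ST: "\<J> = S \<inter> T" and J_UV: "\<J> = U \<inter> V"
begin

lemma op_twin: "twin (op_cat \<C>) \<J> tri_op V U T S"
proof (intro twin.intro twin_axioms.intro op_pair, unfold op_simps)
  show "\<exists>Y f A g. Y \<in> U \<and> A \<in> V \<and> tri X g A f Y" if "X \<in> Obj \<C>" for X
    using V_hull[OF that] by blast
  show "\<exists>f A g Y. A \<in> U \<and> Y \<in> V \<and> tri Y g A f X" if "X \<in> Obj \<C>" for X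
    using U_cover[OF that] by blast
  show "\<exists>Y f A g. Y \<in> S \<and> A \<in> T \<and> tri X g A f Y" if "X \<in> Obj \<C>" for X
    using T_hull[OF that] by blast
  show "\<exists>f A g Y. A \<in> S \<and> Y \<in> T \<and> tri Y g A f X" if "X \<in> Obj \<C>" for X
    using S_cover[OF that] by blast
qed (rule V_iff U_iff T_iff S_iff | use S_U V_T J_ST J_UV in blast)+

text \<open>\<open>srel X A\<close> says that \<open>A\<close> is a value of \<open>\<sigma>\<close> at \<open>X\<close> for some choice of triangle.  In the same sense
  \<open>wrel\<close>, \<open>Srel\<close> and \<open>Orel\<close> stand for \<open>\<omega>\<close>, for \<open>\<Sigma>\<close> and for its quasi-inverse \<open>\<Omega>\<close>.  Working with relations
  keeps the definitions self-dual and independent of choices.\<close>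

definition srel :: "'o \<Rightarrow> 'o \<Rightarrow> bool" where
  "srel X A \<longleftrightarrow> A \<in> T \<and> (\<exists>t B s. B \<in> S \<and> tri X t A s B)"

definition wrel :: "'o \<Rightarrow> 'o \<Rightarrow> bool" where
  "wrel X A \<longleftrightarrow> A \<in> U \<and> (\<exists>v B u. B \<in> V \<and> tri B v A u X)"

definition Srel :: "'o \<Rightarrow> 'o \<Rightarrow> bool" where
  "Srel R Y \<longleftrightarrow> (\<exists>i I p R1. I \<in> \<J> \<and> R1 \<in> U \<and> tri R i I p R1 \<and> srel R1 Y)"

definition Orel :: "'o \<Rightarrow> 'o \<Rightarrow> bool" where
  "Orel Y R \<longleftrightarrow> (\<exists>i I p Y1. I \<in> \<J> \<and> Y1 \<in> T \<and> tri Y1 i I p Y \<and> wrel Y1 R)"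

lemma op_rel:
  "twin.srel tri_op V U X A \<longleftrightarrow> wrel X A"
  "twin.wrel tri_op T S X A \<longleftrightarrow> srel X A"
  "twin.Srel \<J> tri_op V U T X A \<longleftrightarrow> Orel X A"
  "twin.Orel \<J> tri_op U T S X A \<longleftrightarrow> Srel X A"
  unfolding twin.srel_def[OF op_twin] twin.wrel_def[OF op_twin] twin.Srel_def[OF op_twin]
    twin.Orel_def[OF op_twin] srel_def wrel_def Srel_def Orel_def by blast+

lemmas twin_op_simps = op_rel op_simps

lemma ext_ST: "X \<in> S \<Longrightarrow> Y \<in> T \<Longrightarrow> ext0 X Y" and ext_UV: "X \<in> U \<Longrightarrow> Y \<in> V \<Longrightarrow> ext0 X Y"
  using S_iff U_iff by blast+

lemma mem_obj: "X \<in> S \<Longrightarrow> X \<in> Obj \<C>" "X \<in> T \<Longrightarrow> X \<in> Obj \<C>" "X \<in> U \<Longrightarrow> X \<in> Obj \<C>" "X \<in> V \<Longrightarrow> X \<in> Obj \<C>"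
  using S_iff T_iff U_iff V_iff by blast+

lemma J_mem: "X \<in> \<J> \<Longrightarrow> X \<in> S" "X \<in> \<J> \<Longrightarrow> X \<in> T" "X \<in> \<J> \<Longrightarrow> X \<in> U" "X \<in> \<J> \<Longrightarrow> X \<in> V"
  using J_ST J_UV by auto

lemma J_ext: "J \<in> \<J> \<Longrightarrow> Y \<in> T \<Longrightarrow> ext0 J Y" "J \<in> \<J> \<Longrightarrow> X \<in> U \<Longrightarrow> ext0 X J"
  using ext_ST ext_UV J_mem by blast+

lemma S_extension: "tri X f Y g Z \<Longrightarrow> X \<in> S \<Longrightarrow> Z \<in> S \<Longrightarrow> Y \<in> S"
  using ext0_left ext_ST tri_homs(4) S_iff by metis

lemma U_extension: "tri X f Y g Z \<Longrightarrow> X \<in> U \<Longrightarrow> Z \<in> U \<Longrightarrow> Y \<in> U"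
  using ext0_left ext_UV tri_homs(4) U_iff by metis

lemma T_extension: "tri X f Y g Z \<Longrightarrow> X \<in> T \<Longrightarrow> Z \<in> T \<Longrightarrow> Y \<in> T"
  using ext0_right ext_ST tri_homs(4) T_iff by metis

lemma J_extension: "tri X f Y g Z \<Longrightarrow> X \<in> \<J> \<Longrightarrow> Z \<in> \<J> \<Longrightarrow> Y \<in> \<J>"
  using S_extension T_extension J_ST by blast

text \<open>Vanishing of Ext^1 into T, or from U, passes from \<open>\<J>\<close> to objects that
  vanish modulo \<open>\<J>\<close>. Such an object lies in S and in V, and V is contained in
  T.\<close>

lemma null_obj_J: "null_obj X \<longleftrightarrow> X \<in> \<J>"
proof
  assume X: "null_obj X"
  have o: "X \<in> Obj \<C>" using X unfolding null_obj_def by blast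
  have "ext0 X Y" if "Y \<in> T" for Y
    by (rule null_obj_ext0[OF X J_ext(1)[OF _ that]])
  then have "X \<in> S" using S_iff o by blast
  moreover have "ext0 Y X" if "Y \<in> U" for Y
    using pair_category.null_obj_ext0[OF op_pair, of X Y] X J_ext(2)[OF _ that] by (simp add: op_simps)
  then have "X \<in> V" using V_iff o by blast
  ultimately show "X \<in> \<J>" using J_ST V_T by blast
qed (rule J_null_obj)

lemma U_iso: "isoJ X X' \<Longrightarrow> X \<in> U \<Longrightarrow> X' \<in> U"
  using ext0_isoJ_left[of X' X] isoJ_sym[of X X'] isoJ_obj(2)[of X X'] J_mem ext_UV U_iff by metis

lemma T_iso: "isoJ X X' \<Longrightarrow> X \<in> T \<Longrightarrow> X' \<in> T"
  using ext0_isoJ_right[of X' X] isoJ_sym[of X X'] isoJ_obj(2)[of X X'] J_mem ext_ST T_iff by metis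

lemma J_iso: "isoJ X X' \<Longrightarrow> X \<in> \<J> \<Longrightarrow> X' \<in> \<J>"
  using null_obj_iso null_obj_J by blast

text \<open>The S-cover of Y has its kernel in T, so the cover is in T too and hence in
  \<open>\<J>\<close>; every morphism from S to Y lifts to it.\<close>

lemma hom_ST_null: assumes "X \<in> S" "Y \<in> T" "f \<in> Hom \<C> X Y" shows "null X Y f"
proof -
  obtain A i B p where t: "A \<in> T" "B \<in> S" "tri A i B p Y" using S_cover mem_obj assms(2) by blast
  have "B \<in> \<J>" using T_extension[OF t(3,1) assms(2)] t(2) J_ST by blast
  moreover obtain f' where "f' \<in> Hom \<C> X B" "p \<cdot> f' = f"
    using ext_lift[OF ext_ST[OF assms(1) t(1)] t(3) assms(3)] by blast
  ultimately show ?thesis using nullI tri_homs(2)[OF t(3)] by metis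
qed

lemma hom_UV_null: "X \<in> U \<Longrightarrow> Y \<in> V \<Longrightarrow> f \<in> Hom \<C> X Y \<Longrightarrow> null X Y f"
  using twin.hom_ST_null[OF op_twin, of Y X f] by (simp add: twin_op_simps)

text \<open>Existence and uniqueness in the universal property of the unit \<open>X \<rightarrow> A\<close> of the reflection
  onto \<open>\<T>/\<I>\<close>.\<close>

lemma hull_extend: "\<lbrakk>tri X t A s B; B \<in> S; Y \<in> T; x \<in> Hom \<C> X Y\<rbrakk> \<Longrightarrow> \<exists>a \<in> Hom \<C> A Y. a \<cdot> t = x"
  using ext_extend ext_ST by blast

lemma hull_null:
  assumes t: "tri X t A s B" and B: "B \<in> S" and Y: "Y \<in> T" and a: "a \<in> Hom \<C> A Y" "null X Y (a \<cdot> t)"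
  shows "null A Y a"
proof -
  note h = tri_homs[OF t] a(1)
  obtain J c d where J: "J \<in> \<J>" "c \<in> Hom \<C> X J" "d \<in> Hom \<C> J Y" "a \<cdot> t = d \<cdot> c"
    using a(2) unfolding null_def by blast
  obtain c' where c: "c' \<in> Hom \<C> A J" "c' \<cdot> t = c" using hull_extend[OF t B J_mem(2)[OF J(1)] J(2)] by blast
  have dc: "d \<cdot> c' \<in> Hom \<C> A Y" using comp_hom c J by blast
  \<comment> \<open>Once the part through J is extended along t and subtracted, the difference
    vanishes on X and factors through B in S, so \<open>hom_ST_null\<close> applies.\<close>
  have "(d \<cdot> c') \<cdot> t = a \<cdot> t" using comp_assoc[OF h(1) c(1) J(3)] c(2) J(4) by simp
  then have "arr_minus \<C> a (d \<cdot> c') \<cdot> t = Zer \<C> X Y"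
    using minus_comp[OF h(1) a(1) dc] minus_self[OF comp_hom[OF h(1) a(1)]] by simp
  then obtain b where b: "b \<in> Hom \<C> B Y" "arr_minus \<C> a (d \<cdot> c') = b \<cdot> s"
    using tri_extend[OF t minus_hom[OF a(1) dc]] by blast
  have "null A Y (arr_minus \<C> a (d \<cdot> c'))"
    unfolding b(2) using null_comp_right[OF hom_ST_null[OF B Y b(1)] h(2)] .
  then have "null A Y (Plus \<C> (arr_minus \<C> a (d \<cdot> c')) (d \<cdot> c'))"
    using null_plus nullI[OF J(1) c(1) J(3)] by blast
  then show ?thesis using minus_plus[OF a(1) dc] by simp
qed

lemma hull_eqv:
  assumes t: "tri X t A s B" and B: "B \<in> S" and Y: "Y \<in> T"
    and a: "a \<in> Hom \<C> A Y" "b \<in> Hom \<C> A Y" "eqv X Y (a \<cdot> t) (b \<cdot> t)"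
  shows "eqv A Y a b"
  using hull_null[OF t B Y minus_hom[OF a(1,2)]] a minus_comp[OF tri_homs(1)[OF t] a(1,2)]
  unfolding eqv_def by simp

lemma cover_lift: "\<lbrakk>tri B v A u X; B \<in> V; Y \<in> U; x \<in> Hom \<C> Y X\<rbrakk> \<Longrightarrow> \<exists>a \<in> Hom \<C> Y A. u \<cdot> a = x"
  using ext_lift ext_UV by blast

lemma cover_eqv: "\<lbrakk>tri B v A u X; B \<in> V; Y \<in> U; a \<in> Hom \<C> Y A; b \<in> Hom \<C> Y A;
    eqv Y X (u \<cdot> a) (u \<cdot> b)\<rbrakk> \<Longrightarrow> eqv Y A a b"
  using twin.hull_eqv[OF op_twin, where X = X and t = u and A = A and s = v and B = B and Y = Y
      and a = a and b = b] by (simp add: twin_op_simps)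

lemma srel_obj: "srel X A \<Longrightarrow> X \<in> Obj \<C>" "srel X A \<Longrightarrow> A \<in> Obj \<C>"
  unfolding srel_def by (auto dest: tri_homs(3) tri_homs(4))

lemma wrel_obj: "wrel X A \<Longrightarrow> X \<in> Obj \<C>" "wrel X A \<Longrightarrow> A \<in> Obj \<C>"
  unfolding wrel_def by (auto dest: tri_homs(4) tri_homs(5))

lemma srel_T: "srel X A \<Longrightarrow> A \<in> T" and wrel_U: "wrel X A \<Longrightarrow> A \<in> U"
  unfolding srel_def wrel_def by blast+

lemma srelE: assumes "srel X A"
  obtains t B s where "A \<in> T" "B \<in> S" "tri X t A s B"
  using assms unfolding srel_def by blast

lemma wrelE: assumes "wrel X A"
  obtains v B u where "A \<in> U" "B \<in> V" "tri B v A u X"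
  using assms unfolding wrel_def by blast

lemma srelI: "\<lbrakk>tri X t A s B; A \<in> T; B \<in> S\<rbrakk> \<Longrightarrow> srel X A" and wrelI: "\<lbrakk>tri B v A u X; A \<in> U; B \<in> V\<rbrakk> \<Longrightarrow> wrel X A"
  unfolding srel_def wrel_def by blast+

lemma srel_exists: "X \<in> Obj \<C> \<Longrightarrow> \<exists>A. srel X A" and wrel_exists: "X \<in> Obj \<C> \<Longrightarrow> \<exists>A. wrel X A"
  unfolding srel_def wrel_def using T_hull U_cover by blast+

text \<open>Extensions a and b of mutually inverse morphisms compose to something that agrees with
  the identity after t, and uniqueness along the hull finishes.\<close>

lemma srel_eqv_inverse:
  assumes f: "f \<in> Hom \<C> X X'" "g \<in> Hom \<C> X' X" "eqv X X (g \<cdot> f) (Idn \<C> X)"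
    and t: "tri X t A s B" "B \<in> S" "A \<in> T" and t': "t' \<in> Hom \<C> X' A'"
    and a: "a \<in> Hom \<C> A A'" "a \<cdot> t = t' \<cdot> f" and b: "b \<in> Hom \<C> A' A" "b \<cdot> t' = t \<cdot> g"
  shows "eqv A A (b \<cdot> a) (Idn \<C> A)"
proof -
  note h = tri_homs[OF t(1)]
  have "(b \<cdot> a) \<cdot> t = t \<cdot> (g \<cdot> f)"
    using comp_assoc[OF h(1) a(1) b(1)] a(2) comp_assoc[OF f(1) t' b(1)] b(2)
      comp_assoc[OF f(1,2) h(1)] by simp
  then have "eqv X A ((b \<cdot> a) \<cdot> t) (t \<cdot> Idn \<C> X)" using eqv_comp_left[OF f(3) h(1)] by simp
  then have "eqv X A ((b \<cdot> a) \<cdot> t) (Idn \<C> A \<cdot> t)" using idn_left idn_right h by simp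
  then show ?thesis using hull_eqv[OF t] comp_hom[OF a(1) b(1)] idn_hom h by blast
qed

lemma srel_iso: assumes "isoJ X X'" "srel X A" "srel X' A'" shows "isoJ A A'"
proof -
  obtain f g where f: "f \<in> Hom \<C> X X'" "g \<in> Hom \<C> X' X" "eqv X X (g \<cdot> f) (Idn \<C> X)" "eqv X' X' (f \<cdot> g) (Idn \<C> X')"
    using assms(1) unfolding isoJ_def by blast
  obtain t B s where t: "A \<in> T" "B \<in> S" "tri X t A s B" using srelE[OF assms(2)] .
  obtain t' B' s' where t': "A' \<in> T" "B' \<in> S" "tri X' t' A' s' B'" using srelE[OF assms(3)] .
  obtain a where a: "a \<in> Hom \<C> A A'" "a \<cdot> t = t' \<cdot> f"
    using hull_extend[OF t(3,2) t'(1) comp_hom[OF f(1) tri_homs(1)[OF t'(3)]]] by blast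
  obtain b where b: "b \<in> Hom \<C> A' A" "b \<cdot> t' = t \<cdot> g"
    using hull_extend[OF t'(3,2) t(1) comp_hom[OF f(2) tri_homs(1)[OF t(3)]]] by blast
  have "eqv A A (b \<cdot> a) (Idn \<C> A)"
    by (rule srel_eqv_inverse[OF f(1,2,3) t(3,2,1) tri_homs(1)[OF t'(3)] a b])
  moreover have "eqv A' A' (a \<cdot> b) (Idn \<C> A')"
    by (rule srel_eqv_inverse[OF f(2,1,4) t'(3,2,1) tri_homs(1)[OF t(3)] b a])
  ultimately show ?thesis unfolding isoJ_def using a b by blast
qed

lemma wrel_iso: "\<lbrakk>isoJ X X'; wrel X A; wrel X' A'\<rbrakk> \<Longrightarrow> isoJ A A'"
  using twin.srel_iso[OF op_twin, of X X' A A'] by (simp add: twin_op_simps)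

lemma srel_unique: "\<lbrakk>srel X A; srel X A'\<rbrakk> \<Longrightarrow> isoJ A A'"
  using srel_iso isoJ_refl srel_obj by blast

lemma wrel_unique: "\<lbrakk>wrel X A; wrel X A'\<rbrakk> \<Longrightarrow> isoJ A A'"
  using wrel_iso isoJ_refl wrel_obj by blast

lemma zero_mem: assumes "is_zero \<C> N" shows "N \<in> S" "N \<in> T" "N \<in> U" "N \<in> V" "N \<in> \<J>"
proof -
  have N: "N \<in> Obj \<C>" using assms unfolding is_zero_def by blast
  have "ext0 N Y" if "Y \<in> Obj \<C>" for Y by (rule ext0_zero[OF assms that])
  moreover have "ext0 Y N" if "Y \<in> Obj \<C>" for Y
    using pair_category.ext0_zero[OF op_pair, of N Y] assms that by (simp add: op_simps)
  ultimately show "N \<in> S" "N \<in> T" "N \<in> U" "N \<in> V"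
    using S_iff[of N] T_iff[of N] U_iff[of N] V_iff[of N] N mem_obj by auto
  then show "N \<in> \<J>" using J_ST by blast
qed

lemma srel_self: assumes "A \<in> T" shows "srel A A"
proof -
  obtain N where N: "is_zero \<C> N" using ex_zero by blast
  show ?thesis using tri_idn[OF mem_obj(2)[OF assms] N] zero_mem(1)[OF N] assms unfolding srel_def by blast
qed

lemma wrel_self: "A \<in> U \<Longrightarrow> wrel A A"
  using twin.srel_self[OF op_twin, of A] by (simp add: twin_op_simps)

lemma srel_in_U: "srel X A \<Longrightarrow> X \<in> U \<Longrightarrow> A \<in> U"
  unfolding srel_def using U_extension S_U by blast

lemma wrel_in_T: "wrel X A \<Longrightarrow> X \<in> T \<Longrightarrow> A \<in> T"
  unfolding wrel_def using T_extension V_T by blast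

text \<open>Composing X -> X' with a hull of X' gives a hull of X: by the octahedron its cone is an
  extension of two objects of S.\<close>

lemma srel_ext: assumes t: "tri X f X' g B" "B \<in> S" and s: "srel X A" "srel X' A'" shows "isoJ A A'"
proof -
  obtain t' B' s' where t': "A' \<in> T" "B' \<in> S" "tri X' t' A' s' B'" using srelE[OF s(2)] .
  obtain Y y f' g' where Y: "tri X (t' \<cdot> f) A' y Y" "tri B f' Y g' B'"
    using oct_comp_op[OF t'(3) t(1)] by blast
  have "srel X A'" using srelI[OF Y(1) t'(1)] S_extension[OF Y(2) t(2) t'(2)] by blast
  then show ?thesis using srel_unique s(1) by blast
qed

lemma wrel_ext: "\<lbrakk>tri B f X' g X; B \<in> V; wrel X A; wrel X' A'\<rbrakk> \<Longrightarrow> isoJ A A'"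
  using twin.srel_ext[OF op_twin, where X = X and f = g and X' = X' and g = f and B = B and A = A
      and A' = A'] by (simp add: twin_op_simps)

text \<open>Insert id = i r + s q on P between x and y. The summand with i r passes through a
  morphism from U to V, which is null.\<close>

lemma section_eqv:
  assumes t: "tri B i P q A" and s: "s \<in> Hom \<C> A P" "q \<cdot> s = Idn \<C> A"
    and B: "B \<in> V" and x: "x \<in> Hom \<C> A' P" "y \<in> Hom \<C> P A'" "y \<cdot> x = Idn \<C> A'" and A': "A' \<in> U"
  shows "eqv A' A' ((y \<cdot> s) \<cdot> (q \<cdot> x)) (Idn \<C> A')"
proof -
  note h = tri_homs[OF t] s(1) x(1,2)
  obtain r where r: "r \<in> Hom \<C> P B" "Plus \<C> (i \<cdot> r) (s \<cdot> q) = Idn \<C> P"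
    using tri_split[OF t s] by blast
  have n: "null A' A' (y \<cdot> (i \<cdot> (r \<cdot> x)))"
    by (intro null_comp_left[OF null_comp_left[OF hom_UV_null[OF A' B comp_hom[OF x(1) r(1)]] h(1)] x(2)])
  have "Plus \<C> (y \<cdot> (i \<cdot> (r \<cdot> x))) ((y \<cdot> s) \<cdot> (q \<cdot> x)) = y \<cdot> (Plus \<C> (i \<cdot> r) (s \<cdot> q) \<cdot> x)"
    using h r(1) by (simp add: Hom_def arr_simps)
  also have "\<dots> = Idn \<C> A'" using r(2) h x(3) by (simp add: Hom_def arr_simps)
  finally have "Idn \<C> A' = Plus \<C> ((y \<cdot> s) \<cdot> (q \<cdot> x)) (y \<cdot> (i \<cdot> (r \<cdot> x)))"
    using plus_commute[OF null_hom[OF n] comp_hom[OF comp_hom[OF x(1) h(2)] comp_hom[OF s(1) x(2)]]] by simp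
  then show ?thesis
    using eqvI[OF comp_hom[OF comp_hom[OF x(1) h(2)] comp_hom[OF s(1) x(2)]] n] eqv_sym by blast
qed

text \<open>A Schanuel argument: in the push-out P of the two hulls, U1 is a complement of V2 and U2
  a complement of V1. Since morphisms from U to V are null, the complements agree modulo
  \<open>\<J>\<close>.\<close>

lemma V_hull_unique:
  assumes "tri R f V1 g U1" "tri R f' V2 g' U2" "V1 \<in> V" "V2 \<in> V" "U1 \<in> U" "U2 \<in> U"
  shows "isoJ U1 U2"
proof -
  obtain P i q y c where P: "tri V2 i P q U1" "tri V1 y P c U2"
    using oct_push[OF assms(1,2)] by blast
  obtain s where s: "s \<in> Hom \<C> U1 P" "q \<cdot> s = Idn \<C> U1"
    using ext0D[OF ext_UV[OF assms(5,4)] P(1)] by blast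
  obtain x where x: "x \<in> Hom \<C> U2 P" "c \<cdot> x = Idn \<C> U2"
    using ext0D[OF ext_UV[OF assms(6,3)] P(2)] by blast
  note h = tri_homs(2)[OF P(1)] tri_homs(2)[OF P(2)]
  have "eqv U2 U2 ((c \<cdot> s) \<cdot> (q \<cdot> x)) (Idn \<C> U2)"
    by (rule section_eqv[OF P(1) s assms(4) x(1) h(2) x(2) assms(6)])
  moreover have "eqv U1 U1 ((q \<cdot> x) \<cdot> (c \<cdot> s)) (Idn \<C> U1)"
    by (rule section_eqv[OF P(2) x assms(3) s(1) h(1) s(2) assms(5)])
  ultimately show ?thesis unfolding isoJ_def using comp_hom s(1) x(1) h by blast
qed

text \<open>An S-cover of an object of T is an extension of objects of T, so it already lies in
  \<open>\<J>\<close>.\<close>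

lemma J_cover:
  assumes "Z \<in> T" obtains A t J j where "A \<in> T" "J \<in> \<J>" "tri A t J j Z"
proof -
  obtain A t J j where t: "A \<in> T" "J \<in> S" "tri A t J j Z" using S_cover mem_obj assms by blast
  then show ?thesis using that T_extension assms J_ST by blast
qed

lemma J_hull:
  assumes "Z \<in> U" obtains i J p A where "A \<in> U" "J \<in> \<J>" "tri Z i J p A"
proof -
  obtain i J p A where t: "J \<in> V" "A \<in> U" "tri Z i J p A" using V_hull mem_obj assms by blast
  then show ?thesis using that U_extension assms J_UV by blast
qed

text \<open>An isomorphism modulo \<open>\<I>\<close> becomes a split epimorphism after adding an \<open>\<I>\<close>-cover of its
  target to its source, and then its kernel lies in \<open>\<I>\<close>.\<close>

lemma iso_kernel:
  assumes "isoJ Y Z" and Z: "Z \<in> T"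
  obtains A t J j i E q k K e where "A \<in> T" "J \<in> \<J>" "K \<in> \<J>" "tri A t J j Z"
    "tri J i E q Y" "tri K k E e Z" "e \<cdot> i = j"
proof -
  obtain z w where z: "z \<in> Hom \<C> Y Z" "w \<in> Hom \<C> Z Y" and
    wz: "eqv Y Y (w \<cdot> z) (Idn \<C> Y)" and zw: "eqv Z Z (z \<cdot> w) (Idn \<C> Z)"
    using assms(1) unfolding isoJ_def by blast
  obtain A t J j where A: "A \<in> T" "J \<in> \<J>" "tri A t J j Z" using J_cover[OF Z] .
  note j = tri_homs(2)[OF A(3)]
  have o: "Y \<in> Obj \<C>" "Z \<in> Obj \<C>" "J \<in> Obj \<C>" using hom_obj z tri_homs A by blast+
  obtain E i l p q where E: "tri J i E q Y" "tri Y l E p J" "p \<cdot> i = Idn \<C> J" "q \<cdot> l = Idn \<C> Y"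
    "Plus \<C> (i \<cdot> p) (l \<cdot> q) = Idn \<C> E" using tri_biproduct[OF o(3,1)] by blast
  note h = tri_homs[OF E(1)] tri_homs[OF E(2)] z j
  have qi: "q \<cdot> i = Zer \<C> J Y" and pl: "p \<cdot> l = Zer \<C> Y J" using tri_comp E by blast+
  \<comment> \<open>On the biproduct E of J and Y, e is j on the first summand and z on the
    second.\<close>
  define e where "e = Plus \<C> (j \<cdot> p) (z \<cdot> q)"
  have e: "e \<in> Hom \<C> E Z"
    unfolding e_def by (rule plus_hom[OF comp_hom[OF h(7) j] comp_hom[OF h(2) z(1)]])
  have ei: "e \<cdot> i = j" unfolding e_def using h E(3) qi o by (simp add: Hom_def arr_simps)
  have el: "e \<cdot> l = z" unfolding e_def using h E(4) pl o by (simp add: Hom_def arr_simps)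
  obtain K k where K: "tri K k E e Z" using tri_fiber[OF e] by blast
  note k = tri_homs(1)[OF K]
  have "null Z Z (arr_minus \<C> (z \<cdot> w) (Idn \<C> Z))" using zw unfolding eqv_def by blast
  then obtain J' c d where J': "J' \<in> \<J>" "c \<in> Hom \<C> Z J'" "d \<in> Hom \<C> J' Z"
    "arr_minus \<C> (z \<cdot> w) (Idn \<C> Z) = d \<cdot> c" unfolding null_def by blast
  obtain d' where d': "d' \<in> Hom \<C> J' J" "j \<cdot> d' = d"
    using ext_lift[OF J_ext(1)[OF J'(1) A(1)] A(3) J'(3)] by blast
  \<comment> \<open>The morphism z w differs from id by d c, and d lifts along j; subtracting this
    lift in the J-component turns w into an honest section of e.\<close>
  define s where "s = arr_minus \<C> (l \<cdot> w) (i \<cdot> (d' \<cdot> c))"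
  have s: "s \<in> Hom \<C> Z E"
    unfolding s_def by (rule minus_hom[OF comp_hom[OF z(2) h(6)]
        comp_hom[OF comp_hom[OF J'(2) d'(1)] h(1)]])
  have zwh: "z \<cdot> w \<in> Hom \<C> Z Z" using comp_hom z by blast
  have "e \<cdot> s = arr_minus \<C> (e \<cdot> (l \<cdot> w)) (e \<cdot> (i \<cdot> (d' \<cdot> c)))"
    unfolding s_def using h e d' J' by (simp add: Hom_def arr_simps)
  also have "e \<cdot> (l \<cdot> w) = z \<cdot> w" using comp_assoc[OF z(2) h(6) e] el by simp
  also have "e \<cdot> (i \<cdot> (d' \<cdot> c)) = arr_minus \<C> (z \<cdot> w) (Idn \<C> Z)"
    using comp_assoc[OF comp_hom[OF J'(2) d'(1)] h(1) e] ei comp_assoc[OF J'(2) d'(1) j] d'(2) J'(4)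
    by simp
  also have "arr_minus \<C> (z \<cdot> w) (arr_minus \<C> (z \<cdot> w) (Idn \<C> Z)) = Idn \<C> Z"
    by (rule minusI[OF zwh minus_hom[OF zwh idn_hom[OF o(2)]] idn_hom[OF o(2)]
          plus_minus[OF zwh idn_hom[OF o(2)]]])
  finally have "e \<cdot> s = Idn \<C> Z" .
  then obtain r where r: "r \<in> Hom \<C> E K" "r \<cdot> k = Idn \<C> K" using split_epi[OF K s] by blast
  \<comment> \<open>The identity of K equals r (i p + l q) k. The component p k is null because it
    ends in J, and q k because z q k is minus the null morphism j p k and w z is the identity modulo
    \<open>\<J>\<close>.\<close>
  have 1: "null K J (p \<cdot> k)"
    using nullI[OF A(2) comp_hom[OF k h(7)] idn_hom[OF o(3)]] idn_left[OF comp_hom[OF k h(7)]] by simp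
  have "Plus \<C> (j \<cdot> (p \<cdot> k)) (z \<cdot> (q \<cdot> k)) = e \<cdot> k"
    unfolding e_def using h k by (simp add: Hom_def arr_simps)
  then have "Plus \<C> (j \<cdot> (p \<cdot> k)) (z \<cdot> (q \<cdot> k)) = Zer \<C> K Z" using tri_comp[OF K] by simp
  moreover note jpk = comp_hom[OF comp_hom[OF k h(7)] j] and qk = comp_hom[OF k h(2)]
    comp_hom[OF comp_hom[OF k h(2)] z(1)] and KZ = tri_homs(3)[OF K] o(2)
  ultimately have "arr_minus \<C> (Zer \<C> K Z) (j \<cdot> (p \<cdot> k)) = z \<cdot> (q \<cdot> k)"
    using minusI[OF zer_hom[OF KZ] jpk qk(2)] plus_commute[OF jpk qk(2)] by simp
  then have "null K Z (z \<cdot> (q \<cdot> k))"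
    using null_minus[OF null_zer[OF KZ] null_comp_left[OF 1 j]] by simp
  then have "null K Y (w \<cdot> (z \<cdot> (q \<cdot> k)))" by (rule null_comp_left[OF _ z(2)])
  then have "null K Y ((w \<cdot> z) \<cdot> (q \<cdot> k))" using comp_assoc[OF qk(1) z] by simp
  moreover have "eqv K Y (q \<cdot> k) ((w \<cdot> z) \<cdot> (q \<cdot> k))"
    using eqv_sym[OF eqv_comp_right[OF qk(1) wz]] idn_left[OF qk(1)] by simp
  ultimately have 2: "null K Y (q \<cdot> k)" using eqv_null by blast
  have "null K K (r \<cdot> Plus \<C> (i \<cdot> (p \<cdot> k)) (l \<cdot> (q \<cdot> k)))"
    by (intro null_comp_left[OF null_plus r(1)] null_comp_left[OF 1 h(1)] null_comp_left[OF 2 h(6)])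
  moreover have "Plus \<C> (i \<cdot> (p \<cdot> k)) (l \<cdot> (q \<cdot> k)) = Plus \<C> (i \<cdot> p) (l \<cdot> q) \<cdot> k"
    using h k by (simp add: Hom_def arr_simps)
  ultimately have "null K K (Idn \<C> K)" using E(5) idn_left[OF k] r(2) by simp
  then have "K \<in> \<J>" using null_obj_J[of K] tri_homs(3)[OF K] unfolding null_obj_def by simp
  then show ?thesis using that A E(1) K ei by blast
qed

section \<open>The shift of the quotient as a relation on objects\<close>

lemma Srel_exists: assumes "R \<in> U" shows "\<exists>Y. Srel R Y"
proof -
  obtain i J p A where "A \<in> U" "J \<in> \<J>" "tri R i J p A" using J_hull[OF assms] .
  then show ?thesis unfolding Srel_def using srel_exists mem_obj(3) by blast
qed

lemma Orel_exists: "Y \<in> T \<Longrightarrow> \<exists>R. Orel Y R"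
  using twin.Srel_exists[OF op_twin, of Y] by (simp add: twin_op_simps)

text \<open>By the dual of \<open>iso_kernel\<close>, R embeds into E, the biproduct of R' and J,
  with cone K in \<open>\<J>\<close>. A \<open>\<J>\<close>-hull of R' pushed out to E and
  restricted to R is a \<open>\<J>\<close>-hull of R, and its cone differs from R1' only by
  K.\<close>

lemma Srel_iso:
  assumes iso: "isoJ R R'" and R: "R \<in> U" "R' \<in> U" and S: "Srel R Y" "Srel R' Y'"
  shows "isoJ Y Y'"
proof -
  obtain i I0 p R1 where 1: "I0 \<in> \<J>" "R1 \<in> U" "tri R i I0 p R1" "srel R1 Y"
    using S(1) unfolding Srel_def by blast
  obtain i' I0' p' R1' where 2: "I0' \<in> \<J>" "R1' \<in> U" "tri R' i' I0' p' R1'" "srel R1' Y'"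
    using S(2) unfolding Srel_def by blast
  obtain J q E l k K e where E: "J \<in> \<J>" "K \<in> \<J>" "tri R' q E l J" "tri R e E k K"
  proof (rule twin.iso_kernel[OF op_twin, of R' R])
    show "ideal_category.isoJ (op_cat \<C>) \<J> R' R" using iso isoJ_sym op_isoJ by simp
  qed (use R in auto)
  obtain P a b y c where P: "tri I0' a P b J" "tri E y P c R1'" using oct_push[OF E(3) 2(3)] by blast
  have PJ: "P \<in> \<J>" by (rule J_extension[OF P(1) 2(1) E(1)])
  obtain Q g u v where Q: "tri R (y \<cdot> e) P g Q" "tri K u Q v R1'"
    using oct_comp_op[OF P(2) E(4)] by blast
  have QU: "Q \<in> U" using U_extension[OF Q(2)] J_mem E 2 by blast
  have "isoJ Q R1'" by (rule split_isoJ[OF Q(2) E(2) J_ext(2)[OF E(2) 2(2)]])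
  moreover have "isoJ R1 Q" by (rule V_hull_unique[OF 1(3) Q(1)]) (use J_mem 1 PJ QU in auto)
  ultimately show ?thesis using srel_iso isoJ_trans 1(4) 2(4) by blast
qed

lemma Orel_iso: "\<lbrakk>isoJ Y Y'; Y \<in> T; Y' \<in> T; Orel Y R; Orel Y' R'\<rbrakk> \<Longrightarrow> isoJ R R'"
  using twin.Srel_iso[OF op_twin, of Y Y' R R'] by (simp add: twin_op_simps)

lemma Srel_unique: "\<lbrakk>R \<in> U; Srel R Y; Srel R Y'\<rbrakk> \<Longrightarrow> isoJ Y Y'"
  using Srel_iso isoJ_refl mem_obj(3) by blast

end

section \<open>Consequences of conditions (I) and (II)\<close>

text \<open>\<open>comparison\<close> keeps of (I) that the two ends of \<mu> are isomorphic modulo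
  \<open>\<J>\<close>, for any choice of triangles; this is its own mirror. \<open>U_Nf\<close> and
  \<open>T_Ni\<close> are the inclusions into \<S> and \<V> in (II), and mirror each other.\<close>

locale mutable_twin = twin \<C> \<J> tri S T U V
  for \<C> :: "('o, 'm, 'z) cat_data_scheme" (structure) and \<J> :: "'o set"
    and tri :: "'o \<Rightarrow> 'm \<Rightarrow> 'o \<Rightarrow> 'm \<Rightarrow> 'o \<Rightarrow> bool" and S T U V :: "'o set" +
  assumes comparison: "\<lbrakk>tri A f X g B; A \<in> T; B \<in> U; wrel X W; srel W Z; srel X Y; wrel Y Z'\<rbrakk>
      \<Longrightarrow> isoJ Z Z'"
    and U_Nf: "\<lbrakk>tri A f B g D; A \<in> U; B \<in> V; D \<in> S\<rbrakk> \<Longrightarrow> A \<in> S"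
    and T_Ni: "\<lbrakk>tri D f B g A; A \<in> T; B \<in> S; D \<in> V\<rbrakk> \<Longrightarrow> A \<in> V"
begin

lemma op_mutable: "mutable_twin (op_cat \<C>) \<J> tri_op V U T S"
  by (intro mutable_twin.intro mutable_twin_axioms.intro op_twin, unfold twin_op_simps)
    (use comparison isoJ_sym in blast, use T_Ni in blast, use U_Nf in blast)

text \<open>In the situation of the next lemma, \<open>\<omega>(A) \<cong> R\<close> and \<open>\<sigma>(D) \<cong> Y\<close>, hence
  \<open>\<sigma>(D) \<cong> \<Sigma>\<omega>(A)\<close>.  Conditions (I) and (II) are what forces the reflection of the push-out
  of \<open>R \<rightarrow> I\<close> along \<open>R \<rightarrow> A\<close> into \<open>\<V>\<close>.\<close>

lemma Srel_hull:
  assumes t: "tri A f B g D" "A \<in> T" "B \<in> V" "D \<in> U"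
    and rel: "wrel A R" "srel D Y" "Srel R Y'"
  shows "isoJ Y Y'"
proof -
  obtain v V0 u where R: "R \<in> U" "V0 \<in> V" "tri V0 v R u A" using wrelE[OF rel(1)] .
  obtain i I0 p R1 where I0: "I0 \<in> \<J>" "R1 \<in> U" "tri R i I0 p R1" "srel R1 Y'"
    using rel(3) unfolding Srel_def by blast
  \<comment> \<open>X is the push-out of R -> I0 along R -> A. It lies in T * U, and I0 is its
    U-cover with kernel V0.\<close>
  obtain X y f' g' where X: "tri V0 (i \<cdot> v) I0 y X" "tri A f' X g' R1"
    using oct_comp_op[OF I0(3) R(3)] by blast
  obtain t' T' s' S' where T': "T' \<in> T" "S' \<in> S" "tri X t' T' s' S'"
    using T_hull tri_homs(4)[OF X(2)] by blast
  obtain Z where "wrel T' Z" using wrel_exists mem_obj(2)[OF T'(1)] by blast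
  \<comment> \<open>Since I0 lies in T, it is its own reflection; thus (I) makes the U-cover Z of T'
    isomorphic to I0.\<close>
  note IZ = comparison[OF X(2) t(2) I0(2) wrelI[OF X(1) _ R(2)] srel_self srelI[OF T'(3,1,2)] this]
  have Z: "Z \<in> \<J>" using J_iso[OF IZ I0(1)] J_mem[OF I0(1)] by blast
  obtain v3 V3 u3 where V3: "V3 \<in> V" "tri V3 v3 Z u3 T'" using wrelE[OF \<open>wrel T' Z\<close>] .
  \<comment> \<open>T' is the cone of a morphism from V to an object of \<open>\<J>\<close>, hence
    of S; this is the situation of (II).\<close>
  have T'V: "T' \<in> V" by (rule T_Ni[OF V3(2) T'(1) J_mem(1)[OF Z] V3(1)])
  \<comment> \<open>The composite A -> X -> T' is a second V-hull of A. Its cone U3 is an extension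
    of S' by R1, so it has the same reflection as R1.\<close>
  obtain U3 a b c where U3: "tri A (t' \<cdot> f') T' a U3" "tri R1 b U3 c S'"
    using oct_comp_op[OF T'(3) X(2)] by blast
  have U3U: "U3 \<in> U" using U_extension[OF U3(2) I0(2)] S_U T'(2) by blast
  obtain Y3 where Y3: "srel U3 Y3" using srel_exists mem_obj(3)[OF U3U] by blast
  have "isoJ D U3" by (rule V_hull_unique[OF t(1) U3(1) t(3) T'V t(4) U3U])
  then have "isoJ Y Y3" by (rule srel_iso[OF _ rel(2) Y3])
  moreover have "isoJ Y' Y3" by (rule srel_ext[OF U3(2) T'(2) I0(4) Y3])
  ultimately show ?thesis using isoJ_sym isoJ_trans by blast
qed

lemma Orel_cover: "\<lbrakk>tri A f B g D; A \<in> T; B \<in> S; D \<in> U; srel D R; wrel A Y; Orel R Y'\<rbrakk> \<Longrightarrow> isoJ Y Y'"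
  using mutable_twin.Srel_hull[OF op_mutable, where A = D and f = g and B = B and g = f and D = A
      and R = R and Y = Y and Y' = Y'] by (simp add: twin_op_simps)

text \<open>A \<open>\<J>\<close>-hull R -> I0 -> R1 also has its middle term in S, so the dual of
  \<open>Srel_hull\<close> reads it backwards: R is recovered as \<Omega> of \<sigma>(R1).\<close>

lemma Orel_Srel: assumes "R \<in> T" "R \<in> U" "Srel R Y" "Orel Y R'" shows "isoJ R R'"
proof -
  obtain i I0 p R1 where "I0 \<in> \<J>" "R1 \<in> U" "tri R i I0 p R1" "srel R1 Y"
    using assms(3) unfolding Srel_def by blast
  then show ?thesis using Orel_cover[OF _ assms(1) _ _ _ wrel_self[OF assms(2)] assms(4)] J_mem by blast
qed

lemma Srel_inj:
  assumes "R \<in> T" "R \<in> U" "R' \<in> T" "R' \<in> U" "Srel R Y" "Srel R' Y'" "isoJ Y Y'"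
  shows "isoJ R R'"
proof -
  have Y: "Y \<in> T" "Y' \<in> T" using assms(5,6) srel_T unfolding Srel_def by blast+
  obtain Q Q' where Q: "Orel Y Q" "Orel Y' Q'" using Orel_exists Y by blast
  have "isoJ Q Q'" by (rule Orel_iso[OF assms(7) Y Q])
  then show ?thesis using Orel_Srel assms Q isoJ_sym isoJ_trans by meson
qed

definition biproductJ :: "'o \<Rightarrow> 'o \<Rightarrow> 'o \<Rightarrow> bool" where
  "biproductJ X Y B \<longleftrightarrow> (\<exists>i \<in> Hom \<C> X B. \<exists>j \<in> Hom \<C> Y B. \<exists>p \<in> Hom \<C> B X. \<exists>q \<in> Hom \<C> B Y.
     eqv X X (p \<cdot> i) (Idn \<C> X) \<and> eqv Y Y (q \<cdot> j) (Idn \<C> Y) \<and>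
     eqv Y X (p \<cdot> j) (Zer \<C> Y X) \<and> eqv X Y (q \<cdot> i) (Zer \<C> X Y) \<and>
     eqv B B (Plus \<C> (i \<cdot> p) (j \<cdot> q)) (Idn \<C> B))"

text \<open>The structure morphisms extend to the hulls. Each biproduct equation is checked after
  composing with a hull, where uniqueness modulo \<open>\<J>\<close> applies.\<close>

lemma srel_biproduct:
  assumes B: "is_biproduct \<C> X Y B" and s: "srel X X'" "srel Y Y'" "srel B B'"
  shows "biproductJ X' Y' B'"
proof -
  obtain i j p q where h: "i \<in> Hom \<C> X B" "j \<in> Hom \<C> Y B" "p \<in> Hom \<C> B X" "q \<in> Hom \<C> B Y"
    and e: "p \<cdot> i = Idn \<C> X" "q \<cdot> j = Idn \<C> Y" "p \<cdot> j = Zer \<C> Y X" "q \<cdot> i = Zer \<C> X Y"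
      "Plus \<C> (i \<cdot> p) (j \<cdot> q) = Idn \<C> B"
    using B unfolding is_biproduct_def by blast
  obtain x X1 x1 where x: "X' \<in> T" "X1 \<in> S" "tri X x X' x1 X1" using srelE[OF s(1)] .
  obtain y Y1 y1 where y: "Y' \<in> T" "Y1 \<in> S" "tri Y y Y' y1 Y1" using srelE[OF s(2)] .
  obtain b B1 b1 where b: "B' \<in> T" "B1 \<in> S" "tri B b B' b1 B1" using srelE[OF s(3)] .
  note th = tri_homs[OF x(3)] tri_homs[OF y(3)] tri_homs[OF b(3)]
  obtain i' where i: "i' \<in> Hom \<C> X' B'" "i' \<cdot> x = b \<cdot> i"
    using hull_extend[OF x(3,2) b(1) comp_hom[OF h(1) th(11)]] by blast
  obtain j' where j: "j' \<in> Hom \<C> Y' B'" "j' \<cdot> y = b \<cdot> j"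
    using hull_extend[OF y(3,2) b(1) comp_hom[OF h(2) th(11)]] by blast
  obtain p' where p: "p' \<in> Hom \<C> B' X'" "p' \<cdot> b = x \<cdot> p"
    using hull_extend[OF b(3,2) x(1) comp_hom[OF h(3) th(1)]] by blast
  obtain q' where q: "q' \<in> Hom \<C> B' Y'" "q' \<cdot> b = y \<cdot> q"
    using hull_extend[OF b(3,2) y(1) comp_hom[OF h(4) th(6)]] by blast
  have ih: "i' \<cdot> p' \<in> Hom \<C> B' B'" "j' \<cdot> q' \<in> Hom \<C> B' B'" using comp_hom i j p q by blast+
  \<comment> \<open>Pasting of two commuting squares, common to all the composites below.\<close>
  have square: "(v \<cdot> u) \<cdot> a = d \<cdot> (l \<cdot> k)"
    if "a \<in> Hom \<C> K K'" "u \<in> Hom \<C> K' L'" "v \<in> Hom \<C> L' M'" "k \<in> Hom \<C> K L" "l \<in> Hom \<C> L M"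
      "c \<in> Hom \<C> L L'" "d \<in> Hom \<C> M M'" "u \<cdot> a = c \<cdot> k" "v \<cdot> c = d \<cdot> l"
    for a u v c d k l K K' L L' M M'
  proof -
    have "(v \<cdot> u) \<cdot> a = v \<cdot> (c \<cdot> k)" using that(8) comp_assoc[OF that(1,2,3)] by simp
    also have "\<dots> = (d \<cdot> l) \<cdot> k" using that(9) comp_assoc[OF that(4,6,3)] by simp
    finally show ?thesis using comp_assoc[OF that(4,5,7)] by simp
  qed
  have "eqv X' X' (p' \<cdot> i') (Idn \<C> X')"
    using square[OF th(1) i(1) p(1) h(1) h(3) th(11) th(1) i(2) p(2)] e(1) th
      eqv_refl[OF th(1)] idn_left[OF th(1)] idn_right[OF th(1)]
    by (intro hull_eqv[OF x(3,2,1) comp_hom[OF i(1) p(1)] idn_hom]) simp_all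
  moreover have "eqv Y' Y' (q' \<cdot> j') (Idn \<C> Y')"
    using square[OF th(6) j(1) q(1) h(2) h(4) th(11) th(6) j(2) q(2)] e(2) th
      eqv_refl[OF th(6)] idn_left[OF th(6)] idn_right[OF th(6)]
    by (intro hull_eqv[OF y(3,2,1) comp_hom[OF j(1) q(1)] idn_hom]) simp_all
  moreover have "eqv Y' X' (p' \<cdot> j') (Zer \<C> Y' X')"
    using square[OF th(6) j(1) p(1) h(2) h(3) th(11) th(1) j(2) p(2)] e(3) th
      zer_comp[OF th(6)] comp_zer[OF th(1)] eqv_refl[OF zer_hom]
    by (intro hull_eqv[OF y(3,2) x(1) comp_hom[OF j(1) p(1)] zer_hom]) simp_all
  moreover have "eqv X' Y' (q' \<cdot> i') (Zer \<C> X' Y')"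
    using square[OF th(1) i(1) q(1) h(1) h(4) th(11) th(6) i(2) q(2)] e(4) th
      zer_comp[OF th(1)] comp_zer[OF th(6)] eqv_refl[OF zer_hom]
    by (intro hull_eqv[OF x(3,2) y(1) comp_hom[OF i(1) q(1)] zer_hom]) simp_all
  moreover have "Plus \<C> (i' \<cdot> p') (j' \<cdot> q') \<cdot> b = b \<cdot> Plus \<C> (i \<cdot> p) (j \<cdot> q)"
    using comp_plus_left[OF th(11) ih] comp_plus_right[OF comp_hom[OF h(3,1)] comp_hom[OF h(4,2)] th(11)]
      square[OF th(11) p(1) i(1) h(3) h(1) th(1) th(11) p(2) i(2)]
      square[OF th(11) q(1) j(1) h(4) h(2) th(6) th(11) q(2) j(2)] by simp
  then have "eqv B' B' (Plus \<C> (i' \<cdot> p') (j' \<cdot> q')) (Idn \<C> B')"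
    using e(5) th eqv_refl[OF th(11)] idn_left[OF th(11)] idn_right[OF th(11)]
    by (intro hull_eqv[OF b(3,2,1) plus_hom[OF ih] idn_hom]) simp_all
  ultimately show ?thesis unfolding biproductJ_def using i j p q by blast
qed

lemma op_biproductJ: "mutable_twin.biproductJ (op_cat \<C>) \<J> X Y B \<longleftrightarrow> biproductJ X Y B"
  unfolding mutable_twin.biproductJ_def[OF op_mutable] biproductJ_def twin_op_simps by blast

end

section \<open>Transport of cotorsion pairs from the quotient\<close>

text \<open>These are the closure properties of the two halves of a cotorsion pair in the quotient,
  in terms of representatives. Its orthogonality and its triangles enter separately, as the
  hypothesis of \<open>ext_sL_wR\<close> and as \<open>enough\<close>.\<close>

locale mutable_classes = mutable_twin \<C> \<J> tri S T U V
  for \<C> :: "('o, 'm, 'z) cat_data_scheme" (structure) and \<J> :: "'o set"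
    and tri :: "'o \<Rightarrow> 'm \<Rightarrow> 'o \<Rightarrow> 'm \<Rightarrow> 'o \<Rightarrow> bool" and S T U V :: "'o set" +
  fixes L R :: "'o set"
  assumes L_Z: "L \<subseteq> T \<inter> U" and R_Z: "R \<subseteq> T \<inter> U"
    and L_iso: "\<lbrakk>isoJ X Y; X \<in> L\<rbrakk> \<Longrightarrow> Y \<in> L" and R_iso: "\<lbrakk>isoJ X Y; X \<in> R\<rbrakk> \<Longrightarrow> Y \<in> R"
    and L_J: "L \<inter> \<J> \<noteq> {}" and R_J: "R \<inter> \<J> \<noteq> {}"
    and L_sum: "\<lbrakk>biproductJ X Y B; X \<in> L; Y \<in> L; B \<in> T \<inter> U\<rbrakk> \<Longrightarrow> B \<in> L"
    and R_sum: "\<lbrakk>biproductJ X Y B; X \<in> R; Y \<in> R; B \<in> T \<inter> U\<rbrakk> \<Longrightarrow> B \<in> R"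
    and L_summand: "\<lbrakk>biproductJ X Y B; B \<in> L; X \<in> T \<inter> U; Y \<in> T \<inter> U\<rbrakk> \<Longrightarrow> X \<in> L \<and> Y \<in> L"
    and R_summand: "\<lbrakk>biproductJ X Y B; B \<in> R; X \<in> T \<inter> U; Y \<in> T \<inter> U\<rbrakk> \<Longrightarrow> X \<in> R \<and> Y \<in> R"
begin

lemma op_classes: "mutable_classes (op_cat \<C>) \<J> tri_op V U T S R L"
  by (intro mutable_classes.intro mutable_classes_axioms.intro op_mutable,
      unfold twin_op_simps op_biproductJ Int_commute[of U T])
    (fact L_Z R_Z L_iso R_iso L_J R_J L_sum R_sum L_summand R_summand)+

text \<open>The preimages of \<open>L\<close> under \<open>\<sigma>\<close> and of \<open>R\<close> under \<open>\<omega>\<close>.\<close>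

definition sL :: "'o set" where
  "sL = {X \<in> U. \<exists>Y \<in> L. srel X Y}"

definition wR :: "'o set" where
  "wR = {X \<in> T. \<exists>Y \<in> R. wrel X Y}"

lemma op_sL: "mutable_classes.sL tri_op V U T R = wR" and op_wR: "mutable_classes.wR tri_op U T S L = sL"
  unfolding mutable_classes.sL_def[OF op_classes] mutable_classes.wR_def[OF op_classes] sL_def wR_def
  by (simp_all add: twin_op_simps)

lemmas classes_op_simps = op_sL op_wR twin_op_simps

lemma sLI: "\<lbrakk>X \<in> U; srel X Y; Y \<in> L\<rbrakk> \<Longrightarrow> X \<in> sL" and wRI: "\<lbrakk>X \<in> T; wrel X Y; Y \<in> R\<rbrakk> \<Longrightarrow> X \<in> wR"
  unfolding sL_def wR_def by blast+

lemma sLD: "\<lbrakk>X \<in> sL; srel X Y\<rbrakk> \<Longrightarrow> Y \<in> L" and wRD: "\<lbrakk>X \<in> wR; wrel X Y\<rbrakk> \<Longrightarrow> Y \<in> R"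
  unfolding sL_def wR_def using srel_unique wrel_unique L_iso R_iso by blast+

lemma sL_U: "X \<in> sL \<Longrightarrow> X \<in> U" and wR_T: "X \<in> wR \<Longrightarrow> X \<in> T"
  unfolding sL_def wR_def by blast+

lemma J_L: "X \<in> \<J> \<Longrightarrow> X \<in> L"
  using L_J null_objs_iso J_null_obj L_iso by blast

text \<open>The reflection of an object of S is an extension of objects of S, so it falls into
  \<open>\<J>\<close>, which is contained in L.\<close>

lemma S_sL: "S \<subseteq> sL"
proof
  fix X assume X: "X \<in> S"
  obtain t A s B where A: "A \<in> T" "B \<in> S" "tri X t A s B" using T_hull mem_obj(1)[OF X] by blast
  then have "A \<in> \<J>" using S_extension[OF A(3) X A(2)] J_ST by blast
  then show "X \<in> sL" using sLI srelI[OF A(3,1,2)] J_L X S_U by blast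
qed

lemma V_wR: "V \<subseteq> wR"
  using mutable_classes.S_sL[OF op_classes] by (simp add: classes_op_simps)

lemma sL_iso: assumes "isoJ X Y" "X \<in> sL" shows "Y \<in> sL"
proof -
  obtain X' where X': "srel X X'" "X' \<in> L" using assms(2) unfolding sL_def by blast
  obtain Y' where "srel Y Y'" using srel_exists isoJ_obj assms(1) by blast
  then show ?thesis using srel_iso[OF assms(1) X'(1)] L_iso X'(2) sLI U_iso[OF assms(1)] sL_U[OF assms(2)] by blast
qed

lemma biproduct_srel:
  assumes "is_biproduct \<C> X Y B" "X \<in> U" "Y \<in> U" "B \<in> U"
  obtains X' Y' B' where "srel X X'" "srel Y Y'" "srel B B'" "biproductJ X' Y' B'"
    "X' \<in> T \<inter> U" "Y' \<in> T \<inter> U" "B' \<in> T \<inter> U"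
proof -
  obtain X' Y' B' where *: "srel X X'" "srel Y Y'" "srel B B'"
    using srel_exists[OF mem_obj(3)[OF assms(2)]] srel_exists[OF mem_obj(3)[OF assms(3)]]
      srel_exists[OF mem_obj(3)[OF assms(4)]] by blast
  have "X' \<in> T \<inter> U" "Y' \<in> T \<inter> U" "B' \<in> T \<inter> U"
    using srel_T[OF *(1)] srel_T[OF *(2)] srel_T[OF *(3)] srel_in_U[OF *(1) assms(2)]
      srel_in_U[OF *(2) assms(3)] srel_in_U[OF *(3) assms(4)] by auto
  then show ?thesis by (rule that[OF * srel_biproduct[OF assms(1) *]])
qed

text \<open>U is an Ext-orthogonal: for a sum, lift the two inclusions separately and add; summands
  are retracts.\<close>

lemma biproduct_tri:
  assumes "is_biproduct \<C> X Y B"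
  shows "X \<in> U \<Longrightarrow> Y \<in> U \<Longrightarrow> B \<in> U" "B \<in> U \<Longrightarrow> X \<in> U \<and> Y \<in> U"
proof -
  obtain i j p q where h: "i \<in> Hom \<C> X B" "j \<in> Hom \<C> Y B" "p \<in> Hom \<C> B X" "q \<in> Hom \<C> B Y"
    and e: "p \<cdot> i = Idn \<C> X" "q \<cdot> j = Idn \<C> Y" "Plus \<C> (i \<cdot> p) (j \<cdot> q) = Idn \<C> B"
    using assms unfolding is_biproduct_def by blast
  note o = hom_obj[OF h(1)] hom_obj(1)[OF h(2)]
  show "X \<in> U \<and> Y \<in> U" if B: "B \<in> U"
  proof -
    have "ext0 X A" "ext0 Y A" if A: "A \<in> V" for A
      using ext0_retract_left[OF h(1,3)] ext0_retract_left[OF h(2,4)] e eqv_refl[OF idn_hom] o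
        ext_UV[OF B A] ext_UV[OF J_mem(3) A] by simp_all
    then show ?thesis using U_iff o by blast
  qed
  show "B \<in> U" if X: "X \<in> U" and Y: "Y \<in> U"
  proof -
    have "ext0 B A" if A: "A \<in> V" for A
      unfolding ext0_def
    proof (intro allI impI)
      fix E f g assume t: "tri A f E g B"
      obtain i' where i': "i' \<in> Hom \<C> X E" "g \<cdot> i' = i" using ext_lift[OF ext_UV[OF X A] t h(1)] by blast
      obtain j' where j': "j' \<in> Hom \<C> Y E" "g \<cdot> j' = j" using ext_lift[OF ext_UV[OF Y A] t h(2)] by blast
      note g = tri_homs(2)[OF t]
      have "g \<cdot> Plus \<C> (i' \<cdot> p) (j' \<cdot> q) = Idn \<C> B"
        using comp_plus_right[OF comp_hom[OF h(3) i'(1)] comp_hom[OF h(4) j'(1)] g]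
          comp_assoc[OF h(3) i'(1) g] comp_assoc[OF h(4) j'(1) g] i'(2) j'(2) e(3) by simp
      then show "\<exists>s \<in> Hom \<C> B E. g \<cdot> s = Idn \<C> B"
        using plus_hom[OF comp_hom[OF h(3) i'(1)] comp_hom[OF h(4) j'(1)]] by blast
    qed
    then show ?thesis using U_iff o by blast
  qed
qed

lemma sL_sum: assumes "is_biproduct \<C> X Y B" "X \<in> sL" "Y \<in> sL" shows "B \<in> sL"
proof -
  have U: "X \<in> U" "Y \<in> U" using sL_U assms(2,3) by auto
  then have UB: "B \<in> U" by (rule biproduct_tri(1)[OF assms(1)])
  obtain X' Y' B' where "srel X X'" "srel Y Y'" and B': "srel B B'" "biproductJ X' Y' B'" "B' \<in> T \<inter> U"
    using biproduct_srel[OF assms(1) U UB] .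
  then have "X' \<in> L" "Y' \<in> L" using sLD assms(2,3) by blast+
  then show ?thesis using sLI[OF UB B'(1)] L_sum[OF B'(2) _ _ B'(3)] by blast
qed

lemma sL_summand: assumes "is_biproduct \<C> X Y B" "B \<in> sL" shows "X \<in> sL \<and> Y \<in> sL"
proof -
  have U: "B \<in> U" "X \<in> U" "Y \<in> U" using sL_U[OF assms(2)] biproduct_tri(2)[OF assms(1)] by blast+
  obtain X' Y' B' where XY: "srel X X'" "srel Y Y'" and B': "srel B B'" "biproductJ X' Y' B'"
    and Z: "X' \<in> T \<inter> U" "Y' \<in> T \<inter> U" using biproduct_srel[OF assms(1) U(2,3,1)] .
  have "X' \<in> L \<and> Y' \<in> L" by (rule L_summand[OF B'(2) sLD[OF assms(2) B'(1)] Z])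
  then show ?thesis using sLI[OF U(2) XY(1)] sLI[OF U(3) XY(2)] by blast
qed

lemma isomorphic_isoJ: "isomorphic \<C> X Y \<Longrightarrow> isoJ X Y"
proof -
  assume "isomorphic \<C> X Y"
  then obtain f g where f: "f \<in> Hom \<C> X Y" "g \<in> Hom \<C> Y X" "g \<cdot> f = Idn \<C> X" "f \<cdot> g = Idn \<C> Y"
    unfolding isomorphic_def is_iso_def Hom_def by auto
  then show ?thesis unfolding isoJ_def using eqv_refl idn_hom hom_obj by metis
qed

lemma sL_additive: "additive_subcat \<C> sL"
  unfolding additive_subcat_def
proof (intro conjI allI impI)
  show "sL \<subseteq> Obj \<C>" using sL_U mem_obj by blast
  show "\<exists>N \<in> sL. is_zero \<C> N" using ex_zero zero_mem(1) S_sL by blast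
  show "B \<in> sL" if "X \<in> sL" "Y \<in> sL" "is_biproduct \<C> X Y B" for X Y B using sL_sum that by blast
  show "Y \<in> sL" if "X \<in> sL" "isomorphic \<C> X Y" for X Y using sL_iso isomorphic_isoJ that by blast
  show "X \<in> sL" "Y \<in> sL" if "B \<in> sL" "is_biproduct \<C> X Y B" for X Y B using sL_summand that by blast+
qed

lemma op_isomorphic: "isomorphic (op_cat \<C>) X Y \<longleftrightarrow> isomorphic \<C> X Y"
proof -
  have "isomorphic D X Y \<longleftrightarrow> (\<exists>f \<in> Hom D X Y. \<exists>g \<in> Hom D Y X. g \<cdot>\<^bsub>D\<^esub> f = Idn D X \<and> f \<cdot>\<^bsub>D\<^esub> g = Idn D Y)"
    for D :: "('o, 'm, 'y) cat_data_scheme"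
    unfolding isomorphic_def is_iso_def Hom_def by auto
  from this[of "op_cat \<C>"] this[of \<C>] show ?thesis by auto
qed

lemma wR_additive: "additive_subcat \<C> wR"
  using mutable_classes.sL_additive[OF op_classes]
  unfolding additive_subcat_def op_sL op_isomorphic is_biproduct_op_cat is_zero_op_cat op_cat_simps .

text \<open>The form, in \<C> itself, of the statement that every object of the quotient lies in L *
  \<Sigma>R.\<close>

definition enough :: bool where
  "enough \<longleftrightarrow> (\<forall>Z \<in> T \<inter> U. \<exists>B f X g. B \<in> wR \<and> X \<in> L \<and> tri B f X g Z)"

lemma U_resolution:
  assumes "enough" and D: "D \<in> U"
  obtains B f A g where "B \<in> wR" "A \<in> sL" "tri B f A g D"
proof -
  obtain Y where Y: "srel D Y" using srel_exists mem_obj D by blast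
  have YZ: "Y \<in> T \<inter> U" using srel_T Y srel_in_U D by blast
  obtain t S' s where S': "Y \<in> T" "S' \<in> S" "tri D t Y s S'" using srelE[OF Y] .
  obtain B b X p where B: "B \<in> wR" "X \<in> L" "tri B b X p Y" using assms(1) YZ unfolding enough_def by blast
  \<comment> \<open>P is the pull-back of X -> Y along D -> Y. It lies in T * U, and X is its
    reflection because the cone of P -> X is S'.\<close>
  obtain P y f g where P: "tri P y X (s \<cdot> p) S'" "tri B f P g D" using oct_comp[OF B(3) S'(3)] by blast
  obtain V0 v A u where A: "V0 \<in> V" "A \<in> U" "tri V0 v A u P"
    using U_cover tri_homs(3)[OF P(1)] by blast
  obtain Q where Q: "srel A Q" using srel_exists mem_obj A(2) by blast
  have X: "X \<in> T" "X \<in> U" using B(2) L_Z by blast+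
  \<comment> \<open>X lies in U and so is its own U-cover; (I) therefore identifies the reflection
    of the U-cover A of P with X.\<close>
  have "isoJ Q X"
    by (rule comparison[OF P(2) wR_T[OF B(1)] D wrelI[OF A(3,2,1)] Q srelI[OF P(1) X(1) S'(2)]
          wrel_self[OF X(2)]])
  then have "A \<in> sL" using sLI[OF A(2) Q] L_iso isoJ_sym B(2) by blast
  \<comment> \<open>Passing from P to its cover enlarges the kernel B by V0 in V, a change that
    \<omega> does not see.\<close>
  obtain B' y' f' g' where B': "tri B' y' A (g \<cdot> u) D" "tri V0 f' B' g' B"
    using oct_comp[OF A(3) P(2)] by blast
  have "B' \<in> T" using T_extension[OF B'(2)] V_T A(1) wR_T[OF B(1)] by blast
  moreover obtain C C' where C: "wrel B C" "wrel B' C'"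
    using wrel_exists[OF tri_homs(4)[OF B'(2)]] wrel_exists[OF tri_homs(5)[OF B'(2)]] by blast
  ultimately have "B' \<in> wR" using wrel_ext[OF B'(2) A(1) C] wRD[OF B(1) C(1)] R_iso wRI C(2) by blast
  then show ?thesis using that \<open>A \<in> sL\<close> B'(1) by blast
qed

text \<open>Resolve the cone Z1 of a \<open>\<J>\<close>-hull of Z and pull back along I -> Z1. The
  pull-back E agrees with B modulo \<open>\<J>\<close> and lies in \<Z>, hence in R, and Z -> E -> A
  is the mirrored triangle.\<close>

lemma enough_op: assumes "enough" shows "mutable_classes.enough tri_op U T S R L"
  unfolding mutable_classes.enough_def[OF op_classes] classes_op_simps
proof
  fix Z assume "Z \<in> U \<inter> T"
  then have Z: "Z \<in> T" "Z \<in> U" by auto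
  obtain i I p Z1 where I: "Z1 \<in> U" "I \<in> \<J>" "tri Z i I p Z1" using J_hull[OF Z(2)] .
  obtain B b A a where B: "B \<in> wR" "A \<in> sL" "tri B b A a Z1" using U_resolution[OF assms I(1)] .
  obtain E f g k y where E: "tri Z f E g A" "tri B k E y I" using oct_pull[OF I(3) B(3)] by blast
  have EZ: "E \<in> T" "E \<in> U"
    using T_extension[OF E(2) wR_T[OF B(1)] J_mem(2)[OF I(2)]] U_extension[OF E(1) Z(2) sL_U[OF B(2)]] .
  have "isoJ E B" by (rule split_isoJ_op[OF E(2) I(2) J_ext(1)[OF I(2) wR_T[OF B(1)]]])
  moreover obtain C where "wrel B C" using wrel_exists tri_homs(3)[OF E(2)] by blast
  ultimately have "E \<in> R"
    using wrel_iso[OF _ wrel_self[OF EZ(2)], of B C] wRD[OF B(1)] R_iso isoJ_sym by blast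
  then show "\<exists>B f X g. B \<in> sL \<and> X \<in> R \<and> tri Z g X f B" using E(1) B(2) by blast
qed

lemma T_coresolution:
  assumes "enough" and D: "D \<in> T"
  obtains B f A g where "B \<in> wR" "A \<in> sL" "tri D f B g A"
proof (rule mutable_classes.U_resolution[OF op_classes enough_op[OF assms(1)] D], unfold classes_op_simps)
  fix B f A g assume "B \<in> sL" "A \<in> wR" "tri D g A f B"
  then show ?thesis using that by blast
qed

text \<open>A resolution of the U-cover of C gives one of C, but its kernel B is only an extension
  of V0 by B', and \<open>wR\<close> is not yet known to be closed under extensions. Coresolving B
  instead exhibits it as a summand of B1.\<close>

lemma resolution:
  assumes "enough" and ext: "\<And>A B. A \<in> sL \<Longrightarrow> B \<in> wR \<Longrightarrow> ext0 A B" and C: "C \<in> Obj \<C>"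
  obtains B f A g where "B \<in> wR" "A \<in> sL" "tri B f A g C"
proof -
  obtain V0 v D u where D: "V0 \<in> V" "D \<in> U" "tri V0 v D u C" using U_cover[OF C] by blast
  obtain B' b A a where A: "B' \<in> wR" "A \<in> sL" "tri B' b A a D" using U_resolution[OF assms(1) D(2)] .
  obtain B y f g where B: "tri B y A (u \<cdot> a) C" "tri B' f B g V0" using oct_comp[OF A(3) D(3)] by blast
  have BT: "B \<in> T" using T_extension[OF B(2) wR_T[OF A(1)]] V_T D(1) by blast
  obtain B1 j A1 p where B1: "B1 \<in> wR" "A1 \<in> sL" "tri B j B1 p A1" using T_coresolution[OF assms(1) BT] .
  \<comment> \<open>Vanishing against the two constituents B' and V0 of B is known, and
    half-exactness gives it for B.\<close>
  have "ext0 A1 B" using ext0_right[OF B(2) ext[OF B1(2) A(1)] ext_UV[OF sL_U[OF B1(2)] D(1)]] .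
  then obtain s where s: "s \<in> Hom \<C> A1 B1" "p \<cdot> s = Idn \<C> A1" using ext0D B1(3) by blast
  obtain r where r: "r \<in> Hom \<C> B1 B" "r \<cdot> j = Idn \<C> B" "r \<cdot> s = Zer \<C> A1 B" "Plus \<C> (j \<cdot> r) (s \<cdot> p) = Idn \<C> B1"
    using tri_split[OF B1(3) s] by blast
  have "is_biproduct \<C> B A1 B1"
    unfolding is_biproduct_def using s r tri_homs[OF B1(3)] tri_comp[OF B1(3)] by blast
  then have "B \<in> wR" using wR_additive B1(1) unfolding additive_subcat_def by blast
  then show ?thesis using that A(2) B(1) by blast
qed

text \<open>Only the vanishing of the morphisms \<open>L \<rightarrow> \<Sigma>R\<close> modulo \<open>\<I>\<close> is known.  It makes the morphism
  \<open>A \<rightarrow> U\<^sub>3\<close> that classifies an extension of \<open>A\<close> by \<open>B\<close> factor through an object whose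
  \<open>\<U>\<close>-cover lies in \<open>\<S>\<close> by (I) and (II).\<close>

lemma ext_sL_wR:
  assumes orth: "\<And>X Y Y' f. \<lbrakk>X \<in> L; Y \<in> R; Srel Y Y'; f \<in> Hom \<C> X Y'\<rbrakk> \<Longrightarrow> null X Y' f"
    and A: "A \<in> sL" and B: "B \<in> wR"
  shows "ext0 A B"
  unfolding ext0_def
proof (intro allI impI)
  fix X i g assume X: "tri B i X g A"
  obtain f V0 p U3 where V0: "V0 \<in> V" "U3 \<in> U" "tri B f V0 p U3"
    using V_hull tri_homs(3)[OF X] by blast
  obtain P f' g' y c where P: "tri V0 f' P g' A" "tri X y P c U3" "g' \<cdot> y = g" "c \<cdot> f' = p"
    using oct_push[OF X V0(3)] by blast
  note h = tri_homs(1,2)[OF P(1)] tri_homs(1,2)[OF P(2)] tri_homs(1,2)[OF V0(3)]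
  obtain s where s: "s \<in> Hom \<C> A P" "g' \<cdot> s = Idn \<C> A"
    using ext0D[OF ext_UV[OF sL_U[OF A] V0(1)] P(1)] by blast
  \<comment> \<open>P splits as V0 plus A, and c has components p and a. The original extension
    splits exactly when a lifts along p.\<close>
  define a where "a = c \<cdot> s"
  have a: "a \<in> Hom \<C> A U3" unfolding a_def by (rule comp_hom[OF s(1) h(4)])
  obtain Y where Y: "srel U3 Y" using srel_exists mem_obj V0(2) by blast
  obtain t S3 s3 where t: "Y \<in> T" "S3 \<in> S" "tri U3 t Y s3 S3" using srelE[OF Y] .
  obtain C where C: "wrel B C" "C \<in> R" using B unfolding wR_def by blast
  obtain Y' where Y': "Srel C Y'" using Srel_exists wrel_U[OF C(1)] by blast
  \<comment> \<open>The reflection of U3 is \<Sigma>\<omega>(B), so the orthogonality hypothesis can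
    be applied to \<sigma>(a), represented by x below.\<close>
  have "isoJ Y Y'" by (rule Srel_hull[OF V0(3) wR_T[OF B] V0(1,2) C(1) Y Y'])
  then obtain z w where z: "z \<in> Hom \<C> Y Y'" "w \<in> Hom \<C> Y' Y" "eqv Y Y (w \<cdot> z) (Idn \<C> Y)"
    unfolding isoJ_def by blast
  obtain D where D: "srel A D" "D \<in> L" using A unfolding sL_def by blast
  obtain ta SA sa where ta: "D \<in> T" "SA \<in> S" "tri A ta D sa SA" using srelE[OF D(1)] .
  note t1 = tri_homs(1)[OF t(3)]
  obtain x where x: "x \<in> Hom \<C> D Y" "x \<cdot> ta = t \<cdot> a"
    using hull_extend[OF ta(3,2) t(1) comp_hom[OF a t1]] by blast
  have "null D Y' (z \<cdot> x)" by (rule orth[OF D(2) C(2) Y' comp_hom[OF x(1) z(1)]])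
  then have "null D Y ((w \<cdot> z) \<cdot> x)"
    using null_comp_left[OF _ z(2)] comp_assoc[OF x(1) z(1,2)] by simp
  then have "null D Y x"
    using eqv_null[OF eqv_sym[OF eqv_comp_right[OF x(1) z(3)]]] idn_left[OF x(1)] by simp
  then have "null A Y (t \<cdot> a)" using null_comp_right[OF _ tri_homs(1)[OF ta(3)]] x(2) by metis
  then obtain J' d' d where J': "J' \<in> \<J>" "d' \<in> Hom \<C> A J'" "d \<in> Hom \<C> J' Y" "t \<cdot> a = d \<cdot> d'"
    unfolding null_def by blast
  \<comment> \<open>This S-cover of Y absorbs the arbitrary object J' and has its kernel in T, which
    puts the pull-back F below into T * U.\<close>
  obtain T0 e J j where J: "T0 \<in> T" "J \<in> \<J>" "tri T0 e J j Y" using J_cover[OF t(1)] .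
  obtain k where k: "k \<in> Hom \<C> J' J" "j \<cdot> k = d" using ext_lift[OF J_ext(1)[OF J'(1) J(1)] J(3) J'(3)] by blast
  have jk: "j \<cdot> (k \<cdot> d') = t \<cdot> a"
    using comp_assoc[OF J'(2) k(1) tri_homs(2)[OF J(3)]] k(2) J'(4) by simp
  \<comment> \<open>F is the pull-back of J -> Y along U3 -> Y. As t a passes through J, the weak
    pull-back clause lifts a to F.\<close>
  obtain F y1 f1 g1 where F: "tri F y1 J (s3 \<cdot> j) S3" "tri T0 f1 F g1 U3" and
    F_lift: "\<forall>A a b. a \<in> Hom \<C> A U3 \<longrightarrow> b \<in> Hom \<C> A J \<longrightarrow> j \<cdot> b = t \<cdot> a \<longrightarrow>
        (\<exists>c \<in> Hom \<C> A F. g1 \<cdot> c = a)"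
    using oct_comp[OF J(3) t(3)] by blast
  obtain b where b: "b \<in> Hom \<C> A F" "g1 \<cdot> b = a" using F_lift a comp_hom[OF J'(2) k(1)] jk by blast
  obtain V1 v W u where W: "V1 \<in> V" "W \<in> U" "tri V1 v W u F" using U_cover tri_homs(3)[OF F(1)] by blast
  obtain b' where b': "b' \<in> Hom \<C> A W" "u \<cdot> b' = b"
    using cover_lift[OF W(3,1) sL_U[OF A] b(1)] by blast
  obtain Q where Q: "srel W Q" using srel_exists mem_obj W(2) by blast
  obtain q S4 q' where S4: "S4 \<in> S" "tri W q Q q' S4" using srelE[OF Q] .
  \<comment> \<open>F has reflection J, so by (I) the reflection of its cover W vanishes modulo
    \<open>\<J>\<close>; then (II) puts W into S.\<close>
  have "isoJ Q J"
    by (rule comparison[OF F(2) J(1) V0(2) wrelI[OF W(3,2,1)] Q srelI[OF F(1) J_mem(2)[OF J(2)] t(2)]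
          wrel_self[OF J_mem(3)[OF J(2)]]])
  then have "Q \<in> \<J>" using J_iso isoJ_sym J(2) by blast
  then have WS: "W \<in> S" using U_Nf[OF S4(2) W(2) J_mem(4) S4(1)] by blast
  note gu = comp_hom[OF tri_homs(2)[OF W(3)] tri_homs(2)[OF F(2)]]
  \<comment> \<open>The morphism W -> U3 lifts along p because W is in S and B is in T. Since a
    factors through W, it lifts too.\<close>
  obtain m where m: "m \<in> Hom \<C> W V0" "p \<cdot> m = g1 \<cdot> u"
    using ext_lift[OF ext_ST[OF WS wR_T[OF B]] V0(3) gu] by blast
  \<comment> \<open>The correction removes the U3-component of s and stays a section of g', so the
    result descends to X.\<close>
  define s' where "s' = arr_minus \<C> s (f' \<cdot> (m \<cdot> b'))"
  note mb = comp_hom[OF b'(1) m(1)]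
  note fmb = comp_hom[OF mb h(1)]
  have s': "s' \<in> Hom \<C> A P" unfolding s'_def by (rule minus_hom[OF s(1) fmb])
  have "c \<cdot> (f' \<cdot> (m \<cdot> b')) = p \<cdot> (m \<cdot> b')" using comp_assoc[OF mb h(1,4)] P(4) by simp
  also have "\<dots> = (g1 \<cdot> u) \<cdot> b'" using comp_assoc[OF b'(1) m(1) h(6)] m(2) by simp
  also have "\<dots> = a" using comp_assoc[OF b'(1) tri_homs(2)[OF W(3)] tri_homs(2)[OF F(2)]] b(2) b'(2) by simp
  finally have "c \<cdot> s' = Zer \<C> A U3"
    unfolding s'_def using comp_minus[OF s(1) fmb h(4)] minus_self[OF a] a_def by simp
  then obtain s'' where s'': "s'' \<in> Hom \<C> A X" "s' = y \<cdot> s''" using tri_lift[OF P(2) s'] by blast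
  have oA: "A \<in> Obj \<C>" "V0 \<in> Obj \<C>" using tri_homs(3,5)[OF P(1)] by auto
  have "g' \<cdot> (f' \<cdot> (m \<cdot> b')) = Zer \<C> A A"
    using comp_assoc[OF mb h(1,2)] tri_comp[OF P(1)] zer_comp[OF mb oA(1)] by simp
  then have "g' \<cdot> s' = Idn \<C> A"
    unfolding s'_def using comp_minus[OF s(1) fmb h(2)] s(2) minus_zer[OF idn_hom[OF oA(1)]] by simp
  then have "g \<cdot> s'' = Idn \<C> A" using comp_assoc[OF s''(1) h(3) h(2)] P(3) s''(2) by simp
  then show "\<exists>s \<in> Hom \<C> A X. g \<cdot> s = Idn \<C> A" using s''(1) by blast
qed

end

text \<open>\<open>oct_meet\<close> takes all three triangles as given instead of producing one, and
  it is kept apart from the axioms that are passed to the opposite category.\<close>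

locale mutable_oct = mutable_twin \<C> \<J> tri S T U V
  for \<C> :: "('o, 'm, 'z) cat_data_scheme" (structure) and \<J> :: "'o set"
    and tri :: "'o \<Rightarrow> 'm \<Rightarrow> 'o \<Rightarrow> 'm \<Rightarrow> 'o \<Rightarrow> bool" and S T U V :: "'o set" +
  assumes oct_meet: "\<lbrakk>tri C c D p X; tri B b D q Z; tri A a C (q \<cdot> c) Z\<rbrakk> \<Longrightarrow> \<exists>a' p'. tri A a' B p' X"
begin

text \<open>A standard triangle reaches Z only up to isomorphism modulo \<open>\<J>\<close>. Adding
  a cover J of Z to Y gives a morphism E -> Z with kernel K in \<open>\<J>\<close>; X' is the fibre
  of E -> D and B that of X' -> Z. The octahedron yields A -> B -> X, so B is in T, and B -> K -> D,
  to which \<open>Srel_hull\<close> applies. Injectivity of \<Sigma> then identifies \<omega>(B)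
  with R.\<close>

lemma triangle_cover:
  assumes t: "tri X f Y g D" "X \<in> U" "D \<in> U" and Z: "isoJ Y Z" "Z \<in> T" "X \<in> T"
    and W: "srel D W" "Srel R W'" "isoJ W W'" "R \<in> T" "R \<in> U"
  obtains B b X' p R' where "tri B b X' p Z" "isoJ X' X" "B \<in> T" "wrel B R'" "isoJ R' R"
proof -
  obtain A a J j i E q k K e where J: "A \<in> T" "J \<in> \<J>" "K \<in> \<J>" "tri A a J j Z"
    "tri J i E q Y" "tri K k E e Z" "e \<cdot> i = j" using iso_kernel[OF Z(1,2)] .
  obtain X' y f' g' where X': "tri X' y E (g \<cdot> q) D" "tri J f' X' g' X" "y \<cdot> f' = i"
    using oct_comp[OF J(5) t(1)] by blast
  note y = tri_homs(1)[OF X'(1)] and e = tri_homs(2)[OF J(6)]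
  obtain B b where B: "tri B b X' (e \<cdot> y) Z" using tri_fiber[OF comp_hom[OF y e]] by blast
  have "(e \<cdot> y) \<cdot> f' = j" using comp_assoc[OF tri_homs(1)[OF X'(2)] y e] X'(3) J(7) by simp
  then obtain a' p' where "tri A a' B p' X" using oct_meet[OF X'(2) B] J(4) by blast
  then have BT: "B \<in> T" using T_extension J(1) Z(3) by blast
  obtain a'' p'' where K: "tri B a'' K p'' D" using oct_meet[OF X'(1) J(6) B] by blast
  obtain R' where R': "wrel B R'" using wrel_exists mem_obj(2)[OF BT] by blast
  note R'Z = wrel_in_T[OF R' BT] wrel_U[OF R']
  obtain W'' where W'': "Srel R' W''" using Srel_exists R'Z by blast
  have "isoJ W W''" by (rule Srel_hull[OF K BT J_mem(4)[OF J(3)] t(3) R' W(1) W''])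
  then have "isoJ W'' W'" using W(3) isoJ_sym isoJ_trans by blast
  then have "isoJ R' R" by (rule Srel_inj[OF R'Z W(4,5) W'' W(2)])
  moreover have "isoJ X' X" by (rule split_isoJ[OF X'(2) J(2) J_ext(2)[OF J(2) t(2)]])
  ultimately show ?thesis using that B BT R' by blast
qed

end

section \<open>Triangulated categories satisfy the calculus\<close>

context additive_category
begin

lemma is_isoI: "\<lbrakk>f \<in> Hom \<C> X Y; g \<in> Hom \<C> Y X; g \<cdot> f = Idn \<C> X; f \<cdot> g = Idn \<C> Y\<rbrakk> \<Longrightarrow> is_iso \<C> f"
  unfolding is_iso_def Hom_def by auto

lemma is_isoE:
  assumes "is_iso \<C> f" "f \<in> Hom \<C> X Y"
  obtains g where "g \<in> Hom \<C> Y X" "g \<cdot> f = Idn \<C> X" "f \<cdot> g = Idn \<C> Y" "is_iso \<C> g"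
  using assms unfolding is_iso_def Hom_def by auto

lemma idn_iso: "X \<in> Obj \<C> \<Longrightarrow> is_iso \<C> (Idn \<C> X)"
  using is_isoI[OF idn_hom idn_hom] idn_left[OF idn_hom] by simp

lemma neg_idn_iso: assumes "X \<in> Obj \<C>" shows "is_iso \<C> (neg \<C> (Idn \<C> X))"
proof -
  note i = idn_hom[OF assms] neg_hom[OF idn_hom[OF assms]]
  have "neg \<C> (Idn \<C> X) \<cdot> neg \<C> (Idn \<C> X) = Idn \<C> X"
    using neg_comp[OF i(2,1)] idn_left[OF i(2)] neg_neg[OF i(1)] by simp
  then show ?thesis using is_isoI[OF i(2,2)] by simp
qed

lemma neg_inject: "\<lbrakk>f \<in> Hom \<C> X Y; g \<in> Hom \<C> X Y; neg \<C> f = neg \<C> g\<rbrakk> \<Longrightarrow> f = g"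
  using neg_neg by metis

lemma zeroI: assumes "N \<in> Obj \<C>" "Idn \<C> N = Zer \<C> N N" shows "is_zero \<C> N"
  unfolding is_zero_def
proof (intro conjI ballI)
  fix X assume X: "X \<in> Obj \<C>"
  have "f = Zer \<C> N X" if "f \<in> Hom \<C> N X" for f
    using idn_right[OF that] comp_zer[OF that assms(1)] assms(2) by simp
  then show "Hom \<C> N X = {Zer \<C> N X}" using zer_hom[OF assms(1) X] by blast
  have "f = Zer \<C> X N" if "f \<in> Hom \<C> X N" for f
    using idn_left[OF that] zer_comp[OF that assms(1)] assms(2) by simp
  then show "Hom \<C> X N = {Zer \<C> X N}" using zer_hom[OF X assms(1)] by blast
qed (rule assms(1))

end

section \<open>Triangles with recorded third morphism: rotation, signs and shift\<close>

context triangulated_category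
begin

abbreviation sh :: "'o \<Rightarrow> 'o" where "sh \<equiv> sh_obj \<C>"
abbreviation sha :: "'m \<Rightarrow> 'm" where "sha \<equiv> sh_arr \<C>"

lemma sh_hom: "f \<in> Hom \<C> X Y \<Longrightarrow> sha f \<in> Hom \<C> (sh X) (sh Y)"
  using bij_betwE[OF sh_full_faithful[of X Y]] hom_obj[of f X Y] by blast

lemma sh_inj: "\<lbrakk>f \<in> Hom \<C> X Y; g \<in> Hom \<C> X Y; sha f = sha g\<rbrakk> \<Longrightarrow> f = g"
  using sh_full_faithful[of X Y] hom_obj[of f X Y] unfolding bij_betw_def inj_on_def by blast

lemma sh_full:
  assumes "X \<in> Obj \<C>" "Y \<in> Obj \<C>" "g \<in> Hom \<C> (sh X) (sh Y)"
  obtains f where "f \<in> Hom \<C> X Y" "g = sha f"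
  using sh_full_faithful[OF assms(1,2)] assms(3) unfolding bij_betw_def by blast

lemma sh_zer: assumes "X \<in> Obj \<C>" "Y \<in> Obj \<C>" shows "sha (Zer \<C> X Y) = Zer \<C> (sh X) (sh Y)"
proof -
  note z = zer_hom[OF assms]
  have "Plus \<C> (sha (Zer \<C> X Y)) (sha (Zer \<C> X Y)) = Plus \<C> (Zer \<C> (sh X) (sh Y)) (sha (Zer \<C> X Y))"
    using sh_plus[OF z z] plus_zer[OF z] zer_plus[OF sh_hom[OF z]] by simp
  then show ?thesis
    by (rule plus_cancel[OF sh_hom[OF z] zer_hom[OF sh_obj_closed[OF assms(1)] sh_obj_closed[OF assms(2)]] sh_hom[OF z]])
qed

lemma sh_neg: assumes "f \<in> Hom \<C> X Y" shows "sha (neg \<C> f) = neg \<C> (sha f)"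
proof -
  note s = sh_hom[OF assms]
  have "Plus \<C> (sha (neg \<C> f)) (sha f) = Plus \<C> (neg \<C> (sha f)) (sha f)"
    using sh_plus[OF neg_hom[OF assms] assms] neg_plus[OF assms] neg_plus[OF s]
      sh_zer[OF hom_obj[OF assms]] by simp
  then show ?thesis by (rule plus_cancel[OF sh_hom[OF neg_hom[OF assms]] neg_hom[OF s] s])
qed

definition tri3 :: "'o \<Rightarrow> 'm \<Rightarrow> 'o \<Rightarrow> 'm \<Rightarrow> 'o \<Rightarrow> 'm \<Rightarrow> bool" where
  "tri3 X f Y g Z h \<longleftrightarrow> (f, g, h) \<in> Tri \<C> \<and> f \<in> Hom \<C> X Y \<and> g \<in> Hom \<C> Y Z \<and> h \<in> Hom \<C> Z (sh X)"

lemma tri3D: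
  assumes "tri3 X f Y g Z h"
  shows "(f, g, h) \<in> Tri \<C>" "f \<in> Hom \<C> X Y" "g \<in> Hom \<C> Y Z" "h \<in> Hom \<C> Z (sh X)"
    "X \<in> Obj \<C>" "Y \<in> Obj \<C>" "Z \<in> Obj \<C>"
  using assms hom_obj unfolding tri3_def by blast+

lemma Tri_tri3: "(f, g, h) \<in> Tri \<C> \<Longrightarrow> tri3 (Dom \<C> f) f (Cod \<C> f) g (Cod \<C> g) h"
  using tri_candidate[of "(f, g, h)"] unfolding tri3_def candidate_triangle_def Hom_def by auto

lemma candidateI: "\<lbrakk>f \<in> Hom \<C> X Y; g \<in> Hom \<C> Y Z; h \<in> Hom \<C> Z (sh X)\<rbrakk> \<Longrightarrow> candidate_triangle \<C> (f, g, h)"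
  unfolding candidate_triangle_def Hom_def by auto

lemma tri3_rotate:
  assumes "f \<in> Hom \<C> X Y" "g \<in> Hom \<C> Y Z" "h \<in> Hom \<C> Z (sh X)"
  shows "tri3 Y g Z h (sh X) (neg \<C> (sha f)) \<longleftrightarrow> tri3 X f Y g Z h"
  unfolding tri3_def using TR2[OF candidateI[OF assms]] assms neg_hom[OF sh_hom[OF assms(1)]] by blast

lemma tri3_rot: "tri3 X f Y g Z h \<Longrightarrow> tri3 Y g Z h (sh X) (neg \<C> (sha f))"
  using tri3_rotate[of f X Y g Z h] tri3D(2-4)[of X f Y g Z h] by simp

lemma tri3_transport:
  assumes t: "tri3 X f Y g Z h"
    and h: "f' \<in> Hom \<C> X' Y'" "g' \<in> Hom \<C> Y' Z'" "h' \<in> Hom \<C> Z' (sh X')"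
    and i: "x \<in> Hom \<C> X X'" "y \<in> Hom \<C> Y Y'" "z \<in> Hom \<C> Z Z'" "is_iso \<C> x" "is_iso \<C> y" "is_iso \<C> z"
    and e: "y \<cdot> f = f' \<cdot> x" "z \<cdot> g = g' \<cdot> y" "sha x \<cdot> h = h' \<cdot> z"
  shows "tri3 X' f' Y' g' Z' h'"
proof -
  have "tri_mor \<C> (f, g, h) (f', g', h') (x, y, z)"
    using tri3D[OF t] h i e unfolding tri_mor_def Hom_def by auto
  then have "tri_iso \<C> (f, g, h) (f', g', h')" unfolding tri_iso_def using i by blast
  then show ?thesis
    unfolding tri3_def using TR1_iso[OF tri3D(1)[OF t] candidateI[OF h]] h by blast
qed

text \<open>Changing the sign of two adjacent morphisms amounts to applying -1 to the object between
  them.\<close>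

lemma tri3_signs:
  assumes t: "tri3 X f Y g Z h"
  shows "tri3 X (neg \<C> f) Y (neg \<C> g) Z h" "tri3 X f Y (neg \<C> g) Z (neg \<C> h)"
proof -
  note h = tri3D[OF t]
  note X = idn_hom[OF h(5)] and Y = idn_hom[OF h(6)] and Z = idn_hom[OF h(7)]
  note iso = idn_iso[OF h(5)] idn_iso[OF h(6)] idn_iso[OF h(7)] neg_idn_iso[OF h(6)] neg_idn_iso[OF h(7)]
  show "tri3 X (neg \<C> f) Y (neg \<C> g) Z h"
    by (rule tri3_transport[OF t neg_hom[OF h(2)] neg_hom[OF h(3)] h(4) X neg_hom[OF Y] Z iso(1,4,3)])
      (simp_all add: neg_comp[OF h(2) Y] idn_left[OF h(2)] idn_right[OF neg_hom[OF h(2)]] idn_left[OF h(3)]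
        comp_neg[OF Y neg_hom[OF h(3)]] idn_right[OF neg_hom[OF h(3)]] neg_neg[OF h(3)] sh_idn[OF h(5)]
        idn_left[OF h(4)] idn_right[OF h(4)])
  show "tri3 X f Y (neg \<C> g) Z (neg \<C> h)"
    by (rule tri3_transport[OF t h(2) neg_hom[OF h(3)] neg_hom[OF h(4)] X Y neg_hom[OF Z] iso(1,2,5)])
      (simp_all add: idn_left[OF h(2)] idn_right[OF h(2)] idn_left[OF h(3)] neg_comp[OF h(3) Z]
        idn_right[OF neg_hom[OF h(3)]] comp_neg[OF Z neg_hom[OF h(4)]] idn_right[OF neg_hom[OF h(4)]]
        neg_neg[OF h(4)] sh_idn[OF h(5)] idn_left[OF h(4)])
qed

text \<open>Three rotations shift a triangle and reverse all three signs; two of the signs can be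
  removed. The equivalence also allows triangles to be unshifted.\<close>

lemma tri3_shift:
  assumes h: "f \<in> Hom \<C> X Y" "g \<in> Hom \<C> Y Z" "h \<in> Hom \<C> Z (sh X)"
  shows "tri3 (sh X) (sha f) (sh Y) (sha g) (sh Z) (neg \<C> (sha h)) \<longleftrightarrow> tri3 X f Y g Z h"
proof -
  note s = sh_hom[OF h(1)] sh_hom[OF h(2)] sh_hom[OF h(3)]
  have "tri3 X f Y g Z h \<longleftrightarrow> tri3 (sh X) (neg \<C> (sha f)) (sh Y) (neg \<C> (sha g)) (sh Z) (neg \<C> (sha h))"
    using tri3_rotate[OF h] tri3_rotate[OF h(2,3) neg_hom[OF s(1)]]
      tri3_rotate[OF h(3) neg_hom[OF s(1)] neg_hom[OF s(2)]] by blast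
  also have "\<dots> \<longleftrightarrow> tri3 (sh X) (sha f) (sh Y) (sha g) (sh Z) (neg \<C> (sha h))"
    using tri3_signs(1)[of "sh X" "sha f" "sh Y" "sha g" "sh Z" "neg \<C> (sha h)"]
      tri3_signs(1)[of "sh X" "neg \<C> (sha f)" "sh Y" "neg \<C> (sha g)" "sh Z" "neg \<C> (sha h)"]
      neg_neg[OF s(1)] neg_neg[OF s(2)] by auto
  finally show ?thesis by blast
qed

lemma sh_zero: assumes "is_zero \<C> N" shows "is_zero \<C> (sh N)"
proof -
  have N: "N \<in> Obj \<C>" using assms unfolding is_zero_def by blast
  show ?thesis
    using zeroI[OF sh_obj_closed[OF N]] sh_idn[OF N] zero_obj_hom(1)[OF assms idn_hom[OF N]] sh_zer[OF N N]
    by simp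
qed

lemma tri3_idn:
  assumes X: "X \<in> Obj \<C>" and N: "is_zero \<C> N"
  shows "tri3 X (Idn \<C> X) X (Zer \<C> X N) N (Zer \<C> N (sh X))"
    "tri3 N (Zer \<C> N X) X (Idn \<C> X) X (Zer \<C> X (sh N))"
proof -
  have NO: "N \<in> Obj \<C>" using N unfolding is_zero_def by blast
  have 1: "tri3 X (Idn \<C> X) X (Zer \<C> X M) M (Zer \<C> M (sh X))" if "is_zero \<C> M" for M
  proof -
    have "M \<in> Obj \<C>" using that unfolding is_zero_def by blast
    then show ?thesis unfolding tri3_def using TR1_idn[OF X that] idn_hom X zer_hom sh_obj_closed by auto
  qed
  show "tri3 X (Idn \<C> X) X (Zer \<C> X N) N (Zer \<C> N (sh X))" by (rule 1[OF N])
  have "neg \<C> (sha (Zer \<C> N X)) = Zer \<C> (sh N) (sh X)"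
    using sh_zer[OF NO X] neg_zer[OF sh_obj_closed[OF NO] sh_obj_closed[OF X]] by simp
  then show "tri3 N (Zer \<C> N X) X (Idn \<C> X) X (Zer \<C> X (sh N))"
    using 1[OF sh_zero[OF N]] tri3_rotate[OF zer_hom[OF NO X] idn_hom[OF X] zer_hom[OF X sh_obj_closed[OF NO]]]
    by simp
qed

lemma tri3_mor:
  assumes t: "tri3 X f Y g Z h" "tri3 X' f' Y' g' Z' h'"
    and x: "x \<in> Hom \<C> X X'" "y \<in> Hom \<C> Y Y'" "y \<cdot> f = f' \<cdot> x"
  obtains z where "z \<in> Hom \<C> Z Z'" "z \<cdot> g = g' \<cdot> y" "sha x \<cdot> h = h' \<cdot> z"
proof -
  note a = tri3D[OF t(1)] and b = tri3D[OF t(2)]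
  obtain z where "tri_mor \<C> (f, g, h) (f', g', h') (x, y, z)"
    using TR3[OF a(1) b(1) _ _ x(3)] a b x unfolding Hom_def by auto
  then show ?thesis using that a b unfolding tri_mor_def Hom_def by auto
qed

lemma tri3_comp: assumes t: "tri3 X f Y g Z h" shows "g \<cdot> f = Zer \<C> X Z" "h \<cdot> g = Zer \<C> Y (sh X)"
proof -
  have *: "g \<cdot> f = Zer \<C> X Z" if t: "tri3 X f Y g Z h" for X f Y g Z h
  proof -
    obtain N where N: "is_zero \<C> N" using ex_zero by blast
    note h = tri3D[OF t] and i = tri3_idn(1)[OF tri3D(5)[OF t] N]
    obtain z where z: "z \<in> Hom \<C> N Z" "z \<cdot> Zer \<C> X N = g \<cdot> f"
      using tri3_mor[OF i t idn_hom[OF h(5)] h(2)] by blast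
    then show ?thesis using comp_zer[OF z(1) h(5)] by simp
  qed
  show "g \<cdot> f = Zer \<C> X Z" "h \<cdot> g = Zer \<C> Y (sh X)" using *[OF t] *[OF tri3_rot[OF t]] by auto
qed

lemma tri3_comp_shift: assumes t: "tri3 X f Y g Z h" shows "sha f \<cdot> h = Zer \<C> Z (sh Y)"
proof -
  note a = tri3D[OF t]
  have "neg \<C> (sha f \<cdot> h) = neg \<C> (Zer \<C> Z (sh Y))"
    using tri3_comp(2)[OF tri3_rot[OF t]] neg_comp[OF a(4) sh_hom[OF a(2)]]
      neg_zer[OF a(7) sh_obj_closed[OF a(6)]] by simp
  then show ?thesis
    by (rule neg_inject[OF comp_hom[OF a(4) sh_hom[OF a(2)]] zer_hom[OF a(7) sh_obj_closed[OF a(6)]]])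
qed

text \<open>Compare the rotated triangle W -> 0 -> W[1] with the rotation of the given one and
  unshift the third component, using that the shift is full and faithful.\<close>

lemma tri3_lift:
  assumes t: "tri3 X f Y g Z h" and x: "x \<in> Hom \<C> W Y" "g \<cdot> x = Zer \<C> W Z"
  obtains x' where "x' \<in> Hom \<C> W X" "x = f \<cdot> x'"
proof -
  obtain N where N: "is_zero \<C> N" using ex_zero by blast
  note h = tri3D[OF t]
  have o: "W \<in> Obj \<C>" "N \<in> Obj \<C>" using hom_obj x N unfolding is_zero_def by blast+
  note r = tri3_rot[OF tri3_idn(1)[OF o(1) N]]
  have "Zer \<C> N Z \<cdot> Zer \<C> W N = g \<cdot> x" using comp_zer[OF zer_hom[OF o(2) h(7)] o(1)] x(2) by simp
  then obtain z where z: "z \<in> Hom \<C> (sh W) (sh X)"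
    "sha x \<cdot> neg \<C> (sha (Idn \<C> W)) = neg \<C> (sha f) \<cdot> z"
    using tri3_mor[OF r tri3_rot[OF t] x(1) zer_hom[OF o(2) h(7)]] by blast
  obtain x' where x': "x' \<in> Hom \<C> W X" "z = sha x'" using sh_full[OF o(1) h(5) z(1)] .
  have "sha x \<cdot> neg \<C> (sha (Idn \<C> W)) = neg \<C> (sha x)"
    using comp_neg[OF sh_hom[OF idn_hom[OF o(1)]] sh_hom[OF x(1)]] sh_comp[OF idn_hom[OF o(1)] x(1)]
      idn_right[OF x(1)] by simp
  moreover have "neg \<C> (sha f) \<cdot> z = neg \<C> (sha (f \<cdot> x'))"
    using neg_comp[OF sh_hom[OF x'(1)] sh_hom[OF h(2)]] sh_comp[OF x'(1) h(2)] x'(2) by simp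
  ultimately have "sha x = sha (f \<cdot> x')"
    using z(2) neg_neg[OF sh_hom[OF x(1)]] neg_neg[OF sh_hom[OF comp_hom[OF x'(1) h(2)]]] by metis
  then show ?thesis using that x'(1) sh_inj[OF x(1) comp_hom[OF x'(1) h(2)]] by blast
qed

lemma tri3_extend:
  assumes t: "tri3 X f Y g Z h" and x: "x \<in> Hom \<C> Y W" "x \<cdot> f = Zer \<C> X W"
  obtains x' where "x' \<in> Hom \<C> Z W" "x = x' \<cdot> g"
proof -
  obtain N where N: "is_zero \<C> N" using ex_zero by blast
  note h = tri3D[OF t]
  have o: "W \<in> Obj \<C>" "N \<in> Obj \<C>" using hom_obj x N unfolding is_zero_def by blast+
  have "x \<cdot> f = Zer \<C> N W \<cdot> Zer \<C> X N" using comp_zer[OF zer_hom[OF o(2,1)] h(5)] x(2) by simp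
  then obtain z where z: "z \<in> Hom \<C> Z W" "z \<cdot> g = Idn \<C> W \<cdot> x"
    using tri3_mor[OF t tri3_idn(2)[OF o(1) N] zer_hom[OF h(5) o(2)] x(1)] by blast
  then show ?thesis using that idn_left[OF x(1)] by auto
qed

text \<open>After two rotations, h is followed by X[1] -> Y[1], so the shift of x extends there;
  fullness brings the extension back.\<close>

lemma tri3_extend_shift:
  assumes t: "tri3 X f Y g Z h" and x: "x \<in> Hom \<C> X W" "sha x \<cdot> h = Zer \<C> Z (sh W)"
  obtains x' where "x' \<in> Hom \<C> Y W" "x = x' \<cdot> f"
proof -
  note h = tri3D[OF t]
  note W = hom_obj(2)[OF x(1)]
  obtain c where c: "c \<in> Hom \<C> (sh Y) (sh W)" "sha x = c \<cdot> neg \<C> (sha f)"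
    using tri3_extend[OF tri3_rot[OF tri3_rot[OF t]] sh_hom[OF x(1)] x(2)] by blast
  obtain c' where c': "c' \<in> Hom \<C> Y W" "c = sha c'" using sh_full[OF h(6) W c(1)] .
  note n = neg_hom[OF c'(1)]
  have "sha x = sha (neg \<C> c' \<cdot> f)"
    using c(2) c'(2) comp_neg[OF sh_hom[OF h(2)] sh_hom[OF c'(1)]] neg_comp[OF h(2) c'(1)]
      sh_neg[OF comp_hom[OF h(2) c'(1)]] sh_comp[OF h(2) c'(1)] by simp
  then show ?thesis using that[OF n] sh_inj[OF x(1) comp_hom[OF h(2) n]] by blast
qed

lemma tri3_cone: assumes "f \<in> Hom \<C> X Y" obtains g Z h where "tri3 X f Y g Z h"
proof -
  obtain g h where "(f, g, h) \<in> Tri \<C>" using TR1_complete assms unfolding Hom_def by blast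
  then have "tri3 X f Y g (Cod \<C> g) h" using Tri_tri3[of f g h] assms unfolding Hom_def by simp
  then show ?thesis by (rule that)
qed

text \<open>Since the shift is only essentially surjective, a triangle can be rotated backwards only
  after its third object has been replaced by an isomorphic shifted one.\<close>

lemma tri3_unrotate:
  assumes t: "tri3 Y g Z p W k"
  obtains X f s s' where "tri3 X f Y g Z (s' \<cdot> p)" "s \<in> Hom \<C> (sh X) W" "s' \<in> Hom \<C> W (sh X)"
    "s \<cdot> s' = Idn \<C> W" "is_iso \<C> s"
proof -
  note h = tri3D[OF t]
  obtain X where X: "X \<in> Obj \<C>" "isomorphic \<C> (sh X) W" using sh_ess_surj h(7) by blast
  then obtain s where s: "s \<in> Hom \<C> (sh X) W" "is_iso \<C> s" unfolding isomorphic_def by blast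
  obtain s' where s': "s' \<in> Hom \<C> W (sh X)" "s' \<cdot> s = Idn \<C> (sh X)" "s \<cdot> s' = Idn \<C> W" "is_iso \<C> s'"
    using is_isoE[OF s(2,1)] .
  note ks = comp_hom[OF s(1) h(4)] and s'p = comp_hom[OF h(3) s'(1)]
  have "tri3 Y g Z (s' \<cdot> p) (sh X) (k \<cdot> s)"
    by (rule tri3_transport[OF t h(2) s'p ks idn_hom[OF h(5)] idn_hom[OF h(6)] s'(1)
          idn_iso[OF h(5)] idn_iso[OF h(6)] s'(4)])
      (simp_all add: idn_left[OF h(2)] idn_right[OF h(2)] idn_right[OF s'p] sh_idn[OF h(5)]
        idn_left[OF h(4)] comp_assoc[OF s'(1) s(1) h(4)] s'(3) idn_right[OF h(4)])
  moreover obtain f0 where f0: "f0 \<in> Hom \<C> X Y" "k \<cdot> s = sha f0" using sh_full[OF X(1) h(5) ks] .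
  then have "k \<cdot> s = neg \<C> (sha (neg \<C> f0))"
    using sh_neg[OF f0(1)] neg_neg[OF sh_hom[OF f0(1)]] by simp
  ultimately have "tri3 X (neg \<C> f0) Y g Z (s' \<cdot> p)"
    using tri3_rotate[OF neg_hom[OF f0(1)] h(2) s'p] by simp
  then show ?thesis using that s s' by blast
qed

lemma tri3_fiber: assumes "g \<in> Hom \<C> Y Z" obtains X f h where "tri3 X f Y g Z h"
proof -
  obtain p W k where "tri3 Y g Z p W k" using tri3_cone[OF assms] .
  then show ?thesis using tri3_unrotate that by metis
qed

lemma tri3_third:
  assumes "X \<in> Obj \<C>" "h \<in> Hom \<C> Z (sh X)" obtains f Y g where "tri3 X f Y g Z h"
proof -
  obtain Y g e where t: "tri3 Y g Z h (sh X) e" using tri3_fiber[OF assms(2)] .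
  note h = tri3D[OF t]
  obtain f0 where f0: "f0 \<in> Hom \<C> X Y" "e = sha f0" using sh_full[OF assms(1) h(5,4)] .
  then have "e = neg \<C> (sha (neg \<C> f0))" using sh_neg[OF f0(1)] neg_neg[OF sh_hom[OF f0(1)]] by simp
  then show ?thesis using that t tri3_rotate[OF neg_hom[OF f0(1)] h(2) assms(2)] by simp
qed

section \<open>The octahedral axiom in the forms required by the pair calculus\<close>

lemma tri3_octahedron:
  assumes t: "tri3 X f Y f' C f''" "tri3 Y g Z g' D g''" "tri3 X (g \<cdot> f) Z h' E h''"
  obtains u v where "tri3 C u E v D (sha f' \<cdot> g'')" "u \<cdot> f' = h' \<cdot> g" "h'' \<cdot> u = f''"
    "v \<cdot> h' = g'" "g'' \<cdot> v = sha f \<cdot> h''"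
proof -
  note a = tri3D[OF t(1)] and b = tri3D[OF t(2)] and c = tri3D[OF t(3)]
  have "Cod \<C> f = Dom \<C> g" using a(2) b(2) unfolding Hom_def by simp
  from TR4[OF this a(1) b(1) c(1)] obtain u v where
    uv: "(u, v, sha f' \<cdot> g'') \<in> Tri \<C>" "Dom \<C> u = Cod \<C> f'" "Cod \<C> u = Cod \<C> h'" "Cod \<C> v = Cod \<C> g'"
    "u \<cdot> f' = h' \<cdot> g" "h'' \<cdot> u = f''" "v \<cdot> h' = g'" "g'' \<cdot> v = sha f \<cdot> h''" by blast
  have "tri3 C u E v D (sha f' \<cdot> g'')"
    using Tri_tri3[OF uv(1)] uv(2-4) a(3) b(3) c(3) unfolding Hom_def by simp
  then show ?thesis using that uv by blast
qed

text \<open>The octahedron on g and w concerns their cones, which are the shifted fibres. Unshifting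
  the triangle it yields gives the statement for the fibres, with the one over w g
  prescribed.\<close>

lemma tri3_oct_comp:
  assumes t: "tri3 X f Y g Z h" "tri3 Z' z Z w W v" "tri3 Y' y Y (w \<cdot> g) W e"
  obtains f' g' where "tri3 X f' Y' g' Z' (h \<cdot> z)" "y \<cdot> f' = f" "z \<cdot> g' = g \<cdot> y" "sha g' \<cdot> e = v"
proof -
  note a = tri3D[OF t(1)] and b = tri3D[OF t(2)] and c = tri3D[OF t(3)]
  obtain u v' where u: "tri3 (sh X) u (sh Y') v' (sh Z') (sha h \<cdot> neg \<C> (sha z))"
    "neg \<C> (sha y) \<cdot> u = neg \<C> (sha f)" "v' \<cdot> e = v" "neg \<C> (sha z) \<cdot> v' = sha g \<cdot> neg \<C> (sha y)"
    using tri3_octahedron[OF tri3_rot[OF t(1)] tri3_rot[OF t(2)] tri3_rot[OF t(3)]] by blast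
  obtain f' where f': "f' \<in> Hom \<C> X Y'" "u = sha f'" using sh_full[OF a(5) c(5) tri3D(2)[OF u(1)]] .
  obtain g' where g': "g' \<in> Hom \<C> Y' Z'" "v' = sha g'" using sh_full[OF c(5) b(5) tri3D(3)[OF u(1)]] .
  have hz: "h \<cdot> z \<in> Hom \<C> Z' (sh X)" by (rule comp_hom[OF b(2) a(4)])
  have "sha h \<cdot> neg \<C> (sha z) = neg \<C> (sha (h \<cdot> z))"
    using comp_neg[OF sh_hom[OF b(2)] sh_hom[OF a(4)]] sh_comp[OF b(2) a(4)] by simp
  then have "tri3 X f' Y' g' Z' (h \<cdot> z)" using u(1) tri3_shift[OF f'(1) g'(1) hz] f'(2) g'(2) by simp
  moreover have "neg \<C> (sha (y \<cdot> f')) = neg \<C> (sha f)"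
    using u(2) f'(2) neg_comp[OF sh_hom[OF f'(1)] sh_hom[OF c(2)]] sh_comp[OF f'(1) c(2)] by simp
  then have "y \<cdot> f' = f"
    using sh_inj[OF comp_hom[OF f'(1) c(2)] a(2)]
      neg_inject[OF sh_hom[OF comp_hom[OF f'(1) c(2)]] sh_hom[OF a(2)]] by simp
  moreover have "neg \<C> (sha (z \<cdot> g')) = neg \<C> (sha (g \<cdot> y))"
    using u(4) g'(2) neg_comp[OF sh_hom[OF g'(1)] sh_hom[OF b(2)]] sh_comp[OF g'(1) b(2)]
      comp_neg[OF sh_hom[OF c(2)] sh_hom[OF a(3)]] sh_comp[OF c(2) a(3)] by simp
  then have "z \<cdot> g' = g \<cdot> y"
    using sh_inj[OF comp_hom[OF g'(1) b(2)] comp_hom[OF c(2) a(3)]]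
      neg_inject[OF sh_hom[OF comp_hom[OF g'(1) b(2)]] sh_hom[OF comp_hom[OF c(2) a(3)]]] by simp
  ultimately show ?thesis using that u(3) g'(2) by blast
qed

text \<open>The pull-back is defined by its connecting morphism h z. It is the fibre of this
  composite, so the previous lemma applies with Y -> Z -> X[1] as second triangle.\<close>

lemma tri3_oct_pull:
  assumes t: "tri3 X f Y g Z h" "tri3 K k Z' z Z l"
  obtains P f' g' k' y where "tri3 X f' P g' Z' (h \<cdot> z)" "tri3 K k' P y Y (l \<cdot> g)"
    "y \<cdot> f' = f" "g' \<cdot> k' = k" "g \<cdot> y = z \<cdot> g'"
proof -
  note a = tri3D[OF t(1)] and b = tri3D[OF t(2)]
  obtain f' P g' where P: "tri3 X f' P g' Z' (h \<cdot> z)"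
    using tri3_third[OF a(5) comp_hom[OF b(3) a(4)]] .
  note p = tri3D[OF P]
  obtain k' y where y: "tri3 K k' P y Y (l \<cdot> g)" "g' \<cdot> k' = k" "g \<cdot> y = z \<cdot> g'"
    "sha y \<cdot> neg \<C> (sha f') = neg \<C> (sha f)"
    using tri3_oct_comp[OF t(2) tri3_rot[OF t(1)] tri3_rot[OF P]] by blast
  note y' = tri3D(3)[OF y(1)]
  have "neg \<C> (sha (y \<cdot> f')) = neg \<C> (sha f)"
    using y(4) comp_neg[OF sh_hom[OF p(2)] sh_hom[OF y']] sh_comp[OF p(2) y'] by simp
  then have "y \<cdot> f' = f"
    using sh_inj[OF comp_hom[OF p(2) y'] a(2)]
      neg_inject[OF sh_hom[OF comp_hom[OF p(2) y']] sh_hom[OF a(2)]] by simp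
  then show ?thesis using that P y by blast
qed

text \<open>The push-out is defined by its connecting morphism, the composite of h with the shift of
  x; the octahedron on this composite gives the rest up to shift and signs.\<close>

lemma tri3_oct_push:
  assumes t: "tri3 X f Y g Z h" "tri3 X x X' c K k"
  obtains P f' g' y c' where "tri3 X' f' P g' Z (sha x \<cdot> h)" "tri3 Y y P c' K (sha f \<cdot> k)"
    "g' \<cdot> y = g" "c' \<cdot> f' = c" "y \<cdot> f = f' \<cdot> x"
proof -
  note a = tri3D[OF t(1)] and b = tri3D[OF t(2)]
  note xh = comp_hom[OF a(4) sh_hom[OF b(2)]]
  obtain f' P g' where P: "tri3 X' f' P g' Z (sha x \<cdot> h)" using tri3_third[OF b(6) xh] .
  note p = tri3D[OF P]
  have sx: "tri3 (sh X) (sha x) (sh X') (sha c) (sh K) (neg \<C> (sha k))"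
    using tri3_shift[OF b(2,3,4)] t(2) by blast
  obtain u v where u: "tri3 (sh Y) u (sh P) v (sh K) (sha (neg \<C> (sha f)) \<cdot> neg \<C> (sha k))"
    "u \<cdot> neg \<C> (sha f) = neg \<C> (sha f') \<cdot> sha x" "neg \<C> (sha g') \<cdot> u = neg \<C> (sha g)"
    "v \<cdot> neg \<C> (sha f') = sha c"
    using tri3_octahedron[OF tri3_rot[OF tri3_rot[OF t(1)]] sx tri3_rot[OF tri3_rot[OF P]]] by blast
  obtain y where y: "y \<in> Hom \<C> Y P" "u = sha y" using sh_full[OF a(6) p(6) tri3D(2)[OF u(1)]] .
  obtain v0 where v0: "v0 \<in> Hom \<C> P K" "v = sha v0" using sh_full[OF p(6) b(7) tri3D(3)[OF u(1)]] .
  \<comment> \<open>The twice rotated triangle contains -f', so the octahedron delivers the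
    projection P -> K with the wrong sign.\<close>
  define c' where "c' = neg \<C> v0"
  have c': "c' \<in> Hom \<C> P K" "v = neg \<C> (sha c')"
    unfolding c'_def using neg_hom[OF v0(1)] v0 sh_neg[OF v0(1)] neg_neg[OF sh_hom[OF v0(1)]] by auto
  note fk = comp_hom[OF b(4) sh_hom[OF a(2)]]
  have "sha (neg \<C> (sha f)) \<cdot> neg \<C> (sha k) = sha (sha f \<cdot> k)"
    using sh_neg[OF sh_hom[OF a(2)]] sh_comp[OF b(4) sh_hom[OF a(2)]]
      neg_comp[OF neg_hom[OF sh_hom[OF b(4)]] sh_hom[OF sh_hom[OF a(2)]]]
      comp_neg[OF sh_hom[OF b(4)] sh_hom[OF sh_hom[OF a(2)]]]
      neg_neg[OF comp_hom[OF sh_hom[OF b(4)] sh_hom[OF sh_hom[OF a(2)]]]] by simp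
  then have "tri3 (sh Y) (sha y) (sh P) (neg \<C> (sha c')) (sh K) (sha (sha f \<cdot> k))"
    using u(1) y(2) c'(2) by simp
  then have "tri3 (sh Y) (sha y) (sh P) (sha c') (sh K) (neg \<C> (sha (sha f \<cdot> k)))"
    using tri3_signs(2) neg_neg[OF sh_hom[OF c'(1)]] by metis
  then have "tri3 Y y P c' K (sha f \<cdot> k)" using tri3_shift[OF y(1) c'(1) fk] by blast
  moreover have "neg \<C> (sha (g' \<cdot> y)) = neg \<C> (sha g)"
    using u(3) y(2) neg_comp[OF sh_hom[OF y(1)] sh_hom[OF p(3)]] sh_comp[OF y(1) p(3)] by simp
  then have "g' \<cdot> y = g"
    using sh_inj[OF comp_hom[OF y(1) p(3)] a(3)]
      neg_inject[OF sh_hom[OF comp_hom[OF y(1) p(3)]] sh_hom[OF a(3)]] by simp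
  moreover have "sha (c' \<cdot> f') = sha c"
    using u(4) c'(2) comp_neg[OF sh_hom[OF p(2)] neg_hom[OF sh_hom[OF c'(1)]]]
      neg_comp[OF sh_hom[OF p(2)] sh_hom[OF c'(1)]] neg_neg[OF comp_hom[OF sh_hom[OF p(2)] sh_hom[OF c'(1)]]]
      sh_comp[OF p(2) c'(1)] by simp
  then have "c' \<cdot> f' = c" by (rule sh_inj[OF comp_hom[OF p(2) c'(1)] b(3)])
  moreover have "neg \<C> (sha (y \<cdot> f)) = neg \<C> (sha (f' \<cdot> x))"
    using u(2) y(2) comp_neg[OF sh_hom[OF a(2)] sh_hom[OF y(1)]] sh_comp[OF a(2) y(1)]
      neg_comp[OF sh_hom[OF b(2)] sh_hom[OF p(2)]] sh_comp[OF b(2) p(2)] by simp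
  then have "y \<cdot> f = f' \<cdot> x"
    using sh_inj[OF comp_hom[OF a(2) y(1)] comp_hom[OF b(2) p(2)]]
      neg_inject[OF sh_hom[OF comp_hom[OF a(2) y(1)]] sh_hom[OF comp_hom[OF b(2) p(2)]]] by simp
  ultimately show ?thesis using that P by blast
qed

text \<open>Complete i to a triangle. Its third morphism is zero because i has a left inverse, and
  this makes g j inverse to the comparison q' from the cone to Y.\<close>

lemma biproduct_tri3:
  assumes h: "i \<in> Hom \<C> X B" "j \<in> Hom \<C> Y B" "p \<in> Hom \<C> B X" "q \<in> Hom \<C> B Y"
    and e: "p \<cdot> i = Idn \<C> X" "q \<cdot> j = Idn \<C> Y" "q \<cdot> i = Zer \<C> X Y" "Plus \<C> (i \<cdot> p) (j \<cdot> q) = Idn \<C> B"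
  obtains k where "tri3 X i B q Y k"
proof -
  obtain g Z k where t: "tri3 X i B g Z k" using tri3_cone[OF h(1)] .
  note a = tri3D[OF t]
  obtain q' where q': "q' \<in> Hom \<C> Z Y" "q = q' \<cdot> g" using tri3_extend[OF t h(4) e(3)] .
  have o: "X \<in> Obj \<C>" "Y \<in> Obj \<C>" using hom_obj h by blast+
  note gj = comp_hom[OF h(2) a(3)]
  have "k = (sha p \<cdot> sha i) \<cdot> k" using sh_comp[OF h(1,3)] e(1) sh_idn[OF o(1)] idn_left[OF a(4)] by simp
  also have "\<dots> = sha p \<cdot> (sha i \<cdot> k)" by (rule comp_assoc[OF a(4) sh_hom[OF h(1)] sh_hom[OF h(3)]])
  also have "sha i \<cdot> k = Zer \<C> Z (sh B)" by (rule tri3_comp_shift[OF t])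
  also have "sha p \<cdot> Zer \<C> Z (sh B) = Zer \<C> Z (sh X)" by (rule comp_zer[OF sh_hom[OF h(3)] a(7)])
  finally have k: "k = Zer \<C> Z (sh X)" .
  have 1: "q' \<cdot> (g \<cdot> j) = Idn \<C> Y" using comp_assoc[OF h(2) a(3) q'(1)] q'(2) e(2) by simp
  note gjq = comp_hom[OF q'(1) gj] and Z = idn_hom[OF a(7)]
  have "((g \<cdot> j) \<cdot> q') \<cdot> g = g \<cdot> (j \<cdot> q)"
    using comp_assoc[OF a(3) q'(1) gj] q'(2) comp_assoc[OF h(4) h(2) a(3)] by simp
  moreover have "g \<cdot> Plus \<C> (i \<cdot> p) (j \<cdot> q) = g \<cdot> (j \<cdot> q)"
    using comp_plus_right[OF comp_hom[OF h(3,1)] comp_hom[OF h(4,2)] a(3)] comp_assoc[OF h(3,1) a(3)]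
      tri3_comp(1)[OF t] zer_comp[OF h(3) a(7)] zer_plus[OF comp_hom[OF comp_hom[OF h(4,2)] a(3)]] by simp
  ultimately have "((g \<cdot> j) \<cdot> q') \<cdot> g = g" using e(4) idn_right[OF a(3)] by simp
  then have "arr_minus \<C> ((g \<cdot> j) \<cdot> q') (Idn \<C> Z) \<cdot> g = Zer \<C> B Z"
    using minus_comp[OF a(3) gjq Z] idn_left[OF a(3)] minus_self[OF a(3)] by simp
  then obtain m where m: "m \<in> Hom \<C> (sh X) Z" "arr_minus \<C> ((g \<cdot> j) \<cdot> q') (Idn \<C> Z) = m \<cdot> k"
    using tri3_extend[OF tri3_rot[OF t] minus_hom[OF gjq Z]] by blast
  then have "(g \<cdot> j) \<cdot> q' = Idn \<C> Z"
    using minus_zerD[OF gjq Z] k comp_zer[OF m(1) a(7)] by simp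
  then have iso: "is_iso \<C> q'" using is_isoI[OF q'(1) gj _ 1] by blast
  note kgj = comp_hom[OF gj a(4)]
  have "tri3 X i B q Y (k \<cdot> (g \<cdot> j))"
    by (rule tri3_transport[OF t h(1,4) kgj idn_hom[OF a(5)] idn_hom[OF a(6)] q'(1)
          idn_iso[OF a(5)] idn_iso[OF a(6)] iso])
      (use \<open>(g \<cdot> j) \<cdot> q' = Idn \<C> Z\<close> in \<open>simp_all add: idn_left[OF h(1)] idn_right[OF h(1)] idn_right[OF h(4)] q'(2)[symmetric]
        sh_idn[OF a(5)] idn_left[OF a(4)] idn_right[OF a(4)] comp_assoc[OF q'(1) gj a(4)]\<close>)
  then show ?thesis by (rule that)
qed

definition tri :: "'o \<Rightarrow> 'm \<Rightarrow> 'o \<Rightarrow> 'm \<Rightarrow> 'o \<Rightarrow> bool" where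
  "tri X f Y g Z \<longleftrightarrow> (\<exists>h. tri3 X f Y g Z h)"

lemma tri3_tri: "tri3 X f Y g Z h \<Longrightarrow> tri X f Y g Z"
  unfolding tri_def by blast

lemma pair_category_tri:
  assumes "ideal_category \<C> \<J>" shows "pair_category \<C> \<J> tri"
proof (intro pair_category.intro pair_category_axioms.intro assms)
  show "f \<in> Hom \<C> X Y \<and> g \<in> Hom \<C> Y Z" if "tri X f Y g Z" for X f Y g Z
    using that tri3D unfolding tri_def by blast
  show "\<exists>g Z. tri X f Y g Z" if "f \<in> Hom \<C> X Y" for X f Y
    using tri3_cone[OF that] tri3_tri by metis
  show "\<exists>X f. tri X f Y g Z" if "g \<in> Hom \<C> Y Z" for Y g Z
    using tri3_fiber[OF that] tri3_tri by metis
  show "g \<cdot> f = Zer \<C> X Z" if "tri X f Y g Z" for X f Y g Z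
    using that tri3_comp unfolding tri_def by blast
  show "\<exists>x' \<in> Hom \<C> W X. x = f \<cdot> x'" if "tri X f Y g Z" "x \<in> Hom \<C> W Y" "g \<cdot> x = Zer \<C> W Z" for X f Y g Z x W
    using that tri3_lift unfolding tri_def by metis
  show "\<exists>x' \<in> Hom \<C> Z W. x = x' \<cdot> g" if "tri X f Y g Z" "x \<in> Hom \<C> Y W" "x \<cdot> f = Zer \<C> X W" for X f Y g Z x W
    using that tri3_extend unfolding tri_def by metis
  show "\<exists>r \<in> Hom \<C> Y X. r \<cdot> f = Idn \<C> X" if t: "tri X f Y g Z" and s: "s \<in> Hom \<C> Z Y" "g \<cdot> s = Idn \<C> Z" for X f Y g Z s
  proof -
    obtain h where t: "tri3 X f Y g Z h" using t unfolding tri_def by blast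
    note a = tri3D[OF t]
    \<comment> \<open>The section gives h = h g s = 0, and the vanishing of h lets the identity of X
      extend along f.\<close>
    have "sha (Idn \<C> X) \<cdot> h = (h \<cdot> g) \<cdot> s"
      using sh_idn[OF a(5)] idn_left[OF a(4)] comp_assoc[OF s(1) a(3,4)] s(2) idn_right[OF a(4)] by simp
    also have "\<dots> = Zer \<C> Z (sh X)" using tri3_comp(2)[OF t] zer_comp[OF s(1) sh_obj_closed[OF a(5)]] by simp
    finally obtain r where "r \<in> Hom \<C> Y X" "Idn \<C> X = r \<cdot> f"
      using tri3_extend_shift[OF t idn_hom[OF a(5)]] by blast
    then show ?thesis by auto
  qed
  show "\<exists>s \<in> Hom \<C> Z Y. g \<cdot> s = Idn \<C> Z" if t: "tri X f Y g Z" and r: "r \<in> Hom \<C> Y X" "r \<cdot> f = Idn \<C> X" for X f Y g Z r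
  proof -
    obtain h where t: "tri3 X f Y g Z h" using t unfolding tri_def by blast
    note a = tri3D[OF t]
    have "h \<cdot> Idn \<C> Z = (sha r \<cdot> sha f) \<cdot> h"
      using idn_right[OF a(4)] sh_comp[OF a(2) r(1)] r(2) sh_idn[OF a(5)] idn_left[OF a(4)] by simp
    also have "\<dots> = Zer \<C> Z (sh X)"
      using comp_assoc[OF a(4) sh_hom[OF a(2)] sh_hom[OF r(1)]] tri3_comp_shift[OF t] comp_zer[OF sh_hom[OF r(1)] a(7)] by simp
    finally obtain s where "s \<in> Hom \<C> Z Y" "Idn \<C> Z = g \<cdot> s"
      using tri3_lift[OF tri3_rot[OF t] idn_hom[OF a(7)]] by blast
    then show ?thesis by auto
  qed
  show "\<exists>B i j p q. tri X i B q Y \<and> tri Y j B p X \<and> p \<cdot> i = Idn \<C> X \<and> q \<cdot> j = Idn \<C> Y \<and>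
        Plus \<C> (i \<cdot> p) (j \<cdot> q) = Idn \<C> B" if XY: "X \<in> Obj \<C>" "Y \<in> Obj \<C>" for X Y
  proof -
    obtain B i j p q where h: "i \<in> Hom \<C> X B" "j \<in> Hom \<C> Y B" "p \<in> Hom \<C> B X" "q \<in> Hom \<C> B Y"
      and e: "p \<cdot> i = Idn \<C> X" "q \<cdot> j = Idn \<C> Y" "p \<cdot> j = Zer \<C> Y X" "q \<cdot> i = Zer \<C> X Y"
        "Plus \<C> (i \<cdot> p) (j \<cdot> q) = Idn \<C> B"
      using ex_biproduct[OF XY] unfolding is_biproduct_def by blast
    have "Plus \<C> (j \<cdot> q) (i \<cdot> p) = Idn \<C> B"
      using plus_commute[OF comp_hom[OF h(4,2)] comp_hom[OF h(3,1)]] e(5) by simp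
    then obtain k k' where "tri3 X i B q Y k" "tri3 Y j B p X k'"
      using biproduct_tri3[OF h e(1,2,4,5)] biproduct_tri3[OF h(2,1,4,3) e(2,1,3)] by metis
    then show ?thesis using e tri3_tri by blast
  qed
  show "tri X (Idn \<C> X) X (Zer \<C> X N) N \<and> tri N (Zer \<C> N X) X (Idn \<C> X) X" if "X \<in> Obj \<C>" "is_zero \<C> N" for X N
    using tri3_idn[OF that] tri3_tri by blast
  show "\<exists>Y' y f' g'. tri Y' y Y (w \<cdot> g) W \<and> tri X f' Y' g' Z' \<and> y \<cdot> f' = f \<and>
      (\<forall>A a b. a \<in> Hom \<C> A Z' \<longrightarrow> b \<in> Hom \<C> A Y \<longrightarrow> g \<cdot> b = z \<cdot> a \<longrightarrow> (\<exists>c \<in> Hom \<C> A Y'. g' \<cdot> c = a))"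
    if tri: "tri X f Y g Z" "tri Z' z Z w W" for X f Y g Z Z' z w W
  proof -
    obtain h v where t: "tri3 X f Y g Z h" "tri3 Z' z Z w W v" using tri unfolding tri_def by blast
    note a = tri3D[OF t(1)] and b = tri3D[OF t(2)]
    obtain Y' y e where Y': "tri3 Y' y Y (w \<cdot> g) W e" using tri3_fiber[OF comp_hom[OF a(3) b(3)]] .
    obtain f' g' where f': "tri3 X f' Y' g' Z' (h \<cdot> z)" "y \<cdot> f' = f"
      using tri3_oct_comp[OF t Y'] by metis
    \<comment> \<open>The connecting morphism h z kills x, since h z x = h g y0 = 0.\<close>
    have "\<exists>c \<in> Hom \<C> A Y'. g' \<cdot> c = x" if x: "x \<in> Hom \<C> A Z'" "y0 \<in> Hom \<C> A Y" "g \<cdot> y0 = z \<cdot> x" for A x y0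
    proof -
      have "(h \<cdot> z) \<cdot> x = (h \<cdot> g) \<cdot> y0"
        using comp_assoc[OF x(1) b(2) a(4)] comp_assoc[OF x(2) a(3,4)] x(3) by simp
      also have "\<dots> = Zer \<C> A (sh X)"
        using tri3_comp(2)[OF t(1)] zer_comp[OF x(2) sh_obj_closed[OF a(5)]] by simp
      finally obtain c where "c \<in> Hom \<C> A Y'" "x = g' \<cdot> c" using tri3_lift[OF tri3_rot[OF f'(1)] x(1)] by blast
      then show ?thesis by auto
    qed
    then show ?thesis using tri3_tri[OF Y'] tri3_tri[OF f'(1)] f'(2) by blast
  qed
  show "\<exists>Y' y f' g'. tri W (f \<cdot> w) Y y Y' \<and> tri X' f' Y' g' Z \<and> g' \<cdot> y = g \<and>
      (\<forall>A a b. a \<in> Hom \<C> X' A \<longrightarrow> b \<in> Hom \<C> Y A \<longrightarrow> b \<cdot> f = a \<cdot> x \<longrightarrow> (\<exists>c \<in> Hom \<C> Y' A. c \<cdot> f' = a))"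
    if tri: "tri X f Y g Z" "tri W w X x X'" for X f Y g Z W w x X'
  proof -
    obtain h k where t: "tri3 X f Y g Z h" "tri3 W w X x X' k" using tri unfolding tri_def by blast
    note a = tri3D[OF t(1)] and b = tri3D[OF t(2)]
    obtain y Y' e where Y': "tri3 W (f \<cdot> w) Y y Y' e" using tri3_cone[OF comp_hom[OF b(2) a(2)]] .
    obtain f' g' where f': "tri3 X' f' Y' g' Z (sha x \<cdot> h)" "g' \<cdot> y = g"
      using tri3_octahedron[OF t(2,1) Y'] by metis
    have "\<exists>c \<in> Hom \<C> Y' A. c \<cdot> f' = u" if u: "u \<in> Hom \<C> X' A" "v \<in> Hom \<C> Y A" "v \<cdot> f = u \<cdot> x" for A u v
    proof -
      have "sha u \<cdot> (sha x \<cdot> h) = sha (u \<cdot> x) \<cdot> h"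
        using comp_assoc[OF a(4) sh_hom[OF b(3)] sh_hom[OF u(1)]] sh_comp[OF b(3) u(1)] by simp
      also have "\<dots> = sha v \<cdot> (sha f \<cdot> h)"
        using comp_assoc[OF a(4) sh_hom[OF a(2)] sh_hom[OF u(2)]] sh_comp[OF a(2) u(2)] u(3) by simp
      also have "\<dots> = Zer \<C> Z (sh A)" using tri3_comp_shift[OF t(1)] comp_zer[OF sh_hom[OF u(2)] a(7)] by simp
      finally obtain c where "c \<in> Hom \<C> Y' A" "u = c \<cdot> f'" using tri3_extend_shift[OF f'(1) u(1)] by blast
      then show ?thesis by auto
    qed
    then show ?thesis using tri3_tri[OF Y'] tri3_tri[OF f'(1)] f'(2) by blast
  qed
  show "\<exists>P f' g' k' y. tri X f' P g' Z' \<and> tri K k' P y Y \<and> y \<cdot> f' = f \<and> g' \<cdot> k' = k \<and> g \<cdot> y = z \<cdot> g'"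
    if tri: "tri X f Y g Z" "tri K k Z' z Z" for X f Y g Z K k z Z'
  proof -
    obtain h l where t: "tri3 X f Y g Z h" "tri3 K k Z' z Z l" using tri unfolding tri_def by blast
    show ?thesis using tri3_oct_pull[OF t] tri3_tri by metis
  qed
  show "\<exists>P f' g' y c'. tri X' f' P g' Z \<and> tri Y y P c' K \<and> g' \<cdot> y = g \<and> c' \<cdot> f' = c \<and> y \<cdot> f = f' \<cdot> x"
    if tri: "tri X f Y g Z" "tri X x X' c K" for X f Y g Z K c x X'
  proof -
    obtain h l where t: "tri3 X f Y g Z h" "tri3 X x X' c K l" using tri unfolding tri_def by blast
    show ?thesis using tri3_oct_push[OF t] tri3_tri by metis
  qed
qed

text \<open>Rotating the first triangle backwards makes c the second morphism, so that
  \<open>tri3_oct_comp\<close> applies with the given fibre A of q c. The resulting triangle is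
  rotated forward, and its third vertex is replaced by the isomorphic X.\<close>

lemma tri_oct_meet:
  assumes "tri C c D p X" "tri B b D q Z" "tri A a C (q \<cdot> c) Z"
  shows "\<exists>a' p'. tri A a' B p' X"
proof -
  obtain k l e where t: "tri3 C c D p X k" "tri3 B b D q Z l" "tri3 A a C (q \<cdot> c) Z e"
    using assms unfolding tri_def by blast
  obtain Y f s s' where Y: "tri3 Y f C c D (s' \<cdot> p)" "s \<in> Hom \<C> (sh Y) X" "s' \<in> Hom \<C> X (sh Y)"
    "s \<cdot> s' = Idn \<C> X" "is_iso \<C> s" using tri3_unrotate[OF t(1)] .
  obtain f' g' where "tri3 Y f' A g' B ((s' \<cdot> p) \<cdot> b)" using tri3_oct_comp[OF Y(1) t(2,3)] by metis
  then have r: "tri3 A g' B ((s' \<cdot> p) \<cdot> b) (sh Y) (neg \<C> (sha f'))" by (rule tri3_rot)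
  note h = tri3D[OF r]
  obtain s'' where s'': "s'' \<in> Hom \<C> X (sh Y)" "s'' \<cdot> s = Idn \<C> (sh Y)" using is_isoE[OF Y(5,2)] by blast
  note sh' = comp_hom[OF h(3) Y(2)] comp_hom[OF s''(1) h(4)]
  have "tri3 A g' B (s \<cdot> ((s' \<cdot> p) \<cdot> b)) X (neg \<C> (sha f') \<cdot> s'')"
    by (rule tri3_transport[OF r h(2) sh' idn_hom[OF h(5)] idn_hom[OF h(6)] Y(2)
          idn_iso[OF h(5)] idn_iso[OF h(6)] Y(5)])
      (simp_all add: idn_left[OF h(2)] idn_right[OF h(2)] idn_right[OF sh'(1)] sh_idn[OF h(5)]
        idn_left[OF h(4)] comp_assoc[OF Y(2) s''(1) h(4)] s''(2) idn_right[OF h(4)])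
  then show ?thesis using tri3_tri by blast
qed

end

section \<open>The ideal quotient\<close>

context ideal_category
begin

abbreviation cls :: "'m \<Rightarrow> 'm set" where "cls \<equiv> ideal_class \<C> \<J>"

lemma cls_eq: assumes "f \<in> Hom \<C> X Y" shows "cls f = {g. eqv X Y g f}"
proof -
  have d: "Dom \<C> f = X" "Cod \<C> f = Y" using assms unfolding Hom_def by auto
  have "g \<in> Hom \<C> X Y \<and> (\<exists>J \<in> \<J>. \<exists>a \<in> Hom \<C> X J. \<exists>b \<in> Hom \<C> J Y. g = Plus \<C> f (b \<cdot> a)) \<longleftrightarrow> eqv X Y g f" for g
    using eqvD[of X Y g f] eqvI[OF assms, of _ g] eqv_hom(1)[of X Y g f] unfolding null_def by blast
  then show ?thesis unfolding ideal_class_def d by auto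
qed

lemma cls_eqv: assumes "f \<in> Hom \<C> X Y" "g \<in> Hom \<C> X Y" shows "cls f = cls g \<longleftrightarrow> eqv X Y f g"
proof
  assume "cls f = cls g"
  then show "eqv X Y f g" using eqv_refl[OF assms(1)] unfolding cls_eq[OF assms(1)] cls_eq[OF assms(2)] by blast
next
  assume "eqv X Y f g"
  then show "cls f = cls g"
    unfolding cls_eq[OF assms(1)] cls_eq[OF assms(2)] using eqv_trans eqv_sym by blast
qed

lemma rep_eqv: assumes "f \<in> Hom \<C> X Y" shows "eqv X Y (rep (cls f)) f"
proof -
  have "f \<in> cls f" using eqv_refl[OF assms] cls_eq[OF assms] by blast
  then have "rep (cls f) \<in> cls f" unfolding rep_def by (rule someI)
  then show ?thesis using cls_eq[OF assms] by blast
qed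

lemma rep_hom: "f \<in> Hom \<C> X Y \<Longrightarrow> rep (cls f) \<in> Hom \<C> X Y"
  using rep_eqv eqv_hom(1) by blast

lemma cls_dom_cod:
  assumes "f \<in> Hom \<C> X Y"
  shows "Dom (ideal_quotient \<C> \<J> \<X>) (cls f) = X" "Cod (ideal_quotient \<C> \<J> \<X>) (cls f) = Y"
  using rep_hom[OF assms] unfolding ideal_quotient_def Hom_def by auto

lemma cls_comp:
  assumes f: "f \<in> Hom \<C> X Y" "g \<in> Hom \<C> Y Z"
  shows "cls g \<cdot>\<^bsub>ideal_quotient \<C> \<J> \<X>\<^esub> cls f = cls (g \<cdot> f)"
  using cls_eqv[OF comp_hom[OF rep_hom rep_hom, OF f] comp_hom[OF f]] eqv_comp[OF rep_eqv rep_eqv, OF f]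
  by (simp add: ideal_quotient_def)

lemma cls_plus:
  assumes f: "f \<in> Hom \<C> X Y" "g \<in> Hom \<C> X Y"
  shows "Plus (ideal_quotient \<C> \<J> \<X>) (cls f) (cls g) = cls (Plus \<C> f g)"
  using cls_eqv[OF plus_hom[OF rep_hom rep_hom, OF f] plus_hom[OF f]] eqv_plus[OF rep_eqv rep_eqv, OF f]
  by (simp add: ideal_quotient_def)

lemma quotient_simps:
  "Obj (ideal_quotient \<C> \<J> \<X>) = \<X>"
  "Idn (ideal_quotient \<C> \<J> \<X>) X = cls (Idn \<C> X)"
  "Zer (ideal_quotient \<C> \<J> \<X>) X Y = cls (Zer \<C> X Y)"
  by (simp_all add: ideal_quotient_def)

lemma quotient_hom:
  assumes "X \<in> \<X>" "Y \<in> \<X>"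
  shows "Hom (ideal_quotient \<C> \<J> \<X>) X Y = cls ` Hom \<C> X Y"
proof (intro equalityI subsetI)
  fix F assume F: "F \<in> Hom (ideal_quotient \<C> \<J> \<X>) X Y"
  then obtain f where f: "f \<in> Arr \<C>" "F = cls f" unfolding Hom_def ideal_quotient_def by auto
  then have h: "f \<in> Hom \<C> (Dom \<C> f) (Cod \<C> f)" unfolding Hom_def by simp
  have "Dom \<C> f = X" "Cod \<C> f = Y"
    using F cls_dom_cod[OF h, of \<X>] f(2) unfolding Hom_def by auto
  then show "F \<in> cls ` Hom \<C> X Y" using h f(2) by auto
next
  fix F assume "F \<in> cls ` Hom \<C> X Y"
  then obtain f where f: "f \<in> Hom \<C> X Y" "F = cls f" by blast
  have "F \<in> Arr (ideal_quotient \<C> \<J> \<X>)" using f assms unfolding ideal_quotient_def Hom_def by auto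
  then show "F \<in> Hom (ideal_quotient \<C> \<J> \<X>) X Y" using cls_dom_cod[OF f(1), of \<X>] f(2) unfolding Hom_def by auto
qed

lemma quotient_hom_obj: "F \<in> Hom (ideal_quotient \<C> \<J> \<X>) X Y \<Longrightarrow> X \<in> \<X> \<and> Y \<in> \<X>"
proof -
  assume F: "F \<in> Hom (ideal_quotient \<C> \<J> \<X>) X Y"
  then obtain f where f: "f \<in> Arr \<C>" "F = cls f" "Dom \<C> f \<in> \<X>" "Cod \<C> f \<in> \<X>"
    unfolding Hom_def ideal_quotient_def by auto
  then have h: "f \<in> Hom \<C> (Dom \<C> f) (Cod \<C> f)" unfolding Hom_def by simp
  then show ?thesis using F cls_dom_cod[OF h, of \<X>] f unfolding Hom_def by auto
qed

lemma quotient_isomorphic: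
  assumes "X \<in> \<X>" "Y \<in> \<X>" "X \<in> Obj \<C>" "Y \<in> Obj \<C>"
  shows "isomorphic (ideal_quotient \<C> \<J> \<X>) X Y \<longleftrightarrow> isoJ X Y"
proof -
  have *: "(cls g \<cdot>\<^bsub>ideal_quotient \<C> \<J> \<X>\<^esub> cls f = cls (Idn \<C> A)) \<longleftrightarrow> eqv A A (g \<cdot> f) (Idn \<C> A)"
    if "f \<in> Hom \<C> A B" "g \<in> Hom \<C> B A" for f g A B
    using cls_comp[OF that] cls_eqv[OF comp_hom[OF that] idn_hom[OF hom_obj(1)[OF that(1)]]] by simp
  have "isomorphic (ideal_quotient \<C> \<J> \<X>) X Y \<longleftrightarrow>
    (\<exists>F \<in> Hom (ideal_quotient \<C> \<J> \<X>) X Y. \<exists>G \<in> Hom (ideal_quotient \<C> \<J> \<X>) Y X.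
      G \<cdot>\<^bsub>ideal_quotient \<C> \<J> \<X>\<^esub> F = Idn (ideal_quotient \<C> \<J> \<X>) X \<and>
      F \<cdot>\<^bsub>ideal_quotient \<C> \<J> \<X>\<^esub> G = Idn (ideal_quotient \<C> \<J> \<X>) Y)"
    unfolding isomorphic_def is_iso_def by (auto simp: Hom_def)
  also have "\<dots> \<longleftrightarrow> isoJ X Y"
    unfolding quotient_hom[OF assms(1,2)] quotient_hom[OF assms(2,1)] isoJ_def quotient_simps
    using * by auto
  finally show ?thesis .
qed

lemma quotient_iso_cls:
  assumes f: "f \<in> Hom \<C> X Y" "g \<in> Hom \<C> Y X" "eqv X X (g \<cdot> f) (Idn \<C> X)" "eqv Y Y (f \<cdot> g) (Idn \<C> Y)"
    and X: "X \<in> \<X>" "Y \<in> \<X>"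
  shows "is_iso (ideal_quotient \<C> \<J> \<X>) (cls f)"
proof -
  have "cls f \<in> Hom (ideal_quotient \<C> \<J> \<X>) X Y" "cls g \<in> Hom (ideal_quotient \<C> \<J> \<X>) Y X"
    using f(1,2) quotient_hom X by blast+
  then show ?thesis
    unfolding is_iso_def using f cls_comp[OF f(1,2), of \<X>] cls_comp[OF f(2,1), of \<X>]
      cls_eqv[OF comp_hom[OF f(1,2)] idn_hom[OF hom_obj(1)[OF f(1)]]]
      cls_eqv[OF comp_hom[OF f(2,1)] idn_hom[OF hom_obj(1)[OF f(2)]]]
      cls_dom_cod[OF f(1), of \<X>] by (auto simp: quotient_simps Hom_def)
qed

end

section \<open>Cotorsion pairs and distinguished pairs\<close>

context triangulated_category
begin

text \<open>\<open>ext0\<close> and the splitting lemmas do not refer to the ideal. Taking all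
  objects as ideal makes them available for arbitrary cotorsion pairs, before \<I> is fixed.\<close>

sublocale all: pair_category \<C> "Obj \<C>" tri
proof (rule pair_category_tri)
  show "ideal_category \<C> (Obj \<C>)"
    by (intro ideal_category.intro ideal_category_axioms.intro additive_category_axioms)
      (use ex_zero in \<open>auto simp: is_zero_def is_biproduct_def\<close>)
qed

text \<open>Every h : X -> Y[1] is the third morphism of some triangle, and that triangle splits
  exactly when h is zero.\<close>

lemma Ext1_ext0:
  assumes "X \<in> Obj \<C>" "Y \<in> Obj \<C>"
  shows "Ext1 \<C> X Y = {Zer \<C> X (sh Y)} \<longleftrightarrow> all.ext0 X Y"
proof
  assume E: "Ext1 \<C> X Y = {Zer \<C> X (sh Y)}"
  show "all.ext0 X Y"
    unfolding all.ext0_def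
  proof (intro allI impI)
    fix A f g assume "tri Y f A g X"
    then obtain h where t: "tri3 Y f A g X h" unfolding tri_def by blast
    note a = tri3D[OF t]
    have "h \<cdot> Idn \<C> X = Zer \<C> X (sh Y)" using E a(4) idn_right[OF a(4)] unfolding Ext1_def by auto
    then obtain s where "s \<in> Hom \<C> X A" "Idn \<C> X = g \<cdot> s"
      using tri3_lift[OF tri3_rot[OF t] idn_hom[OF assms(1)]] by blast
    then show "\<exists>s \<in> Hom \<C> X A. g \<cdot> s = Idn \<C> X" by auto
  qed
next
  assume E: "all.ext0 X Y"
  have "h = Zer \<C> X (sh Y)" if h: "h \<in> Hom \<C> X (sh Y)" for h
  proof -
    obtain f A g where t: "tri3 Y f A g X h" using tri3_third[OF assms(2) h] .
    note a = tri3D[OF t]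
    obtain s where s: "s \<in> Hom \<C> X A" "g \<cdot> s = Idn \<C> X" using all.ext0D[OF E tri3_tri[OF t]] by blast
    have "h = (h \<cdot> g) \<cdot> s" using comp_assoc[OF s(1) a(3) h] s(2) idn_right[OF h] by simp
    then show ?thesis using tri3_comp(2)[OF t] zer_comp[OF s(1) sh_obj_closed[OF assms(2)]] by simp
  qed
  then show "Ext1 \<C> X Y = {Zer \<C> X (sh Y)}"
    unfolding Ext1_def using zer_hom[OF assms(1) sh_obj_closed[OF assms(2)]] by blast
qed

lemma tri3_shifted_cone:
  assumes t: "tri3 A f X g (sh B) h" and B: "B \<in> Obj \<C>" shows "\<exists>k. tri B k A f X"
proof -
  note a = tri3D[OF t]
  obtain h0 where h0: "h0 \<in> Hom \<C> B A" "h = sha h0" using sh_full[OF B a(5,4)] .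
  have "neg \<C> (sha (neg \<C> h0)) = h" using sh_neg[OF h0(1)] neg_neg[OF sh_hom[OF h0(1)]] h0(2) by simp
  then have "tri3 B (neg \<C> h0) A f X g"
    using tri3_rotate[OF neg_hom[OF h0(1)] a(2,3)] t by simp
  then show ?thesis using tri3_tri by blast
qed

lemma star_shift:
  assumes "\<Y> \<subseteq> Obj \<C>"
  shows "X \<in> star \<C> \<X> (sh_subcat \<C> \<Y>) \<longleftrightarrow> (\<exists>B f A g. B \<in> \<Y> \<and> A \<in> \<X> \<and> tri B f A g X)"
proof
  assume "X \<in> star \<C> \<X> (sh_subcat \<C> \<Y>)"
  then obtain f g h B where t: "(f, g, h) \<in> Tri \<C>" "Dom \<C> f \<in> \<X>" "Cod \<C> f = X" "Cod \<C> g = sh B" "B \<in> \<Y>"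
    unfolding star_def sh_subcat_def by blast
  have t3: "tri3 (Dom \<C> f) f X g (sh B) h" using Tri_tri3[OF t(1)] t(3,4) by simp
  have "B \<in> Obj \<C>" using assms t(5) by blast
  then obtain k where "tri B k (Dom \<C> f) f X" using tri3_shifted_cone[OF t3] by blast
  then show "\<exists>B f A g. B \<in> \<Y> \<and> A \<in> \<X> \<and> tri B f A g X" using t by blast
next
  assume "\<exists>B f A g. B \<in> \<Y> \<and> A \<in> \<X> \<and> tri B f A g X"
  then obtain B f A g h where t: "B \<in> \<Y>" "A \<in> \<X>" "tri3 B f A g X h" unfolding tri_def by blast
  note a = tri3D[OF tri3_rot[OF t(3)]]
  have "Dom \<C> g = A" "Cod \<C> g = X" "Cod \<C> h = sh B" using a(2,3) unfolding Hom_def by auto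
  then show "X \<in> star \<C> \<X> (sh_subcat \<C> \<Y>)"
    unfolding star_def sh_subcat_def using a(1,6) t(1,2) by blast
qed

lemma star_tri: "X \<in> star \<C> \<X> \<Y> \<longleftrightarrow> (\<exists>A f g B. A \<in> \<X> \<and> B \<in> \<Y> \<and> tri A f X g B)"
proof
  assume "X \<in> star \<C> \<X> \<Y>"
  then obtain f g h where t: "(f, g, h) \<in> Tri \<C>" "Dom \<C> f \<in> \<X>" "Cod \<C> f = X" "Cod \<C> g \<in> \<Y>"
    unfolding star_def by blast
  then show "\<exists>A f g B. A \<in> \<X> \<and> B \<in> \<Y> \<and> tri A f X g B" using Tri_tri3[OF t(1)] tri3_tri by blast
next
  assume "\<exists>A f g B. A \<in> \<X> \<and> B \<in> \<Y> \<and> tri A f X g B"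
  then obtain A f g B h where t: "A \<in> \<X>" "B \<in> \<Y>" "tri3 A f X g B h" unfolding tri_def by blast
  note a = tri3D[OF t(3)]
  have "Dom \<C> f = A" "Cod \<C> f = X" "Cod \<C> g = B" using a(2,3) unfolding Hom_def by auto
  then show "X \<in> star \<C> \<X> \<Y>" unfolding star_def using a(1,6) t(1,2) by blast
qed

lemma cotorsion_cover:
  assumes "(\<X>, \<Y>) \<in> cotorsion_pairs \<C>" "X \<in> Obj \<C>"
  shows "\<exists>B f A g. B \<in> \<Y> \<and> A \<in> \<X> \<and> tri B f A g X"
proof -
  have "\<Y> \<subseteq> Obj \<C>" "Obj \<C> = star \<C> \<X> (sh_subcat \<C> \<Y>)"
    using assms(1) unfolding cotorsion_pairs_def additive_subcat_def by blast+
  then show ?thesis using star_shift[of \<Y> X \<X>] assms(2) by blast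
qed

lemma cotorsion_hull:
  assumes "(\<X>, \<Y>) \<in> cotorsion_pairs \<C>" and X: "X \<in> Obj \<C>"
  shows "\<exists>f A g B. A \<in> \<Y> \<and> B \<in> \<X> \<and> tri X f A g B"
proof -
  obtain B f A g h where t: "B \<in> \<Y>" "A \<in> \<X>" "tri3 B f A g (sh X) h"
    using cotorsion_cover[OF assms(1) sh_obj_closed[OF X]] unfolding tri_def by blast
  note a = tri3D[OF t(3)]
  obtain h0 where h0: "h0 \<in> Hom \<C> X B" "h = sha h0" using sh_full[OF X a(5,4)] .
  have "neg \<C> (sha (neg \<C> h0)) = h" using sh_neg[OF h0(1)] neg_neg[OF sh_hom[OF h0(1)]] h0(2) by simp
  then have "tri3 X (neg \<C> h0) B f A g" using tri3_rotate[OF neg_hom[OF h0(1)] a(2,3)] t(3) by simp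
  then show ?thesis using tri3_tri t by blast
qed

lemma cotorsion_obj: "(\<X>, \<Y>) \<in> cotorsion_pairs \<C> \<Longrightarrow> \<X> \<subseteq> Obj \<C> \<and> \<Y> \<subseteq> Obj \<C>"
  unfolding cotorsion_pairs_def additive_subcat_def by blast

lemma Ext1_vanishes_ext0:
  "\<lbrakk>\<X> \<subseteq> Obj \<C>; \<Y> \<subseteq> Obj \<C>\<rbrakk> \<Longrightarrow> Ext1_vanishes \<C> \<X> \<Y> \<longleftrightarrow> (\<forall>X \<in> \<X>. \<forall>Y \<in> \<Y>. all.ext0 X Y)"
  unfolding Ext1_vanishes_def using Ext1_ext0 by blast

lemma cotorsion_ext0:
  assumes "(\<X>, \<Y>) \<in> cotorsion_pairs \<C>" "X \<in> \<X>" "Y \<in> \<Y>" shows "all.ext0 X Y"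
proof -
  have "Ext1_vanishes \<C> \<X> \<Y>" using assms(1) unfolding cotorsion_pairs_def by blast
  then show ?thesis using Ext1_vanishes_ext0[of \<X> \<Y>] cotorsion_obj[OF assms(1)] assms(2,3) by blast
qed

lemma cotorsion_summand:
  assumes "(\<X>, \<Y>) \<in> cotorsion_pairs \<C>" "is_biproduct \<C> X Y B"
  shows "B \<in> \<X> \<Longrightarrow> Y \<in> \<X>" "B \<in> \<Y> \<Longrightarrow> X \<in> \<Y>"
  using assms unfolding cotorsion_pairs_def additive_subcat_def by blast+

lemma ext0_biproduct:
  assumes t: "tri Y f E g X" and "all.ext0 X Y" shows "is_biproduct \<C> Y X E"
proof -
  obtain s where s: "s \<in> Hom \<C> X E" "g \<cdot> s = Idn \<C> X" using all.ext0D[OF assms(2) t] by blast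
  obtain r where "r \<in> Hom \<C> E Y" "r \<cdot> f = Idn \<C> Y" "r \<cdot> s = Zer \<C> X Y" "Plus \<C> (f \<cdot> r) (s \<cdot> g) = Idn \<C> E"
    using all.tri_split[OF t s] by blast
  then show ?thesis
    unfolding is_biproduct_def using s all.tri_homs[OF t] all.tri_comp[OF t] by blast
qed

text \<open>If X is orthogonal to the right class, the kernel of its cover splits off, so X is a
  summand of the cover.\<close>

lemma cotorsion_left_iff:
  assumes P: "(\<X>, \<Y>) \<in> cotorsion_pairs \<C>"
  shows "X \<in> \<X> \<longleftrightarrow> X \<in> Obj \<C> \<and> (\<forall>Y \<in> \<Y>. all.ext0 X Y)"
proof
  assume X: "X \<in> Obj \<C> \<and> (\<forall>Y \<in> \<Y>. all.ext0 X Y)"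
  then obtain B f A g where "B \<in> \<Y>" "A \<in> \<X>" "tri B f A g X" using cotorsion_cover[OF P] by blast
  then show "X \<in> \<X>" using cotorsion_summand(1)[OF P ext0_biproduct] X by blast
qed (use cotorsion_obj[OF P] cotorsion_ext0[OF P] in blast)

lemma cotorsion_right_iff:
  assumes P: "(\<X>, \<Y>) \<in> cotorsion_pairs \<C>"
  shows "Y \<in> \<Y> \<longleftrightarrow> Y \<in> Obj \<C> \<and> (\<forall>X \<in> \<X>. all.ext0 X Y)"
proof
  assume Y: "Y \<in> Obj \<C> \<and> (\<forall>X \<in> \<X>. all.ext0 X Y)"
  then obtain f A g B where "A \<in> \<Y>" "B \<in> \<X>" "tri Y f A g B" using cotorsion_hull[OF P] by blast
  then show "Y \<in> \<Y>" using cotorsion_summand(2)[OF P ext0_biproduct] Y by blast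
qed (use cotorsion_obj[OF P] cotorsion_ext0[OF P] in blast)

lemma cotorsion_pairsI:
  assumes a: "additive_subcat \<C> \<X>" "additive_subcat \<C> \<Y>"
    and e: "\<And>X Y. X \<in> \<X> \<Longrightarrow> Y \<in> \<Y> \<Longrightarrow> all.ext0 X Y"
    and c: "\<And>X. X \<in> Obj \<C> \<Longrightarrow> \<exists>B f A g. B \<in> \<Y> \<and> A \<in> \<X> \<and> tri B f A g X"
  shows "(\<X>, \<Y>) \<in> cotorsion_pairs \<C>"
proof -
  have o: "\<X> \<subseteq> Obj \<C>" "\<Y> \<subseteq> Obj \<C>" using a unfolding additive_subcat_def by blast+
  have "Obj \<C> = star \<C> \<X> (sh_subcat \<C> \<Y>)"
    using c star_shift[OF o(2), of _ \<X>] unfolding star_def by blast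
  then show ?thesis
    unfolding cotorsion_pairs_def using a Ext1_vanishes_ext0[OF o] e by blast
qed

end

section \<open>The comparison transformation\<close>

context concentric_tcp
begin

lemma ideal_I: "ideal_category \<C> (\<S> \<inter> \<T>)"
proof (intro ideal_category.intro ideal_category_axioms.intro additive_category_axioms)
  have a: "additive_subcat \<C> \<S>" "additive_subcat \<C> \<T>"
    using ST_cotorsion unfolding cotorsion_pairs_def by blast+
  show "\<S> \<inter> \<T> \<subseteq> Obj \<C>" using a unfolding additive_subcat_def by blast
  show "B \<in> \<S> \<inter> \<T>" if "X \<in> \<S> \<inter> \<T>" "Y \<in> \<S> \<inter> \<T>" "is_biproduct \<C> X Y B" for X Y B
    using a that unfolding additive_subcat_def by blast
  obtain N M where N: "N \<in> \<S>" "is_zero \<C> N" and M: "M \<in> \<T>" "is_zero \<C> M"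
    using a unfolding additive_subcat_def by blast
  have o: "N \<in> Obj \<C>" "M \<in> Obj \<C>" using N M unfolding is_zero_def by blast+
  \<comment> \<open>The zero objects supplied by \<S> and \<T> may differ; being isomorphic, one of
    them lies in both classes.\<close>
  have "is_iso \<C> (Zer \<C> M N)"
    using is_isoI[OF zer_hom[OF o(2,1)] zer_hom[OF o]] comp_zer[OF zer_hom[OF o] o(2)]
      comp_zer[OF zer_hom[OF o(2,1)] o(1)] zero_obj_hom(1)[OF N(2) idn_hom[OF o(1)]]
      zero_obj_hom(1)[OF M(2) idn_hom[OF o(2)]] by simp
  then have "isomorphic \<C> M N" unfolding isomorphic_def using zer_hom[OF o(2,1)] by blast
  then have "N \<in> \<T>" using a(2) M(1) unfolding additive_subcat_def by blast
  then show "\<S> \<inter> \<T> \<noteq> {}" using N(1) by blast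
qed

lemma twin_tri: "twin \<C> (\<S> \<inter> \<T>) tri \<S> \<T> \<U> \<V>"
proof (intro twin.intro twin_axioms.intro pair_category_tri ideal_I)
  note ST = ST_cotorsion and UV = UV_cotorsion
  show "X \<in> \<S> \<longleftrightarrow> X \<in> Obj \<C> \<and> (\<forall>Y \<in> \<T>. all.ext0 X Y)" for X by (rule cotorsion_left_iff[OF ST])
  show "Y \<in> \<T> \<longleftrightarrow> Y \<in> Obj \<C> \<and> (\<forall>X \<in> \<S>. all.ext0 X Y)" for Y by (rule cotorsion_right_iff[OF ST])
  show "X \<in> \<U> \<longleftrightarrow> X \<in> Obj \<C> \<and> (\<forall>Y \<in> \<V>. all.ext0 X Y)" for X by (rule cotorsion_left_iff[OF UV])
  show "Y \<in> \<V> \<longleftrightarrow> Y \<in> Obj \<C> \<and> (\<forall>X \<in> \<U>. all.ext0 X Y)" for Y by (rule cotorsion_right_iff[OF UV])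
  show "\<exists>Y f A g. Y \<in> \<T> \<and> A \<in> \<S> \<and> tri Y f A g X" if "X \<in> Obj \<C>" for X by (rule cotorsion_cover[OF ST that])
  show "\<exists>f A g Y. A \<in> \<T> \<and> Y \<in> \<S> \<and> tri X f A g Y" if "X \<in> Obj \<C>" for X by (rule cotorsion_hull[OF ST that])
  show "\<exists>Y f A g. Y \<in> \<V> \<and> A \<in> \<U> \<and> tri Y f A g X" if "X \<in> Obj \<C>" for X by (rule cotorsion_cover[OF UV that])
  show "\<exists>f A g Y. A \<in> \<V> \<and> Y \<in> \<U> \<and> tri X f A g Y" if "X \<in> Obj \<C>" for X by (rule cotorsion_hull[OF UV that])
  have tw: "\<forall>X \<in> \<S>. \<forall>Y \<in> \<V>. all.ext0 X Y"
    using twin Ext1_vanishes_ext0[of \<S> \<V>] cotorsion_obj[OF ST] cotorsion_obj[OF UV] by blast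
  show "\<S> \<subseteq> \<U>" using tw cotorsion_left_iff[OF UV] cotorsion_obj[OF ST] by blast
  show "\<V> \<subseteq> \<T>" using tw cotorsion_right_iff[OF ST] cotorsion_obj[OF UV] by blast
  show "\<S> \<inter> \<T> = \<S> \<inter> \<T>" "\<S> \<inter> \<T> = \<U> \<inter> \<V>" using concentric by auto
qed

end

context concentric_tcp_choice
begin

sublocale tw: twin \<C> \<I> tri \<S> \<T> \<U> \<V>
  unfolding \<I>_def by (rule twin_tri)

abbreviation cover :: "'o \<Rightarrow> 'm" where "cover X \<equiv> fst (triU X)"
abbreviation hull :: "'o \<Rightarrow> 'm" where "hull X \<equiv> fst (triT X)"

lemma cover_tri: assumes "X \<in> Obj \<C>" shows "\<exists>v B. B \<in> \<V> \<and> tri B v (omega_obj X) (cover X) X" "omega_obj X \<in> \<U>"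
proof -
  obtain u v w where t: "triU X = (u, v, w)" by (cases "triU X")
  note a = triU[OF assms t]
  then obtain B where B: "B \<in> \<V>" "Cod \<C> v = sh B" unfolding sh_subcat_def by blast
  have d: "omega_obj X = Dom \<C> u" "cover X = u" unfolding omega_obj_def t by simp_all
  have "tri3 (omega_obj X) u X v (sh B) w" using Tri_tri3[of u v w] a B d by simp
  then show "\<exists>v B. B \<in> \<V> \<and> tri B v (omega_obj X) (cover X) X"
    using tri3_shifted_cone tw.mem_obj(4) B(1) unfolding d(2) by blast
  show "omega_obj X \<in> \<U>" using a d by simp
qed

lemma hull_tri: assumes "X \<in> Obj \<C>" shows "\<exists>s B. B \<in> \<S> \<and> tri X (hull X) (sigma_obj X) s B" "sigma_obj X \<in> \<T>"
proof -
  obtain t s r where t: "triT X = (t, s, r)" by (cases "triT X")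
  note a = triT[OF assms t]
  have d: "sigma_obj X = Cod \<C> t" "hull X = t" unfolding sigma_obj_def t by simp_all
  have "tri3 X t (sigma_obj X) s (Cod \<C> s) r" using Tri_tri3[of t s r] a d by simp
  then show "\<exists>s B. B \<in> \<S> \<and> tri X (hull X) (sigma_obj X) s B" using tri3_tri a unfolding d(2) by blast
  show "sigma_obj X \<in> \<T>" using a d by simp
qed

lemma srel_sigma: "X \<in> Obj \<C> \<Longrightarrow> tw.srel X (sigma_obj X)"
  unfolding tw.srel_def using hull_tri by blast

lemma wrel_omega: "X \<in> Obj \<C> \<Longrightarrow> tw.wrel X (omega_obj X)"
  unfolding tw.wrel_def using cover_tri by blast

lemma sigma_Obj: "X \<in> Obj \<C> \<Longrightarrow> sigma_obj X \<in> Obj \<C>" and omega_Obj: "X \<in> Obj \<C> \<Longrightarrow> omega_obj X \<in> Obj \<C>"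
  using hull_tri(2) cover_tri(2) tw.mem_obj by blast+

lemma sigma_Z: "X \<in> \<U> \<Longrightarrow> sigma_obj X \<in> \<Z>" and omega_Z: "X \<in> \<T> \<Longrightarrow> omega_obj X \<in> \<Z>"
  unfolding \<Z>_def using tw.srel_in_U[OF srel_sigma] tw.wrel_in_T[OF wrel_omega] hull_tri(2) cover_tri(2)
    tw.mem_obj(2,3) by blast+

lemma Z_obj: "Z \<in> \<Z> \<Longrightarrow> Z \<in> Obj \<C>" "Z \<in> \<Z> \<Longrightarrow> Z \<in> \<T>" "Z \<in> \<Z> \<Longrightarrow> Z \<in> \<U>"
  unfolding \<Z>_def using tw.mem_obj by auto

lemma hull_hom: "X \<in> Obj \<C> \<Longrightarrow> hull X \<in> Hom \<C> X (sigma_obj X)"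
  using hull_tri(1) tw.tri_homs(1) by blast

lemma cover_hom: "X \<in> Obj \<C> \<Longrightarrow> cover X \<in> Hom \<C> (omega_obj X) X"
  using cover_tri(1) tw.tri_homs(2) by blast

lemma hull_eqv: "\<lbrakk>X \<in> Obj \<C>; Y \<in> \<T>; a \<in> Hom \<C> (sigma_obj X) Y; b \<in> Hom \<C> (sigma_obj X) Y;
    tw.eqv X Y (a \<cdot> hull X) (b \<cdot> hull X)\<rbrakk> \<Longrightarrow> tw.eqv (sigma_obj X) Y a b"
  using hull_tri(1) tw.hull_eqv by blast

lemma cover_eqv: "\<lbrakk>X \<in> Obj \<C>; Y \<in> \<U>; a \<in> Hom \<C> Y (omega_obj X); b \<in> Hom \<C> Y (omega_obj X);
    tw.eqv Y X (cover X \<cdot> a) (cover X \<cdot> b)\<rbrakk> \<Longrightarrow> tw.eqv Y (omega_obj X) a b"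
  using cover_tri(1) tw.cover_eqv by blast

lemma C_I_simps: "C_I = ideal_quotient \<C> \<I> (Obj \<C>)" "residue f = tw.cls f"
  "eta X = tw.cls (hull X)" "eps X = tw.cls (cover X)"
  by (simp_all add: C_I_def residue_def eta_def eps_def)

lemma C_I_hom: "\<lbrakk>X \<in> Obj \<C>; Y \<in> Obj \<C>\<rbrakk> \<Longrightarrow> Hom C_I X Y = tw.cls ` Hom \<C> X Y"
  unfolding C_I_simps by (rule tw.quotient_hom)

lemma C_I_comp: "\<lbrakk>f \<in> Hom \<C> X Y; g \<in> Hom \<C> Y Z\<rbrakk> \<Longrightarrow> tw.cls g \<cdot>\<^bsub>C_I\<^esub> tw.cls f = tw.cls (g \<cdot> f)"
  unfolding C_I_simps by (rule tw.cls_comp)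

text \<open>\<open>sigma_arr\<close> is a definite description; by uniqueness along the hull, any g
  compatible with f modulo \<I> computes it.\<close>

lemma sigma_arr_cls:
  assumes f: "f \<in> Hom \<C> X Y" and g: "g \<in> Hom \<C> (sigma_obj X) (sigma_obj Y)"
    and e: "tw.eqv X (sigma_obj Y) (g \<cdot> hull X) (hull Y \<cdot> f)"
  shows "sigma_arr (tw.cls f) = tw.cls g"
proof -
  note o = hom_obj[OF f]
  note hX = hull_hom[OF o(1)] and hY = hull_hom[OF o(2)]
  have d: "Dom C_I (tw.cls f) = X" "Cod C_I (tw.cls f) = Y" unfolding C_I_simps using tw.cls_dom_cod[OF f] by auto
  have *: "tw.cls b \<cdot>\<^bsub>C_I\<^esub> eta X = eta Y \<cdot>\<^bsub>C_I\<^esub> tw.cls f \<longleftrightarrow> tw.eqv X (sigma_obj Y) (b \<cdot> hull X) (hull Y \<cdot> f)"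
    if b: "b \<in> Hom \<C> (sigma_obj X) (sigma_obj Y)" for b
    unfolding C_I_simps(3) C_I_comp[OF hX b] C_I_comp[OF f hY]
    by (rule tw.cls_eqv[OF comp_hom[OF hX b] comp_hom[OF f hY]])
  show ?thesis
    unfolding sigma_arr_def Let_def d
  proof (rule the_equality)
    show "tw.cls g \<in> Hom C_I (sigma_obj X) (sigma_obj Y) \<and> tw.cls g \<cdot>\<^bsub>C_I\<^esub> eta X = eta Y \<cdot>\<^bsub>C_I\<^esub> tw.cls f"
      using *[OF g] e C_I_hom[OF sigma_Obj sigma_Obj, OF o] g by blast
    fix G assume G: "G \<in> Hom C_I (sigma_obj X) (sigma_obj Y) \<and> G \<cdot>\<^bsub>C_I\<^esub> eta X = eta Y \<cdot>\<^bsub>C_I\<^esub> tw.cls f"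
    then obtain b where b: "b \<in> Hom \<C> (sigma_obj X) (sigma_obj Y)" "G = tw.cls b"
      using C_I_hom[OF sigma_Obj sigma_Obj, OF o] by blast
    have "tw.eqv X (sigma_obj Y) (b \<cdot> hull X) (g \<cdot> hull X)"
      using *[OF b(1)] G b(2) e tw.eqv_trans tw.eqv_sym by blast
    then have "tw.eqv (sigma_obj X) (sigma_obj Y) b g" by (rule hull_eqv[OF o(1) hull_tri(2)[OF o(2)] b(1) g])
    then show "G = tw.cls g" using tw.cls_eqv[OF b(1) g] b(2) by simp
  qed
qed

lemma omega_arr_cls:
  assumes f: "f \<in> Hom \<C> X Y" and g: "g \<in> Hom \<C> (omega_obj X) (omega_obj Y)"
    and e: "tw.eqv (omega_obj X) Y (cover Y \<cdot> g) (f \<cdot> cover X)"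
  shows "omega_arr (tw.cls f) = tw.cls g"
proof -
  note o = hom_obj[OF f]
  note hX = cover_hom[OF o(1)] and hY = cover_hom[OF o(2)]
  have d: "Dom C_I (tw.cls f) = X" "Cod C_I (tw.cls f) = Y" unfolding C_I_simps using tw.cls_dom_cod[OF f] by auto
  have *: "eps Y \<cdot>\<^bsub>C_I\<^esub> tw.cls b = tw.cls f \<cdot>\<^bsub>C_I\<^esub> eps X \<longleftrightarrow> tw.eqv (omega_obj X) Y (cover Y \<cdot> b) (f \<cdot> cover X)"
    if b: "b \<in> Hom \<C> (omega_obj X) (omega_obj Y)" for b
    unfolding C_I_simps(4) C_I_comp[OF hX f] C_I_comp[OF b hY]
    by (rule tw.cls_eqv[OF comp_hom[OF b hY] comp_hom[OF hX f]])
  show ?thesis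
    unfolding omega_arr_def Let_def d
  proof (rule the_equality)
    show "tw.cls g \<in> Hom C_I (omega_obj X) (omega_obj Y) \<and> eps Y \<cdot>\<^bsub>C_I\<^esub> tw.cls g = tw.cls f \<cdot>\<^bsub>C_I\<^esub> eps X"
      using *[OF g] e C_I_hom[OF omega_Obj omega_Obj, OF o] g by blast
    fix G assume G: "G \<in> Hom C_I (omega_obj X) (omega_obj Y) \<and> eps Y \<cdot>\<^bsub>C_I\<^esub> G = tw.cls f \<cdot>\<^bsub>C_I\<^esub> eps X"
    then obtain b where b: "b \<in> Hom \<C> (omega_obj X) (omega_obj Y)" "G = tw.cls b"
      using C_I_hom[OF omega_Obj omega_Obj, OF o] by blast
    have "tw.eqv (omega_obj X) Y (cover Y \<cdot> b) (cover Y \<cdot> g)"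
      using *[OF b(1)] G b(2) e tw.eqv_trans tw.eqv_sym by blast
    then have "tw.eqv (omega_obj X) (omega_obj Y) b g" by (rule cover_eqv[OF o(2) cover_tri(2)[OF o(1)] b(1) g])
    then show "G = tw.cls g" using tw.cls_eqv[OF b(1) g] b(2) by simp
  qed
qed

lemma sigma_arr_ex:
  assumes f: "f \<in> Hom \<C> X Y"
  obtains g where "g \<in> Hom \<C> (sigma_obj X) (sigma_obj Y)" "g \<cdot> hull X = hull Y \<cdot> f" "sigma_arr (tw.cls f) = tw.cls g"
proof -
  note o = hom_obj[OF f]
  obtain s B where "B \<in> \<S>" "tri X (hull X) (sigma_obj X) s B" using hull_tri(1)[OF o(1)] by blast
  then obtain g where g: "g \<in> Hom \<C> (sigma_obj X) (sigma_obj Y)" "g \<cdot> hull X = hull Y \<cdot> f"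
    using tw.hull_extend hull_tri(2)[OF o(2)] comp_hom[OF f hull_hom[OF o(2)]] by blast
  show ?thesis
    using that[OF g sigma_arr_cls[OF f g(1)]] g(2) tw.eqv_refl[OF comp_hom[OF f hull_hom[OF o(2)]]] by simp
qed

lemma omega_arr_ex:
  assumes f: "f \<in> Hom \<C> X Y"
  obtains g where "g \<in> Hom \<C> (omega_obj X) (omega_obj Y)" "cover Y \<cdot> g = f \<cdot> cover X" "omega_arr (tw.cls f) = tw.cls g"
proof -
  note o = hom_obj[OF f]
  obtain v B where "B \<in> \<V>" "tri B v (omega_obj Y) (cover Y) Y" using cover_tri(1)[OF o(2)] by blast
  then obtain g where g: "g \<in> Hom \<C> (omega_obj X) (omega_obj Y)" "cover Y \<cdot> g = f \<cdot> cover X"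
    using tw.cover_lift cover_tri(2)[OF o(1)] comp_hom[OF cover_hom[OF o(1)] f] by blast
  show ?thesis
    using that[OF g omega_arr_cls[OF f g(1)]] g(2) tw.eqv_refl[OF comp_hom[OF cover_hom[OF o(1)] f]] by simp
qed

text \<open>Extend along the hull of \<open>omega_obj X\<close>, possible since the target is in
  \<T>, then lift along the cover of \<open>sigma_obj X\<close>, possible since the source is in
  \<U>.\<close>

lemma mu_component_ex:
  assumes "X \<in> Obj \<C>"
  shows "\<exists>n \<in> Hom \<C> (sigma_obj (omega_obj X)) (omega_obj (sigma_obj X)).
    cover (sigma_obj X) \<cdot> (n \<cdot> hull (omega_obj X)) = hull X \<cdot> cover X"
proof -
  note o = omega_Obj[OF assms] sigma_Obj[OF assms]
  note hc = comp_hom[OF cover_hom[OF assms] hull_hom[OF assms]]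
  obtain s B where "B \<in> \<S>" "tri (omega_obj X) (hull (omega_obj X)) (sigma_obj (omega_obj X)) s B"
    using hull_tri(1)[OF o(1)] by blast
  then obtain a where a: "a \<in> Hom \<C> (sigma_obj (omega_obj X)) (sigma_obj X)"
    "a \<cdot> hull (omega_obj X) = hull X \<cdot> cover X"
    using tw.hull_extend hull_tri(2)[OF assms] hc by blast
  obtain v D where "D \<in> \<V>" "tri D v (omega_obj (sigma_obj X)) (cover (sigma_obj X)) (sigma_obj X)"
    using cover_tri(1)[OF o(2)] by blast
  moreover have "sigma_obj (omega_obj X) \<in> \<U>" using sigma_Z[OF cover_tri(2)[OF assms]] Z_obj(3) by blast
  ultimately obtain n where n: "n \<in> Hom \<C> (sigma_obj (omega_obj X)) (omega_obj (sigma_obj X))"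
    "cover (sigma_obj X) \<cdot> n = a" using tw.cover_lift a(1) by blast
  show ?thesis
    using n(1) comp_assoc[OF hull_hom[OF o(1)] n(1) cover_hom[OF o(2)]] n(2) a(2) by auto
qed

lemma hull_cover_eqv:
  assumes A: "A \<in> \<U>" and B: "B \<in> \<T>"
    and h: "a \<in> Hom \<C> (sigma_obj A) (omega_obj B)" "b \<in> Hom \<C> (sigma_obj A) (omega_obj B)"
    and e: "tw.eqv A B (cover B \<cdot> (a \<cdot> hull A)) (cover B \<cdot> (b \<cdot> hull A))"
  shows "tw.eqv (sigma_obj A) (omega_obj B) a b"
proof -
  have o: "A \<in> Obj \<C>" "B \<in> Obj \<C>" using A B tw.mem_obj by auto
  note t = hull_hom[OF o(1)] and u = cover_hom[OF o(2)]
  have "tw.eqv A B ((cover B \<cdot> a) \<cdot> hull A) ((cover B \<cdot> b) \<cdot> hull A)"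
    using e comp_assoc[OF t h(1) u] comp_assoc[OF t h(2) u] by simp
  then have "tw.eqv (sigma_obj A) B (cover B \<cdot> a) (cover B \<cdot> b)"
    by (rule hull_eqv[OF o(1) B comp_hom[OF h(1) u] comp_hom[OF h(2) u]])
  then show ?thesis by (rule cover_eqv[OF o(2) Z_obj(3)[OF sigma_Z[OF A]] h])
qed

text \<open>\<open>mu\<close> is a definite description, so its properties become available only
  through existence and uniqueness of the whole family. What is extracted is the hom-set of each
  component.\<close>

lemma mu_hom:
  assumes X: "X \<in> Obj \<C>"
  shows "mu X \<in> Hom (ideal_quotient \<C> \<I> \<Z>) (sigma_obj (omega_obj X)) (omega_obj (sigma_obj X))"
proof -
  let ?P = "\<lambda>m. m \<in> extensional (Obj \<C>) \<and>
     (\<forall>X \<in> Obj \<C>. m X \<in> Hom (ideal_quotient \<C> \<I> \<Z>)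
        (sigma_obj (omega_obj X)) (omega_obj (sigma_obj X))) \<and>
     (\<forall>X Y. \<forall>F \<in> Hom C_I X Y.
        m Y \<cdot>\<^bsub>C_I\<^esub> sigma_arr (omega_arr F) = omega_arr (sigma_arr F) \<cdot>\<^bsub>C_I\<^esub> m X) \<and>
     (\<forall>X \<in> Obj \<C>. eps (sigma_obj X) \<cdot>\<^bsub>C_I\<^esub> m X \<cdot>\<^bsub>C_I\<^esub> eta (omega_obj X)
        = eta X \<cdot>\<^bsub>C_I\<^esub> eps X)"
  obtain n where n: "n X \<in> Hom \<C> (sigma_obj (omega_obj X)) (omega_obj (sigma_obj X))"
    "cover (sigma_obj X) \<cdot> (n X \<cdot> hull (omega_obj X)) = hull X \<cdot> cover X" if "X \<in> Obj \<C>" for X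
    using mu_component_ex by metis
  define m where "m = restrict (\<lambda>X. tw.cls (n X)) (Obj \<C>)"
  have m: "m X = tw.cls (n X)" if "X \<in> Obj \<C>" for X using that unfolding m_def by simp
  have ZH: "Hom (ideal_quotient \<C> \<I> \<Z>) (sigma_obj (omega_obj X)) (omega_obj (sigma_obj X)) =
    tw.cls ` Hom \<C> (sigma_obj (omega_obj X)) (omega_obj (sigma_obj X))" if "X \<in> Obj \<C>" for X
    by (rule tw.quotient_hom[OF sigma_Z[OF cover_tri(2)[OF that]] omega_Z[OF hull_tri(2)[OF that]]])
  have cmp: "eps (sigma_obj X) \<cdot>\<^bsub>C_I\<^esub> tw.cls b \<cdot>\<^bsub>C_I\<^esub> eta (omega_obj X)
      = tw.cls (cover (sigma_obj X) \<cdot> (b \<cdot> hull (omega_obj X)))"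
    if X: "X \<in> Obj \<C>" and b: "b \<in> Hom \<C> (sigma_obj (omega_obj X)) (omega_obj (sigma_obj X))" for X b
    unfolding C_I_simps(3,4) C_I_comp[OF hull_hom[OF omega_Obj[OF X]] b]
    by (rule C_I_comp[OF comp_hom[OF hull_hom[OF omega_Obj[OF X]] b] cover_hom[OF sigma_Obj[OF X]]])
  have ee: "eta X \<cdot>\<^bsub>C_I\<^esub> eps X = tw.cls (hull X \<cdot> cover X)" if X: "X \<in> Obj \<C>" for X
    unfolding C_I_simps(3,4) by (rule C_I_comp[OF cover_hom[OF X] hull_hom[OF X]])
  have "?P m"
  proof (intro conjI ballI allI)
    show "m \<in> extensional (Obj \<C>)" unfolding m_def by simp
    show "m X \<in> Hom (ideal_quotient \<C> \<I> \<Z>) (sigma_obj (omega_obj X)) (omega_obj (sigma_obj X))"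
      if "X \<in> Obj \<C>" for X using ZH[OF that] m[OF that] n(1)[OF that] by blast
    show "eps (sigma_obj X) \<cdot>\<^bsub>C_I\<^esub> m X \<cdot>\<^bsub>C_I\<^esub> eta (omega_obj X) = eta X \<cdot>\<^bsub>C_I\<^esub> eps X"
      if "X \<in> Obj \<C>" for X unfolding m[OF that] cmp[OF that n(1)[OF that]] n(2)[OF that] ee[OF that] ..
    fix X Y F assume F: "F \<in> Hom C_I X Y"
    have X: "X \<in> Obj \<C>" "Y \<in> Obj \<C>" using tw.quotient_hom_obj F unfolding C_I_simps by blast+
    obtain f where f: "f \<in> Hom \<C> X Y" "F = tw.cls f" using F C_I_hom[OF X] by blast
    obtain g where g: "g \<in> Hom \<C> (omega_obj X) (omega_obj Y)" "cover Y \<cdot> g = f \<cdot> cover X"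
      "omega_arr F = tw.cls g" using omega_arr_ex[OF f(1)] f(2) by blast
    obtain g1 where g1: "g1 \<in> Hom \<C> (sigma_obj (omega_obj X)) (sigma_obj (omega_obj Y))"
      "g1 \<cdot> hull (omega_obj X) = hull (omega_obj Y) \<cdot> g" "sigma_arr (omega_arr F) = tw.cls g1"
      using sigma_arr_ex[OF g(1)] g(3) by metis
    obtain h where h: "h \<in> Hom \<C> (sigma_obj X) (sigma_obj Y)" "h \<cdot> hull X = hull Y \<cdot> f"
      "sigma_arr F = tw.cls h" using sigma_arr_ex[OF f(1)] f(2) by blast
    obtain h1 where h1: "h1 \<in> Hom \<C> (omega_obj (sigma_obj X)) (omega_obj (sigma_obj Y))"
      "cover (sigma_obj Y) \<cdot> h1 = h \<cdot> cover (sigma_obj X)" "omega_arr (sigma_arr F) = tw.cls h1"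
      using omega_arr_ex[OF h(1)] h(3) by metis
    note nX = n[OF X(1)] and nY = n[OF X(2)]
    note tX = hull_hom[OF omega_Obj[OF X(1)]] and tY = hull_hom[OF omega_Obj[OF X(2)]]
    note uX = cover_hom[OF sigma_Obj[OF X(1)]] and uY = cover_hom[OF sigma_Obj[OF X(2)]]
    note c = cover_hom[OF X(1)] cover_hom[OF X(2)] hull_hom[OF X(1)] hull_hom[OF X(2)]
    \<comment> \<open>Enclosed between the outer cover and hull, both sides of the naturality square
      equal \<open>hull Y \<cdot> f \<cdot> cover X\<close> already in \<C>.\<close>
    have "cover (sigma_obj Y) \<cdot> ((n Y \<cdot> g1) \<cdot> hull (omega_obj X)) = (hull Y \<cdot> cover Y) \<cdot> g"
      using comp_assoc[OF tX g1(1) nY(1)] g1(2) comp_assoc[OF g(1) tY nY(1)]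
        comp_assoc[OF g(1) comp_hom[OF tY nY(1)] uY] nY(2) by simp
    also have "\<dots> = hull Y \<cdot> (f \<cdot> cover X)" using comp_assoc[OF g(1) c(2,4)] g(2) by simp
    also have "\<dots> = h \<cdot> (hull X \<cdot> cover X)"
      using comp_assoc[OF c(1) f(1) c(4)] h(2) comp_assoc[OF c(1,3) h(1)] by simp
    also have "\<dots> = (h \<cdot> cover (sigma_obj X)) \<cdot> (n X \<cdot> hull (omega_obj X))"
      using nX(2) comp_assoc[OF comp_hom[OF tX nX(1)] uX h(1)] by simp
    also have "\<dots> = cover (sigma_obj Y) \<cdot> ((h1 \<cdot> n X) \<cdot> hull (omega_obj X))"
      using h1(2) comp_assoc[OF comp_hom[OF tX nX(1)] h1(1) uY] comp_assoc[OF tX nX(1) h1(1)] by simp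
    finally have "tw.eqv (sigma_obj (omega_obj X)) (omega_obj (sigma_obj Y)) (n Y \<cdot> g1) (h1 \<cdot> n X)"
      using hull_cover_eqv[OF cover_tri(2)[OF X(1)] hull_tri(2)[OF X(2)] comp_hom[OF g1(1) nY(1)]
          comp_hom[OF nX(1) h1(1)]] tw.eqv_refl[OF comp_hom[OF comp_hom[OF tX comp_hom[OF nX(1) h1(1)]] uY]] by simp
    then have "tw.cls (n Y \<cdot> g1) = tw.cls (h1 \<cdot> n X)"
      using tw.cls_eqv[OF comp_hom[OF g1(1) nY(1)] comp_hom[OF nX(1) h1(1)]] by blast
    then show "m Y \<cdot>\<^bsub>C_I\<^esub> sigma_arr (omega_arr F) = omega_arr (sigma_arr F) \<cdot>\<^bsub>C_I\<^esub> m X"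
      unfolding g1(3) h1(3) m[OF X(1)] m[OF X(2)] C_I_comp[OF g1(1) nY(1)] C_I_comp[OF nX(1) h1(1)] .
  qed
  \<comment> \<open>The compatibility equation determines each component by
    \<open>hull_cover_eqv\<close>, and \<open>extensional\<close> settles the arguments outside
    \<open>Obj \<C>\<close>.\<close>
  moreover have "m' = m" if m': "?P m'" for m'
  proof (rule extensionalityI[of _ "Obj \<C>"])
    fix X assume X: "X \<in> Obj \<C>"
    obtain b where b: "b \<in> Hom \<C> (sigma_obj (omega_obj X)) (omega_obj (sigma_obj X))" "m' X = tw.cls b"
      using m'[THEN conjunct2, THEN conjunct1, rule_format, OF X] unfolding ZH[OF X] by blast
    note h = comp_hom[OF comp_hom[OF hull_hom[OF omega_Obj[OF X]] b(1)] cover_hom[OF sigma_Obj[OF X]]]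
      comp_hom[OF comp_hom[OF hull_hom[OF omega_Obj[OF X]] n(1)[OF X]] cover_hom[OF sigma_Obj[OF X]]]
    have "eps (sigma_obj X) \<cdot>\<^bsub>C_I\<^esub> m' X \<cdot>\<^bsub>C_I\<^esub> eta (omega_obj X) = eta X \<cdot>\<^bsub>C_I\<^esub> eps X"
      by (rule m'[THEN conjunct2, THEN conjunct2, THEN conjunct2, rule_format, OF X])
    then have "tw.cls (cover (sigma_obj X) \<cdot> (b \<cdot> hull (omega_obj X))) =
        tw.cls (cover (sigma_obj X) \<cdot> (n X \<cdot> hull (omega_obj X)))"
      unfolding b(2) cmp[OF X b(1)] ee[OF X] n(2)[OF X] .
    then have "tw.eqv (sigma_obj (omega_obj X)) (omega_obj (sigma_obj X)) b (n X)"
      using tw.cls_eqv[OF h] hull_cover_eqv[OF cover_tri(2)[OF X] hull_tri(2)[OF X] b(1) n(1)[OF X]] by blast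
    then show "m' X = m X" unfolding b(2) m[OF X] using tw.cls_eqv[OF b(1) n(1)[OF X]] by blast
  qed (use m'[THEN conjunct1] in \<open>simp_all add: m_def\<close>)
  ultimately have "?P mu" unfolding mu_def by (rule theI)
  from this[THEN conjunct2, THEN conjunct1, rule_format, OF X] show ?thesis .
qed

lemma mutable_twin_tri:
  assumes I: condition_I and II: condition_II
  shows "mutable_twin \<C> \<I> tri \<S> \<T> \<U> \<V>"
proof (intro mutable_twin.intro mutable_twin_axioms.intro tw.twin_axioms)
  fix A f X g B W Z Y Z'
  assume t: "tri A f X g B" "A \<in> \<T>" "B \<in> \<U>" and r: "tw.wrel X W" "tw.srel W Z" "tw.srel X Y" "tw.wrel Y Z'"
  have X: "X \<in> Obj \<C>" using tw.tri_homs(4)[OF t(1)] .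
  have "X \<in> star \<C> \<T> \<U>" using star_tri t by blast
  then have "is_iso (ideal_quotient \<C> \<I> \<Z>) (mu X)" using I unfolding condition_I_def by blast
  then have "isomorphic (ideal_quotient \<C> \<I> \<Z>) (sigma_obj (omega_obj X)) (omega_obj (sigma_obj X))"
    unfolding isomorphic_def using mu_hom[OF X] by blast
  moreover note o = omega_Obj[OF X] sigma_Obj[OF X]
  ultimately have "tw.isoJ (sigma_obj (omega_obj X)) (omega_obj (sigma_obj X))"
    using tw.quotient_isomorphic[OF sigma_Z[OF cover_tri(2)[OF X]] omega_Z[OF hull_tri(2)[OF X]]
        sigma_Obj[OF o(1)] omega_Obj[OF o(2)]] by blast
  \<comment> \<open>(I) speaks of the chosen triangles; other values of the relations differ from
    these by isomorphisms modulo \<I>.\<close>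
  moreover have "tw.isoJ Z (sigma_obj (omega_obj X))"
    by (rule tw.srel_iso[OF tw.wrel_unique[OF r(1) wrel_omega[OF X]] r(2) srel_sigma[OF o(1)]])
  moreover have "tw.isoJ Z' (omega_obj (sigma_obj X))"
    by (rule tw.wrel_iso[OF tw.srel_unique[OF r(3) srel_sigma[OF X]] r(4) wrel_omega[OF o(2)]])
  ultimately show "tw.isoJ Z Z'" using tw.isoJ_trans tw.isoJ_sym by blast
next
  fix A f B g D assume t: "tri A f B g D" "A \<in> \<U>" "B \<in> \<V>" "D \<in> \<S>"
  then obtain h where h: "tri3 A f B g D h" unfolding tri_def by blast
  \<comment> \<open>\<open>N_f\<close> asks for an object whose shift lies in \<S>. As D need not be
    a shift, it is replaced by an isomorphic X[1].\<close>
  obtain X where X: "X \<in> Obj \<C>" "isomorphic \<C> (sh X) D" using sh_ess_surj tw.mem_obj(1)[OF t(4)] by blast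
  then obtain z where z: "z \<in> Hom \<C> (sh X) D" "is_iso \<C> z" unfolding isomorphic_def by blast
  obtain z' where z': "z' \<in> Hom \<C> D (sh X)" "z' \<cdot> z = Idn \<C> (sh X)" "z \<cdot> z' = Idn \<C> D" "is_iso \<C> z'"
    using is_isoE[OF z(2,1)] .
  have "isomorphic \<C> D (sh X)" unfolding isomorphic_def using z' by blast
  then have "sh X \<in> \<S>"
    using ST_cotorsion t(4) unfolding cotorsion_pairs_def additive_subcat_def by blast
  note a = tri3D[OF h]
  note hz = comp_hom[OF z(1) a(4)] and zg = comp_hom[OF a(3) z'(1)]
  have "tri3 A f B (z' \<cdot> g) (sh X) (h \<cdot> z)"
    by (rule tri3_transport[OF h a(2) zg hz idn_hom[OF a(5)] idn_hom[OF a(6)] z'(1)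
          idn_iso[OF a(5)] idn_iso[OF a(6)] z'(4)])
      (simp_all add: idn_left[OF a(2)] idn_right[OF a(2)] idn_right[OF zg] sh_idn[OF a(5)]
        idn_left[OF a(4)] comp_assoc[OF z'(1) z(1) a(4)] z'(3) idn_right[OF a(4)])
  then obtain k where "tri X k A f B" using tri3_shifted_cone X(1) by blast
  then have "A \<in> N_f"
    unfolding N_f_def star_tri unsh_subcat_def using X(1) \<open>sh X \<in> \<S>\<close> t(3) by blast
  then show "A \<in> \<S>" using II t(2) unfolding condition_II_def by blast
next
  fix D f B g A assume t: "tri D f B g A" "A \<in> \<T>" "B \<in> \<S>" "D \<in> \<V>"
  then have "A \<in> N_i" unfolding N_i_def using star_shift[of \<V> A \<S>] tw.mem_obj(4) by blast
  then show "A \<in> \<V>" using II t(2) unfolding condition_II_def by blast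
qed

end

section \<open>Vanishing of morphisms and extensions under isomorphisms and biproducts modulo
  \<open>\<J>\<close>\<close>

context mutable_twin
begin

lemma hom_null_iso:
  assumes X: "isoJ X X'" and Y: "isoJ Y Y'" and n: "\<And>f. f \<in> Hom \<C> X' Y' \<Longrightarrow> null X' Y' f"
    and f: "f \<in> Hom \<C> X Y"
  shows "null X Y f"
proof -
  obtain a a' where a: "a \<in> Hom \<C> X X'" "a' \<in> Hom \<C> X' X" "eqv X X (a' \<cdot> a) (Idn \<C> X)"
    using X unfolding isoJ_def by blast
  obtain b b' where b: "b \<in> Hom \<C> Y Y'" "b' \<in> Hom \<C> Y' Y" "eqv Y Y (b' \<cdot> b) (Idn \<C> Y)"
    using Y unfolding isoJ_def by blast
  note fa = comp_hom[OF a(2) f]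
  have "null X' Y' (b \<cdot> (f \<cdot> a'))" by (rule n[OF comp_hom[OF fa b(1)]])
  then have "null X' Y ((b' \<cdot> b) \<cdot> (f \<cdot> a'))" using null_comp_left[OF _ b(2)] comp_assoc[OF fa b(1,2)] by simp
  then have "null X' Y (f \<cdot> a')"
    using eqv_null[OF eqv_sym[OF eqv_comp_right[OF fa b(3)]]] idn_left[OF fa] by simp
  then have "null X Y (f \<cdot> (a' \<cdot> a))" using null_comp_right[OF _ a(1)] comp_assoc[OF a(1,2) f] by metis
  then show ?thesis using eqv_null[OF eqv_sym[OF eqv_comp_left[OF a(3) f]]] idn_right[OF f] by simp
qed

lemma ext0_biproductJ_left:
  assumes B: "biproductJ X Y B" and e: "ext0 X A" "ext0 Y A" "\<And>J. J \<in> \<J> \<Longrightarrow> ext0 J A"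
  shows "ext0 B A"
  unfolding ext0_def
proof (intro allI impI)
  fix E f g assume t: "tri A f E g B"
  obtain i j p q where h: "i \<in> Hom \<C> X B" "j \<in> Hom \<C> Y B" "p \<in> Hom \<C> B X" "q \<in> Hom \<C> B Y"
    and eq: "eqv B B (Plus \<C> (i \<cdot> p) (j \<cdot> q)) (Idn \<C> B)" using B unfolding biproductJ_def by blast
  obtain n where n: "null B B n" "Idn \<C> B = Plus \<C> (Plus \<C> (i \<cdot> p) (j \<cdot> q)) n"
    using eqvD[OF eqv_sym[OF eq]] by blast
  then obtain J a b where J: "J \<in> \<J>" "a \<in> Hom \<C> B J" "b \<in> Hom \<C> J B" "n = b \<cdot> a"
    unfolding null_def by blast
  obtain i' where i': "i' \<in> Hom \<C> X E" "g \<cdot> i' = i" using ext_lift[OF e(1) t h(1)] by blast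
  obtain j' where j': "j' \<in> Hom \<C> Y E" "g \<cdot> j' = j" using ext_lift[OF e(2) t h(2)] by blast
  obtain b' where b': "b' \<in> Hom \<C> J E" "g \<cdot> b' = b" using ext_lift[OF e(3)[OF J(1)] t J(3)] by blast
  note g = tri_homs(2)[OF t]
  note c = comp_hom[OF h(3) i'(1)] comp_hom[OF h(4) j'(1)] comp_hom[OF J(2) b'(1)]
  have "g \<cdot> Plus \<C> (Plus \<C> (i' \<cdot> p) (j' \<cdot> q)) (b' \<cdot> a) = Idn \<C> B"
    using comp_plus_right[OF plus_hom[OF c(1,2)] c(3) g] comp_plus_right[OF c(1,2) g]
      comp_assoc[OF h(3) i'(1) g] comp_assoc[OF h(4) j'(1) g] comp_assoc[OF J(2) b'(1) g]
      i'(2) j'(2) b'(2) n(2) J(4) by simp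
  then show "\<exists>s \<in> Hom \<C> B E. g \<cdot> s = Idn \<C> B" using plus_hom[OF plus_hom[OF c(1,2)] c(3)] by blast
qed

lemma ext0_biproductJ_summand:
  assumes B: "biproductJ X Y B" and e: "ext0 B A" "\<And>J. J \<in> \<J> \<Longrightarrow> ext0 J A"
  shows "ext0 X A" "ext0 Y A"
proof -
  obtain i j p q where h: "i \<in> Hom \<C> X B" "j \<in> Hom \<C> Y B" "p \<in> Hom \<C> B X" "q \<in> Hom \<C> B Y"
    and eq: "eqv X X (p \<cdot> i) (Idn \<C> X)" "eqv Y Y (q \<cdot> j) (Idn \<C> Y)"
    using B unfolding biproductJ_def by blast
  show "ext0 X A" using ext0_retract_left[OF h(1,3) eqv_sym[OF eq(1)] e(1)] e(2) by blast
  show "ext0 Y A" using ext0_retract_left[OF h(2,4) eqv_sym[OF eq(2)] e(1)] e(2) by blast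
qed

lemma ext0_biproductJ_right:
  "\<lbrakk>biproductJ X Y B; ext0 A X; ext0 A Y; \<And>J. J \<in> \<J> \<Longrightarrow> ext0 A J\<rbrakk> \<Longrightarrow> ext0 A B"
  "\<lbrakk>biproductJ X Y B; ext0 A B; \<And>J. J \<in> \<J> \<Longrightarrow> ext0 A J\<rbrakk> \<Longrightarrow> ext0 A X"
  "\<lbrakk>biproductJ X Y B; ext0 A B; \<And>J. J \<in> \<J> \<Longrightarrow> ext0 A J\<rbrakk> \<Longrightarrow> ext0 A Y"
  using mutable_twin.ext0_biproductJ_left[OF op_mutable, of X Y B A]
    mutable_twin.ext0_biproductJ_summand[OF op_mutable, of X Y B A]
  by (simp_all add: twin_op_simps op_biproductJ)

end

section \<open>The triangulated structure on the quotient\<close>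

context concentric_tcp_choice
begin

abbreviation Sig :: "'o \<Rightarrow> 'o" where "Sig X \<equiv> sigma_obj (step_obj X)"

lemma Z_I_fields:
  "Obj Z_I = \<Z>" "Arr Z_I = Arr (ideal_quotient \<C> \<I> \<Z>)" "Dom Z_I = Dom (ideal_quotient \<C> \<I> \<Z>)"
  "Cod Z_I = Cod (ideal_quotient \<C> \<I> \<Z>)" "Idn Z_I = Idn (ideal_quotient \<C> \<I> \<Z>)"
  "Comp Z_I = Comp (ideal_quotient \<C> \<I> \<Z>)" "Plus Z_I = Plus (ideal_quotient \<C> \<I> \<Z>)"
  "Zer Z_I = Zer (ideal_quotient \<C> \<I> \<Z>)" "sh_obj Z_I = Sig"
  "Tri Z_I = {t. candidate_triangle Z_I_shift t \<and> (\<exists>t'. standard_triangle t' \<and> tri_iso Z_I_shift t' t)}"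
  by (auto simp: Z_I_def Z_I_shift_def ideal_quotient_def cat_data.defs shift_cat_data.defs tri_cat_data.defs)

lemma Z_I_shift_fields:
  "Obj Z_I_shift = \<Z>" "Arr Z_I_shift = Arr (ideal_quotient \<C> \<I> \<Z>)"
  "Dom Z_I_shift = Dom (ideal_quotient \<C> \<I> \<Z>)"
  "Cod Z_I_shift = Cod (ideal_quotient \<C> \<I> \<Z>)" "Idn Z_I_shift = Idn (ideal_quotient \<C> \<I> \<Z>)"
  "Comp Z_I_shift = Comp (ideal_quotient \<C> \<I> \<Z>)" "sh_obj Z_I_shift = Sig"
  "sh_arr Z_I_shift = (\<lambda>F. sigma_arr (step_arr F))"
  by (auto simp: Z_I_shift_def ideal_quotient_def cat_data.defs shift_cat_data.defs)

lemma Z_I_Hom: "Hom Z_I = Hom (ideal_quotient \<C> \<I> \<Z>)" "Hom Z_I_shift = Hom (ideal_quotient \<C> \<I> \<Z>)"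
  by (auto simp: Hom_def Z_I_fields Z_I_shift_fields fun_eq_iff)

lemma Z_I_iso:
  "is_iso Z_I_shift F \<longleftrightarrow> is_iso (ideal_quotient \<C> \<I> \<Z>) F"
  "isomorphic Z_I X Y \<longleftrightarrow> isomorphic (ideal_quotient \<C> \<I> \<Z>) X Y"
  by (auto simp: isomorphic_def is_iso_def Z_I_Hom Z_I_fields Z_I_shift_fields)

lemma Z_I_hom: "\<lbrakk>X \<in> \<Z>; Y \<in> \<Z>\<rbrakk> \<Longrightarrow> Hom Z_I X Y = tw.cls ` Hom \<C> X Y"
  unfolding Z_I_Hom by (rule tw.quotient_hom)

lemma Z_I_isomorphic: "\<lbrakk>X \<in> \<Z>; Y \<in> \<Z>\<rbrakk> \<Longrightarrow> isomorphic Z_I X Y \<longleftrightarrow> tw.isoJ X Y"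
  unfolding Z_I_iso by (rule tw.quotient_isomorphic) (auto intro: Z_obj)

lemma Z_iso: "\<lbrakk>tw.isoJ X Y; X \<in> \<Z>\<rbrakk> \<Longrightarrow> Y \<in> \<Z>"
  unfolding \<Z>_def using tw.T_iso tw.U_iso by blast

lemma I_Z: "\<I> \<subseteq> \<Z>"
  unfolding \<Z>_def using tw.J_mem by blast

lemma step_tri:
  assumes "Z \<in> \<Z>"
  obtains i I p q where "triI Z = (i, p, q)" "tri3 Z i I p (step_obj Z) q" "I \<in> \<I>" "step_obj Z \<in> \<U>"
proof -
  obtain i p q where t: "triI Z = (i, p, q)" by (cases "triI Z")
  note a = triI[OF assms[unfolded \<Z>_def] t]
  have d: "step_obj Z = Cod \<C> p" unfolding step_obj_def t by simp
  have "tri3 Z i (Cod \<C> i) p (step_obj Z) q" using Tri_tri3[of i p q] a d by simp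
  then show ?thesis using that[OF t] a d \<I>_def by simp
qed

lemma step_Obj: "Z \<in> \<Z> \<Longrightarrow> step_obj Z \<in> Obj \<C>"
  using step_tri tw.mem_obj(3) by metis

lemma Sig_Z: "Z \<in> \<Z> \<Longrightarrow> Sig Z \<in> \<Z>"
  using step_tri sigma_Z by metis

lemma Srel_Sig: assumes "Z \<in> \<Z>" shows "tw.Srel Z (Sig Z)"
proof -
  obtain i I p q where "triI Z = (i, p, q)" "tri3 Z i I p (step_obj Z) q" "I \<in> \<I>" "step_obj Z \<in> \<U>"
    using step_tri[OF assms] .
  then show ?thesis unfolding tw.Srel_def using tri3_tri srel_sigma[OF step_Obj[OF assms]] by blast
qed

lemma sigma_arr_idn: "X \<in> Obj \<C> \<Longrightarrow> sigma_arr (tw.cls (Idn \<C> X)) = tw.cls (Idn \<C> (sigma_obj X))"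
  by (rule sigma_arr_cls[OF idn_hom idn_hom])
    (simp_all add: sigma_Obj idn_left[OF hull_hom] idn_right[OF hull_hom] tw.eqv_refl[OF hull_hom])

text \<open>Needed for the isomorphisms of triangles in \<open>star_Z_I_I\<close>, which are the
  identity on the first vertex. The description ranges over all representatives z of the identity
  and all fillers u, so u must be shown independent of both modulo \<I>.\<close>

lemma step_arr_idn:
  assumes Z: "Z \<in> \<Z>" shows "step_arr (tw.cls (Idn \<C> Z)) = tw.cls (Idn \<C> (step_obj Z))"
proof -
  obtain i I p q where t: "triI Z = (i, p, q)" "tri3 Z i I p (step_obj Z) q" "I \<in> \<I>" "step_obj Z \<in> \<U>"
    using step_tri[OF Z] .
  note a = tri3D[OF t(2)]
  note idZ = idn_hom[OF a(5)] and idI = idn_hom[OF a(6)] and idS = idn_hom[OF a(7)]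
  have d: "Dom \<C> z = Z" "Cod \<C> z = Z" if "z \<in> Hom \<C> Z Z" for z using that unfolding Hom_def by auto
  show ?thesis
    unfolding step_arr_def
  proof (rule the_equality)
    have "Idn \<C> Z \<in> tw.cls (Idn \<C> Z)" using tw.cls_eq[OF idZ] tw.eqv_refl[OF idZ] by blast
    moreover have "tri_mor \<C> (triI (Dom \<C> (Idn \<C> Z))) (triI (Cod \<C> (Idn \<C> Z)))
        (Idn \<C> Z, Idn \<C> I, Idn \<C> (step_obj Z))"
      unfolding d[OF idZ] t(1) tri_mor_def using a idZ idI idS
      by (simp add: Hom_def arr_idn sh_idn)
    ultimately show "\<exists>z \<in> tw.cls (Idn \<C> Z). \<exists>i u. tri_mor \<C> (triI (Dom \<C> z)) (triI (Cod \<C> z)) (z, i, u) \<and>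
        tw.cls (Idn \<C> (step_obj Z)) = residue u" unfolding C_I_simps by blast
    fix G assume "\<exists>z \<in> tw.cls (Idn \<C> Z). \<exists>i u. tri_mor \<C> (triI (Dom \<C> z)) (triI (Cod \<C> z)) (z, i, u) \<and> G = residue u"
    then obtain z i' u where z: "z \<in> tw.cls (Idn \<C> Z)"
      and m: "tri_mor \<C> (triI (Dom \<C> z)) (triI (Cod \<C> z)) (z, i', u)" and G: "G = residue u" by blast
    have e: "tw.eqv Z Z z (Idn \<C> Z)" using z tw.cls_eq[OF idZ] by blast
    note zh = tw.eqv_hom(1)[OF e]
    have u: "u \<in> Hom \<C> (step_obj Z) (step_obj Z)" "sha z \<cdot> q = q \<cdot> u"
      using m a unfolding d[OF zh] t(1) tri_mor_def Hom_def by auto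
    obtain n where n: "tw.null Z Z n" "z = Plus \<C> (Idn \<C> Z) n" using tw.eqvD[OF e] by blast
    then obtain J b c where J: "J \<in> \<I>" "b \<in> Hom \<C> Z J" "c \<in> Hom \<C> J Z" "n = c \<cdot> b" unfolding tw.null_def by blast
    note nh = tw.null_hom[OF n(1)]
    \<comment> \<open>This composite is an extension of an object of \<U> by one of \<I> and so
      vanishes; hence z and the identity have the same effect on q.\<close>
    have "sha b \<cdot> q \<in> Ext1 \<C> (step_obj Z) J" unfolding Ext1_def by (rule comp_hom[OF a(4) sh_hom[OF J(2)]])
    then have bq: "sha b \<cdot> q = Zer \<C> (step_obj Z) (sh J)"
      using Ext1_ext0[OF a(7) hom_obj(2)[OF J(2)]] tw.J_ext(2)[OF J(1) t(4)] by blast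
    have "sha n \<cdot> q = sha c \<cdot> (sha b \<cdot> q)"
      unfolding J(4) sh_comp[OF J(2,3)] by (rule comp_assoc[OF a(4) sh_hom[OF J(2)] sh_hom[OF J(3)]])
    then have nq: "sha n \<cdot> q = Zer \<C> (step_obj Z) (sh Z)" using bq comp_zer[OF sh_hom[OF J(3)] a(7)] by simp
    have "sha z \<cdot> q = q"
      unfolding n(2) sh_plus[OF idZ nh] sh_idn[OF a(5)]
      using comp_plus_left[OF a(4) idn_hom[OF sh_obj_closed[OF a(5)]] sh_hom[OF nh]] idn_left[OF a(4)]
        nq plus_zer[OF a(4)] by simp
    \<comment> \<open>What q kills factors through p, hence through I.\<close>
    then have "q \<cdot> arr_minus \<C> u (Idn \<C> (step_obj Z)) = Zer \<C> (step_obj Z) (sh Z)"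
      using comp_minus[OF u(1) idS a(4)] u(2) idn_right[OF a(4)] minus_self[OF a(4)] by simp
    then obtain x where "x \<in> Hom \<C> (step_obj Z) I" "arr_minus \<C> u (Idn \<C> (step_obj Z)) = p \<cdot> x"
      using tri3_lift[OF tri3_rot[OF t(2)] minus_hom[OF u(1) idS]] by blast
    then have "tw.eqv (step_obj Z) (step_obj Z) u (Idn \<C> (step_obj Z))"
      unfolding tw.eqv_def using u(1) idS tw.nullI[OF t(3) _ a(3)] by simp
    then show "G = tw.cls (Idn \<C> (step_obj Z))" unfolding G C_I_simps using tw.cls_eqv[OF u(1) idS] by blast
  qed
qed

lemma Ext1_vanishes_Z_I:
  assumes "\<A> \<subseteq> \<Z>" "\<B> \<subseteq> \<Z>"
  shows "Ext1_vanishes Z_I \<A> \<B> \<longleftrightarrow> (\<forall>X \<in> \<A>. \<forall>Y \<in> \<B>. \<forall>f \<in> Hom \<C> X (Sig Y). tw.null X (Sig Y) f)"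
proof -
  have *: "Ext1 Z_I X Y = {Zer Z_I X (Sig Y)} \<longleftrightarrow> (\<forall>f \<in> Hom \<C> X (Sig Y). tw.null X (Sig Y) f)"
    if X: "X \<in> \<A>" "Y \<in> \<B>" for X Y
  proof -
    have z: "X \<in> \<Z>" "Sig Y \<in> \<Z>" using X assms Sig_Z by blast+
    note zh = zer_hom[OF Z_obj(1)[OF z(1)] Z_obj(1)[OF z(2)]]
    have "tw.cls f = tw.cls (Zer \<C> X (Sig Y)) \<longleftrightarrow> tw.null X (Sig Y) f" if "f \<in> Hom \<C> X (Sig Y)" for f
      unfolding tw.null_eqv by (rule tw.cls_eqv[OF that zh])
    moreover have "tw.cls ` Hom \<C> X (Sig Y) = {tw.cls (Zer \<C> X (Sig Y))} \<longleftrightarrow>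
        (\<forall>f \<in> Hom \<C> X (Sig Y). tw.cls f = tw.cls (Zer \<C> X (Sig Y)))"
      using zh by blast
    ultimately show ?thesis
      unfolding Ext1_def Z_I_fields(8,9) Z_I_hom[OF z] tw.quotient_simps by simp
  qed
  show ?thesis unfolding Ext1_vanishes_def Z_I_fields(9) by (intro ball_cong refl) (rule *)
qed

lemma standard_triangle_cls:
  assumes t: "(f, a, b) \<in> Tri \<C>" "Dom \<C> f \<in> \<Z>" "Cod \<C> f \<in> \<Z>" "Cod \<C> a \<in> \<U>"
    and m: "tri_mor \<C> (f, a, b) (triI (Dom \<C> f)) (Idn \<C> (Dom \<C> f), y, c)"
  obtains d where "tri3 (Dom \<C> f) f (Cod \<C> f) a (Cod \<C> a) b"
    "c \<in> Hom \<C> (Cod \<C> a) (step_obj (Dom \<C> f))"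
    "d \<in> Hom \<C> (sigma_obj (Cod \<C> a)) (Sig (Dom \<C> f))" "sigma_arr (residue c) = tw.cls d"
    "eta (Cod \<C> a) \<cdot>\<^bsub>C_I\<^esub> residue a = tw.cls (hull (Cod \<C> a) \<cdot> a)"
proof -
  have t3: "tri3 (Dom \<C> f) f (Cod \<C> f) a (Cod \<C> a) b" by (rule Tri_tri3[OF t(1)])
  note h = tri3D[OF t3]
  obtain i I p q where s: "triI (Dom \<C> f) = (i, p, q)" "tri3 (Dom \<C> f) i I p (step_obj (Dom \<C> f)) q"
    using step_tri[OF t(2)] by metis
  have c: "c \<in> Hom \<C> (Cod \<C> a) (step_obj (Dom \<C> f))"
    using m tri3D(4)[OF s(2)] h(4) unfolding s(1) tri_mor_def Hom_def by auto
  obtain d where "d \<in> Hom \<C> (sigma_obj (Cod \<C> a)) (Sig (Dom \<C> f))" "sigma_arr (residue c) = tw.cls d"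
    using sigma_arr_ex[OF c] unfolding C_I_simps by metis
  moreover have "eta (Cod \<C> a) \<cdot>\<^bsub>C_I\<^esub> residue a = tw.cls (hull (Cod \<C> a) \<cdot> a)"
    unfolding C_I_simps(2,3) by (rule C_I_comp[OF h(3) hull_hom[OF h(7)]])
  ultimately show ?thesis using that t3 c by blast
qed

text \<open>A distinguished triangle is a standard one up to three isomorphisms. Only the vertices
  are retained, together with the underlying triangle of \<C>.\<close>

lemma star_Z_I_D:
  assumes "Z \<in> star Z_I L (sh_subcat Z_I R)"
  obtains X0 R0 X f Y g D where "X0 \<in> L" "R0 \<in> R" "tri X f Y g D" "X \<in> \<Z>" "Y \<in> \<Z>" "D \<in> \<U>"
    "isomorphic Z_I X X0" "isomorphic Z_I Y Z" "isomorphic Z_I (sigma_obj D) (Sig R0)"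
proof -
  obtain F G H R0 where F: "(F, G, H) \<in> Tri Z_I" "Dom Z_I F \<in> L" "Cod Z_I F = Z" "Cod Z_I G = Sig R0" "R0 \<in> R"
    using assms unfolding star_def sh_subcat_def Z_I_fields by blast
  then have c: "candidate_triangle Z_I_shift (F, G, H)" unfolding Z_I_fields by blast
  have "\<exists>t'. standard_triangle t' \<and> tri_iso Z_I_shift t' (F, G, H)" using F(1) unfolding Z_I_fields by blast
  then obtain f a b y c x1 x2 x3 where
    t: "(f, a, b) \<in> Tri \<C>" "Dom \<C> f \<in> \<Z>" "Cod \<C> f \<in> \<Z>" "Cod \<C> a \<in> \<U>"
    and m: "tri_mor \<C> (f, a, b) (triI (Dom \<C> f)) (Idn \<C> (Dom \<C> f), y, c)"
    and iso: "tri_mor Z_I_shift (residue f, eta (Cod \<C> a) \<cdot>\<^bsub>C_I\<^esub> residue a, sigma_arr (residue c)) (F, G, H) (x1, x2, x3)"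
      "is_iso Z_I_shift x1" "is_iso Z_I_shift x2" "is_iso Z_I_shift x3"
    unfolding standard_triangle_def tri_iso_def by blast
  obtain d where d: "tri3 (Dom \<C> f) f (Cod \<C> f) a (Cod \<C> a) b"
    "d \<in> Hom \<C> (sigma_obj (Cod \<C> a)) (Sig (Dom \<C> f))" "sigma_arr (residue c) = tw.cls d"
    "eta (Cod \<C> a) \<cdot>\<^bsub>C_I\<^esub> residue a = tw.cls (hull (Cod \<C> a) \<cdot> a)"
    using standard_triangle_cls[OF t m] by metis
  note h = tri3D[OF d(1)]
  note ha = comp_hom[OF h(3) hull_hom[OF h(7)]]
  have "Dom Z_I_shift (residue f) = Dom \<C> f" unfolding Z_I_shift_fields C_I_simps by (rule tw.cls_dom_cod[OF h(2)])
  moreover have "Dom Z_I_shift (eta (Cod \<C> a) \<cdot>\<^bsub>C_I\<^esub> residue a) = Cod \<C> f"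
    unfolding Z_I_shift_fields d(4) by (rule tw.cls_dom_cod[OF ha])
  moreover have "Dom Z_I_shift (sigma_arr (residue c)) = sigma_obj (Cod \<C> a)"
    unfolding Z_I_shift_fields d(3) by (rule tw.cls_dom_cod[OF d(2)])
  moreover have "Dom Z_I_shift G = Z" "Dom Z_I_shift H = Sig R0" "Dom Z_I_shift F = Dom Z_I F"
    using c F(3,4) unfolding candidate_triangle_def Z_I_fields Z_I_shift_fields by auto
  ultimately have "x1 \<in> Hom Z_I (Dom \<C> f) (Dom Z_I F)" "x2 \<in> Hom Z_I (Cod \<C> f) Z"
    "x3 \<in> Hom Z_I (sigma_obj (Cod \<C> a)) (Sig R0)"
    using iso(1) unfolding tri_mor_def Z_I_Hom by auto
  then have "isomorphic Z_I (Dom \<C> f) (Dom Z_I F)" "isomorphic Z_I (Cod \<C> f) Z"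
    "isomorphic Z_I (sigma_obj (Cod \<C> a)) (Sig R0)"
    using iso(2-4) unfolding Z_I_iso unfolding isomorphic_def Z_I_Hom by blast+
  then show ?thesis using that F(2,5) t(2-4) tri3_tri[OF d(1)] by blast
qed

text \<open>The triangle of \<C> yields a standard one, in which Y and \<sigma>(D) are then
  exchanged for Z and \<open>Sig R0\<close> by composing with isomorphisms modulo \<I>.\<close>

lemma star_Z_I_I:
  assumes t: "tri X f Y g D" "X \<in> \<Z>" "Y \<in> \<Z>" "D \<in> \<U>" and X: "X \<in> L" and R0: "R0 \<in> R" "R0 \<in> \<Z>"
    and iso: "tw.isoJ Y Z" "tw.isoJ (sigma_obj D) (Sig R0)"
  shows "Z \<in> star Z_I L (sh_subcat Z_I R)"
proof -
  obtain h where t3: "tri3 X f Y g D h" using t(1) unfolding tri_def by blast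
  note a = tri3D[OF t3]
  have d: "Dom \<C> f = X" "Cod \<C> f = Y" "Cod \<C> g = D" "Dom \<C> g = Y" "Dom \<C> h = D"
    using a(2-4) unfolding Hom_def by auto
  obtain i I p q where s: "triI X = (i, p, q)" "tri3 X i I p (step_obj X) q" "I \<in> \<I>"
    using step_tri[OF t(2)] by metis
  note b = tri3D[OF s(2)]
  note idX = idn_hom[OF a(5)]
  \<comment> \<open>Ext^1 from \<U> to \<I> vanishes, so i extends along f. This starts the morphism
    to the chosen triangle of X that a standard triangle requires.\<close>
  obtain y where y: "y \<in> Hom \<C> Y I" "y \<cdot> f = i" using tw.ext_extend[OF tw.J_ext(2)[OF s(3) t(4)] t(1) b(2)] by blast
  then have "y \<cdot> f = i \<cdot> Idn \<C> X" using idn_right[OF b(2)] by simp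
  then obtain c where c: "c \<in> Hom \<C> D (step_obj X)" "c \<cdot> g = p \<cdot> y" "sha (Idn \<C> X) \<cdot> h = q \<cdot> c"
    using tri3_mor[OF t3 s(2) idX y(1)] by blast
  have m: "tri_mor \<C> (f, g, h) (triI (Dom \<C> f)) (Idn \<C> (Dom \<C> f), y, c)"
    unfolding d s(1) tri_mor_def using idX y c a b idn_right[OF b(2)] by (auto simp: Hom_def)
  obtain e where e: "e \<in> Hom \<C> (sigma_obj D) (Sig X)" "sigma_arr (residue c) = tw.cls e"
    "eta D \<cdot>\<^bsub>C_I\<^esub> residue g = tw.cls (hull D \<cdot> g)"
    using standard_triangle_cls[OF a(1) _ _ _ m] t(2-4) unfolding d by metis
  have st: "standard_triangle (tw.cls f, tw.cls (hull D \<cdot> g), tw.cls e)"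
    unfolding standard_triangle_def using a(1) t(2-4) m e(2,3) d C_I_simps(2) by metis
  obtain r r' where r: "r \<in> Hom \<C> Y Z" "r' \<in> Hom \<C> Z Y" "tw.eqv Y Y (r' \<cdot> r) (Idn \<C> Y)" "tw.eqv Z Z (r \<cdot> r') (Idn \<C> Z)"
    using iso(1) unfolding tw.isoJ_def by blast
  obtain k k' where k: "k \<in> Hom \<C> (sigma_obj D) (Sig R0)" "k' \<in> Hom \<C> (Sig R0) (sigma_obj D)"
    "tw.eqv (sigma_obj D) (sigma_obj D) (k' \<cdot> k) (Idn \<C> (sigma_obj D))"
    "tw.eqv (Sig R0) (Sig R0) (k \<cdot> k') (Idn \<C> (Sig R0))" using iso(2) unfolding tw.isoJ_def by blast
  have z: "Z \<in> \<Z>" "sigma_obj D \<in> \<Z>" "Sig R0 \<in> \<Z>" "Sig X \<in> \<Z>"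
    using Z_iso[OF iso(1) t(3)] sigma_Z[OF t(4)] Sig_Z[OF R0(2)] Sig_Z[OF t(2)] .
  note hg = comp_hom[OF a(3) hull_hom[OF a(7)]]
  define f1 where "f1 = r \<cdot> f"
  define g1 where "g1 = k \<cdot> ((hull D \<cdot> g) \<cdot> r')"
  define e1 where "e1 = e \<cdot> k'"
  have h1: "f1 \<in> Hom \<C> X Z" "g1 \<in> Hom \<C> Z (Sig R0)" "e1 \<in> Hom \<C> (Sig R0) (Sig X)"
    unfolding f1_def g1_def e1_def
    using comp_hom[OF a(2) r(1)] comp_hom[OF comp_hom[OF r(2) hg] k(1)] comp_hom[OF k(2) e(1)] .
  have q: "tw.cls ` Hom \<C> A B \<subseteq> Hom (ideal_quotient \<C> \<I> \<Z>) A B" if "A \<in> \<Z>" "B \<in> \<Z>" for A B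
    using tw.quotient_hom[OF that] by blast
  have 1: "tw.cls f1 \<in> Hom (ideal_quotient \<C> \<I> \<Z>) X Z" "tw.cls g1 \<in> Hom (ideal_quotient \<C> \<I> \<Z>) Z (Sig R0)"
    "tw.cls e1 \<in> Hom (ideal_quotient \<C> \<I> \<Z>) (Sig R0) (Sig X)"
    "tw.cls (Idn \<C> X) \<in> Hom (ideal_quotient \<C> \<I> \<Z>) X X"
    "tw.cls r \<in> Hom (ideal_quotient \<C> \<I> \<Z>) Y Z" "tw.cls k \<in> Hom (ideal_quotient \<C> \<I> \<Z>) (sigma_obj D) (Sig R0)"
    using q t(2,3) z h1 idX r(1) k(1) by blast+
  have dd: "Dom (ideal_quotient \<C> \<I> \<Z>) (tw.cls f) = X" "Dom (ideal_quotient \<C> \<I> \<Z>) (tw.cls (hull D \<cdot> g)) = Y"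
    "Dom (ideal_quotient \<C> \<I> \<Z>) (tw.cls e) = sigma_obj D"
    using tw.cls_dom_cod[OF a(2)] tw.cls_dom_cod[OF hg] tw.cls_dom_cod[OF e(1)] by auto
  have cand: "candidate_triangle Z_I_shift (tw.cls f1, tw.cls g1, tw.cls e1)"
    using 1(1-3) unfolding candidate_triangle_def Z_I_shift_fields Hom_def by auto
  have sI: "sigma_arr (step_arr (tw.cls (Idn \<C> X))) = tw.cls (Idn \<C> (Sig X))"
    using step_arr_idn[OF t(2)] sigma_arr_idn[OF step_Obj[OF t(2)]] by simp
  note idS = idn_hom[OF Z_obj(1)[OF z(4)]]
  have "g1 \<cdot> r = (k \<cdot> (hull D \<cdot> g)) \<cdot> (r' \<cdot> r)"
    unfolding g1_def using comp_assoc[OF r(1) comp_hom[OF r(2) hg] k(1)] comp_assoc[OF r(1,2) hg]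
      comp_assoc[OF comp_hom[OF r(1,2)] hg k(1)] by simp
  then have "tw.eqv Y (Sig R0) (g1 \<cdot> r) (k \<cdot> (hull D \<cdot> g))"
    using tw.eqv_comp_left[OF r(3) comp_hom[OF hg k(1)]] idn_right[OF comp_hom[OF hg k(1)]] by simp
  then have e2: "tw.cls (k \<cdot> (hull D \<cdot> g)) = tw.cls (g1 \<cdot> r)"
    using tw.cls_eqv[OF comp_hom[OF r(1) h1(2)] comp_hom[OF hg k(1)]] by simp
  have "tw.eqv (sigma_obj D) (Sig X) (e1 \<cdot> k) e"
    using tw.eqv_comp_left[OF k(3) e(1)] idn_right[OF e(1)] comp_assoc[OF k(1,2) e(1)] unfolding e1_def by simp
  then have e3: "tw.cls e = tw.cls (e1 \<cdot> k)" using tw.cls_eqv[OF comp_hom[OF k(1) h1(3)] e(1)] by simp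
  have "tri_mor Z_I_shift (tw.cls f, tw.cls (hull D \<cdot> g), tw.cls e) (tw.cls f1, tw.cls g1, tw.cls e1)
      (tw.cls (Idn \<C> X), tw.cls r, tw.cls k)"
    unfolding tri_mor_def Z_I_shift_fields Z_I_Hom
    using 1 dd sI tw.cls_comp[OF a(2) r(1), of \<Z>] tw.cls_comp[OF idX h1(1), of \<Z>] idn_right[OF h1(1)]
      tw.cls_comp[OF hg k(1), of \<Z>] tw.cls_comp[OF r(1) h1(2), of \<Z>] e2
      tw.cls_comp[OF e(1) idS, of \<Z>] idn_left[OF e(1)] tw.cls_comp[OF k(1) h1(3), of \<Z>] e3 f1_def
    by (auto simp: Hom_def)
  moreover have "is_iso Z_I_shift (tw.cls (Idn \<C> X))" "is_iso Z_I_shift (tw.cls r)" "is_iso Z_I_shift (tw.cls k)"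
    unfolding Z_I_iso
    using tw.quotient_iso_cls[OF idX idX _ _ t(2,2)] tw.eqv_refl[OF idX] idn_left[OF idX]
      tw.quotient_iso_cls[OF r t(3) z(1)] tw.quotient_iso_cls[OF k z(2,3)] by simp_all
  ultimately have "(tw.cls f1, tw.cls g1, tw.cls e1) \<in> Tri Z_I"
    unfolding Z_I_fields tri_iso_def using cand st by blast
  moreover have "Dom Z_I (tw.cls f1) = X" "Cod Z_I (tw.cls f1) = Z" "Cod Z_I (tw.cls g1) = Sig R0"
    using 1(1,2) unfolding Z_I_fields Hom_def by auto
  ultimately show ?thesis
    unfolding star_def sh_subcat_def Z_I_fields(1,9) using X R0(1) z(1) by blast
qed

end

section \<open>The two maps\<close>

locale mutable_tcp = concentric_tcp_choice \<C> \<S> \<T> \<U> \<V> triU triT triI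
  for \<C> :: "('o, 'm, 'z) tri_cat_data_scheme" (structure)
    and \<S> \<T> \<U> \<V> :: "'o set" and triU triT triI :: "'o \<Rightarrow> 'm triangle" +
  assumes I: condition_I and II: condition_II
begin

sublocale mt: mutable_oct \<C> \<I> tri \<S> \<T> \<U> \<V>
  by (intro mutable_oct.intro mutable_oct_axioms.intro mutable_twin_tri I II) (rule tri_oct_meet)

lemma is_zero_Z_I: "is_zero Z_I N \<longleftrightarrow> N \<in> \<I>"
proof
  assume z: "is_zero Z_I N"
  then have N: "N \<in> \<Z>" unfolding is_zero_def Z_I_fields by blast
  note iN = idn_hom[OF Z_obj(1)[OF N]]
  have "Hom Z_I N N = {Zer Z_I N N}" using z N unfolding is_zero_def Z_I_fields(1) by blast
  then have "tw.cls (Idn \<C> N) = tw.cls (Zer \<C> N N)"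
    using Z_I_hom[OF N N] iN unfolding Z_I_fields(8) tw.quotient_simps by blast
  then have "tw.null N N (Idn \<C> N)"
    using tw.cls_eqv[OF iN zer_hom[OF Z_obj(1)[OF N] Z_obj(1)[OF N]]] tw.null_eqv by blast
  then show "N \<in> \<I>" using tw.null_obj_J[of N] Z_obj(1)[OF N] unfolding tw.null_obj_def by blast
next
  assume N: "N \<in> \<I>"
  then have z: "N \<in> \<Z>" using I_Z by blast
  note o = Z_obj(1)[OF z]
  show "is_zero Z_I N"
    unfolding is_zero_def Z_I_fields(1,8) tw.quotient_simps
  proof (intro conjI ballI)
    fix X assume X: "X \<in> \<Z>"
    note oX = Z_obj(1)[OF X]
    have "tw.cls f = tw.cls (Zer \<C> N X)" if f: "f \<in> Hom \<C> N X" for f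
      using tw.cls_eqv[OF f zer_hom[OF o oX]] tw.nullI[OF N idn_hom[OF o] f] idn_right[OF f] tw.null_eqv by simp
    then show "Hom Z_I N X = {tw.cls (Zer \<C> N X)}" unfolding Z_I_hom[OF z X] using zer_hom[OF o oX] by blast
    have "tw.cls f = tw.cls (Zer \<C> X N)" if f: "f \<in> Hom \<C> X N" for f
      using tw.cls_eqv[OF f zer_hom[OF oX o]] tw.nullI[OF N f idn_hom[OF o]] idn_left[OF f] tw.null_eqv by simp
    then show "Hom Z_I X N = {tw.cls (Zer \<C> X N)}" unfolding Z_I_hom[OF X z] using zer_hom[OF oX o] by blast
  qed (rule z)
qed

lemma is_biproduct_Z_I:
  "is_biproduct Z_I X Y B \<longleftrightarrow> X \<in> \<Z> \<and> Y \<in> \<Z> \<and> B \<in> \<Z> \<and> mt.biproductJ X Y B"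
proof (cases "X \<in> \<Z> \<and> Y \<in> \<Z> \<and> B \<in> \<Z>")
  case True
  then have z: "X \<in> \<Z>" "Y \<in> \<Z>" "B \<in> \<Z>" by auto
  note o = z[THEN Z_obj(1)]
  have *: "(tw.cls p \<cdot>\<^bsub>Z_I\<^esub> tw.cls i = Idn Z_I X \<and> tw.cls q \<cdot>\<^bsub>Z_I\<^esub> tw.cls j = Idn Z_I Y \<and>
      tw.cls p \<cdot>\<^bsub>Z_I\<^esub> tw.cls j = Zer Z_I Y X \<and> tw.cls q \<cdot>\<^bsub>Z_I\<^esub> tw.cls i = Zer Z_I X Y \<and>
      Plus Z_I (tw.cls i \<cdot>\<^bsub>Z_I\<^esub> tw.cls p) (tw.cls j \<cdot>\<^bsub>Z_I\<^esub> tw.cls q) = Idn Z_I B) \<longleftrightarrow>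
    (tw.eqv X X (p \<cdot> i) (Idn \<C> X) \<and> tw.eqv Y Y (q \<cdot> j) (Idn \<C> Y) \<and>
     tw.eqv Y X (p \<cdot> j) (Zer \<C> Y X) \<and> tw.eqv X Y (q \<cdot> i) (Zer \<C> X Y) \<and>
     tw.eqv B B (Plus \<C> (i \<cdot> p) (j \<cdot> q)) (Idn \<C> B))"
    if h: "i \<in> Hom \<C> X B" "j \<in> Hom \<C> Y B" "p \<in> Hom \<C> B X" "q \<in> Hom \<C> B Y" for i j p q
    unfolding Z_I_fields(5-8) tw.quotient_simps tw.cls_comp[OF h(1,3)] tw.cls_comp[OF h(2,4)]
      tw.cls_comp[OF h(2,3)] tw.cls_comp[OF h(1,4)] tw.cls_comp[OF h(3,1)] tw.cls_comp[OF h(4,2)]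
      tw.cls_plus[OF comp_hom[OF h(3,1)] comp_hom[OF h(4,2)]]
      tw.cls_eqv[OF comp_hom[OF h(1,3)] idn_hom[OF o(1)]] tw.cls_eqv[OF comp_hom[OF h(2,4)] idn_hom[OF o(2)]]
      tw.cls_eqv[OF comp_hom[OF h(2,3)] zer_hom[OF o(2,1)]] tw.cls_eqv[OF comp_hom[OF h(1,4)] zer_hom[OF o(1,2)]]
      tw.cls_eqv[OF plus_hom[OF comp_hom[OF h(3,1)] comp_hom[OF h(4,2)]] idn_hom[OF o(3)]] ..
  show ?thesis
    unfolding is_biproduct_def mt.biproductJ_def Z_I_fields(1) Z_I_hom[OF z(1,3)] Z_I_hom[OF z(2,3)]
      Z_I_hom[OF z(3,1)] Z_I_hom[OF z(3,2)] bex_simps(7)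
    by (intro conj_cong bex_cong refl *)
next
  case False
  then show ?thesis unfolding is_biproduct_def Z_I_fields(1) by blast
qed

lemma isomorphic_Z_I_D: "\<lbrakk>isomorphic Z_I X Y\<rbrakk> \<Longrightarrow> X \<in> \<Z> \<and> Y \<in> \<Z> \<and> tw.isoJ X Y"
proof -
  assume i: "isomorphic Z_I X Y"
  then have "X \<in> \<Z> \<and> Y \<in> \<Z>" unfolding isomorphic_def Z_I_Hom using tw.quotient_hom_obj by blast
  then show ?thesis using Z_I_isomorphic i by blast
qed

lemma srel_iso_sigma: "tw.srel X Y \<Longrightarrow> tw.isoJ (sigma_obj X) Y"
  using tw.srel_unique srel_sigma tw.srel_obj by blast

lemma wrel_iso_omega: "tw.wrel X Y \<Longrightarrow> tw.isoJ (omega_obj X) Y"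
  using tw.wrel_unique wrel_omega tw.wrel_obj by blast

lemma sigma_iso_self: "X \<in> \<Z> \<Longrightarrow> tw.isoJ (sigma_obj X) X"
  using srel_iso_sigma tw.srel_self Z_obj(2) by blast

lemma omega_iso_self: "X \<in> \<Z> \<Longrightarrow> tw.isoJ (omega_obj X) X"
  using wrel_iso_omega tw.wrel_self Z_obj(3) by blast

lemma Sig_iso: "\<lbrakk>tw.isoJ X Y; X \<in> \<Z>; Y \<in> \<Z>\<rbrakk> \<Longrightarrow> tw.isoJ (Sig X) (Sig Y)"
  by (rule tw.Srel_iso[OF _ _ _ Srel_Sig Srel_Sig]) (auto intro: Z_obj)

lemma additive_Z_I_iff:
  "additive_subcat Z_I \<A> \<longleftrightarrow> \<A> \<subseteq> \<Z> \<and> \<A> \<inter> \<I> \<noteq> {} \<and>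
    (\<forall>X Y B. X \<in> \<A> \<longrightarrow> Y \<in> \<A> \<longrightarrow> B \<in> \<Z> \<longrightarrow> mt.biproductJ X Y B \<longrightarrow> B \<in> \<A>) \<and>
    (\<forall>X Y. X \<in> \<A> \<longrightarrow> tw.isoJ X Y \<longrightarrow> Y \<in> \<A>) \<and>
    (\<forall>X Y B. B \<in> \<A> \<longrightarrow> X \<in> \<Z> \<longrightarrow> Y \<in> \<Z> \<longrightarrow> mt.biproductJ X Y B \<longrightarrow> X \<in> \<A> \<and> Y \<in> \<A>)"
proof (cases "\<A> \<subseteq> \<Z>")
  case True
  have 1: "isomorphic Z_I X Y \<longleftrightarrow> tw.isoJ X Y" if "X \<in> \<A>" for X Y
    using that True isomorphic_Z_I_D Z_I_isomorphic Z_iso by blast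
  have 2: "is_biproduct Z_I X Y B \<longleftrightarrow> B \<in> \<Z> \<and> mt.biproductJ X Y B" if "X \<in> \<A>" "Y \<in> \<A>" for X Y B
    using that True is_biproduct_Z_I by blast
  have 3: "is_biproduct Z_I X Y B \<longleftrightarrow> X \<in> \<Z> \<and> Y \<in> \<Z> \<and> mt.biproductJ X Y B" if "B \<in> \<A>" for X Y B
    using that True is_biproduct_Z_I by blast
  have 4: "(\<exists>N \<in> \<A>. is_zero Z_I N) \<longleftrightarrow> \<A> \<inter> \<I> \<noteq> {}" unfolding is_zero_Z_I by blast
  have 5: "(\<forall>X Y B. X \<in> \<A> \<longrightarrow> Y \<in> \<A> \<longrightarrow> is_biproduct Z_I X Y B \<longrightarrow> B \<in> \<A>) \<longleftrightarrow>
      (\<forall>X Y B. X \<in> \<A> \<longrightarrow> Y \<in> \<A> \<longrightarrow> B \<in> \<Z> \<longrightarrow> mt.biproductJ X Y B \<longrightarrow> B \<in> \<A>)" using 2 by blast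
  have 6: "(\<forall>X Y. X \<in> \<A> \<longrightarrow> isomorphic Z_I X Y \<longrightarrow> Y \<in> \<A>) \<longleftrightarrow>
      (\<forall>X Y. X \<in> \<A> \<longrightarrow> tw.isoJ X Y \<longrightarrow> Y \<in> \<A>)" using 1 by blast
  have 7: "(\<forall>X Y B. B \<in> \<A> \<longrightarrow> is_biproduct Z_I X Y B \<longrightarrow> X \<in> \<A> \<and> Y \<in> \<A>) \<longleftrightarrow>
      (\<forall>X Y B. B \<in> \<A> \<longrightarrow> X \<in> \<Z> \<longrightarrow> Y \<in> \<Z> \<longrightarrow> mt.biproductJ X Y B \<longrightarrow> X \<in> \<A> \<and> Y \<in> \<A>)"
    using 3 by blast
  show ?thesis unfolding additive_subcat_def Z_I_fields(1) 4 5 6 7 ..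
next
  case False
  then show ?thesis unfolding additive_subcat_def Z_I_fields(1) by blast
qed

lemma additive_Z_I_D:
  assumes "additive_subcat Z_I \<A>"
  shows "\<A> \<subseteq> \<T> \<inter> \<U>" "\<A> \<inter> \<I> \<noteq> {}"
    "\<lbrakk>mt.biproductJ X Y B; X \<in> \<A>; Y \<in> \<A>; B \<in> \<T> \<inter> \<U>\<rbrakk> \<Longrightarrow> B \<in> \<A>"
    "\<lbrakk>tw.isoJ X Y; X \<in> \<A>\<rbrakk> \<Longrightarrow> Y \<in> \<A>"
    "\<lbrakk>mt.biproductJ X Y B; B \<in> \<A>; X \<in> \<T> \<inter> \<U>; Y \<in> \<T> \<inter> \<U>\<rbrakk> \<Longrightarrow> X \<in> \<A> \<and> Y \<in> \<A>"
  using assms unfolding additive_Z_I_iff \<Z>_def by blast+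

lemma mutable_pairsD:
  assumes "(\<A>, \<B>) \<in> mutable_pairs"
  shows "(\<A>, \<B>) \<in> cotorsion_pairs \<C>" "\<S> \<subseteq> \<A>" "\<A> \<subseteq> \<U>" "\<V> \<subseteq> \<B>" "\<B> \<subseteq> \<T>"
    "Ext1_vanishes Z_I (sigma_obj ` \<A>) (omega_obj ` \<B>)"
  using assms unfolding mutable_pairs_def by blast+

section \<open>From mutable pairs to cotorsion pairs of the quotient\<close>

context
  fixes \<A> \<B>
  assumes M: "(\<A>, \<B>) \<in> mutable_pairs"
begin

lemmas MD = mutable_pairsD[OF M]

lemma pair_J: "J \<in> \<I> \<Longrightarrow> J \<in> \<A>" "J \<in> \<I> \<Longrightarrow> J \<in> \<B>"
  using MD(2,4) tw.J_mem by blast+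

lemma pair_ext0: "X \<in> \<A> \<Longrightarrow> Y \<in> \<B> \<Longrightarrow> all.ext0 X Y"
  by (rule cotorsion_ext0[OF MD(1)])

lemma pair_left: "X \<in> Obj \<C> \<Longrightarrow> (\<And>Y. Y \<in> \<B> \<Longrightarrow> all.ext0 X Y) \<Longrightarrow> X \<in> \<A>"
  using cotorsion_left_iff[OF MD(1)] by blast

lemma pair_right: "Y \<in> Obj \<C> \<Longrightarrow> (\<And>X. X \<in> \<A> \<Longrightarrow> all.ext0 X Y) \<Longrightarrow> Y \<in> \<B>"
  using cotorsion_right_iff[OF MD(1)] by blast

lemma pair_iso_left: assumes "tw.isoJ X Y" "X \<in> \<A>" shows "Y \<in> \<A>"
  using pair_left tw.ext0_isoJ_left[OF tw.isoJ_sym[OF assms(1)] pair_ext0[OF assms(2)]]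
    pair_ext0[OF pair_J(1)] tw.isoJ_obj(2)[OF assms(1)] by blast

lemma pair_iso_right: assumes "tw.isoJ X Y" "X \<in> \<B>" shows "Y \<in> \<B>"
  using pair_right tw.ext0_isoJ_right[OF tw.isoJ_sym[OF assms(1)] pair_ext0[OF _ assms(2)]]
    pair_ext0[OF _ pair_J(2)] tw.isoJ_obj(2)[OF assms(1)] by blast

text \<open>The hull of an object of \<A> has its cone in \<S>, hence in \<A>, and orthogonality
  passes to the extension; so \<sigma> maps \<A> into itself. On \<Z> it is the identity up to
  isomorphism modulo \<I>.\<close>

lemma sigma_bar_eq: "sigma_bar \<A> = \<A> \<inter> \<Z>"
proof (intro equalityI subsetI)
  fix Z assume "Z \<in> sigma_bar \<A>"
  then obtain A where A: "Z \<in> \<Z>" "A \<in> \<A>" "tw.isoJ (sigma_obj A) Z"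
    unfolding sigma_bar_def using isomorphic_Z_I_D by blast
  have oA: "A \<in> Obj \<C>" using A(2) MD(3) tw.mem_obj(3) by blast
  obtain s B where s: "B \<in> \<S>" "tri A (hull A) (sigma_obj A) s B" using hull_tri(1)[OF oA] by blast
  have "sigma_obj A \<in> \<A>"
    using pair_left[OF sigma_Obj[OF oA]] tw.ext0_left[OF s(2)] pair_ext0 A(2) s(1) MD(2) by blast
  then show "Z \<in> \<A> \<inter> \<Z>" using pair_iso_left[OF A(3)] A(1) by blast
next
  fix Z assume "Z \<in> \<A> \<inter> \<Z>"
  then show "Z \<in> sigma_bar \<A>"
    unfolding sigma_bar_def using sigma_iso_self Z_I_isomorphic sigma_Z Z_obj(3) by blast
qed

lemma omega_bar_eq: "omega_bar \<B> = \<B> \<inter> \<Z>"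
proof (intro equalityI subsetI)
  fix Z assume "Z \<in> omega_bar \<B>"
  then obtain A where A: "Z \<in> \<Z>" "A \<in> \<B>" "tw.isoJ (omega_obj A) Z"
    unfolding omega_bar_def using isomorphic_Z_I_D by blast
  have oA: "A \<in> Obj \<C>" using A(2) MD(5) tw.mem_obj(2) by blast
  obtain v B where v: "B \<in> \<V>" "tri B v (omega_obj A) (cover A) A" using cover_tri(1)[OF oA] by blast
  have "omega_obj A \<in> \<B>"
    using pair_right[OF omega_Obj[OF oA]] tw.ext0_right[OF v(2)] pair_ext0 A(2) v(1) MD(4) by blast
  then show "Z \<in> \<B> \<inter> \<Z>" using pair_iso_right[OF A(3)] A(1) by blast
next
  fix Z assume "Z \<in> \<B> \<inter> \<Z>"
  then show "Z \<in> omega_bar \<B>"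
    unfolding omega_bar_def using omega_iso_self Z_I_isomorphic omega_Z Z_obj(2) by blast
qed

lemma additive_sigma_bar: "additive_subcat Z_I (\<A> \<inter> \<Z>)"
  unfolding additive_Z_I_iff
proof (intro conjI allI impI)
  obtain J where J: "J \<in> \<I>" using tw.J_nonempty by blast
  then show "\<A> \<inter> \<Z> \<inter> \<I> \<noteq> {}" using pair_J(1) I_Z by blast
  show "B \<in> \<A> \<inter> \<Z>" if "X \<in> \<A> \<inter> \<Z>" "Y \<in> \<A> \<inter> \<Z>" "B \<in> \<Z>" "mt.biproductJ X Y B" for X Y B
    using pair_left[OF Z_obj(1)[OF that(3)]] mt.ext0_biproductJ_left[OF that(4)] pair_ext0 pair_J(1) that(1-3)
    by blast
  show "Y \<in> \<A> \<inter> \<Z>" if "X \<in> \<A> \<inter> \<Z>" "tw.isoJ X Y" for X Y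
    using pair_iso_left[OF that(2)] Z_iso[OF that(2)] that(1) by blast
  show "X \<in> \<A> \<inter> \<Z>" "Y \<in> \<A> \<inter> \<Z>" if "B \<in> \<A> \<inter> \<Z>" "X \<in> \<Z>" "Y \<in> \<Z>" "mt.biproductJ X Y B" for X Y B
    using pair_left[OF Z_obj(1)[OF that(2)]] pair_left[OF Z_obj(1)[OF that(3)]]
      mt.ext0_biproductJ_summand[OF that(4)] pair_ext0 pair_J(1) that(1-3) by blast+
qed blast

lemma additive_omega_bar: "additive_subcat Z_I (\<B> \<inter> \<Z>)"
  unfolding additive_Z_I_iff
proof (intro conjI allI impI)
  obtain J where J: "J \<in> \<I>" using tw.J_nonempty by blast
  then show "\<B> \<inter> \<Z> \<inter> \<I> \<noteq> {}" using pair_J(2) I_Z by blast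
  show "B \<in> \<B> \<inter> \<Z>" if "X \<in> \<B> \<inter> \<Z>" "Y \<in> \<B> \<inter> \<Z>" "B \<in> \<Z>" "mt.biproductJ X Y B" for X Y B
    using pair_right[OF Z_obj(1)[OF that(3)]] mt.ext0_biproductJ_right(1)[OF that(4)] pair_ext0 pair_J(2) that(1-3)
    by blast
  show "Y \<in> \<B> \<inter> \<Z>" if "X \<in> \<B> \<inter> \<Z>" "tw.isoJ X Y" for X Y
    using pair_iso_right[OF that(2)] Z_iso[OF that(2)] that(1) by blast
  show "X \<in> \<B> \<inter> \<Z>" "Y \<in> \<B> \<inter> \<Z>" if "B \<in> \<B> \<inter> \<Z>" "X \<in> \<Z>" "Y \<in> \<Z>" "mt.biproductJ X Y B" for X Y B
    using pair_right[OF Z_obj(1)[OF that(2)]] pair_right[OF Z_obj(1)[OF that(3)]]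
      mt.ext0_biproductJ_right(2,3)[OF that(4)] pair_ext0 pair_J(2) that(1-3) by blast+
qed blast

text \<open>Mutability concerns values of \<sigma> and \<omega>, but every object of \<Z> is such a
  value of itself modulo \<I>.\<close>

lemma R_map_ext: "Ext1_vanishes Z_I (\<A> \<inter> \<Z>) (\<B> \<inter> \<Z>)"
proof -
  have z: "sigma_obj ` \<A> \<subseteq> \<Z>" "omega_obj ` \<B> \<subseteq> \<Z>" using sigma_Z omega_Z MD(3,5) by blast+
  have E: "tw.null (sigma_obj X) (Sig (omega_obj Y)) f"
    if "X \<in> \<A>" "Y \<in> \<B>" "f \<in> Hom \<C> (sigma_obj X) (Sig (omega_obj Y))" for X Y f
    using Ext1_vanishes_Z_I[OF z] MD(6) that by blast
  have "tw.null X (Sig Y) f" if X: "X \<in> \<A> \<inter> \<Z>" and Y: "Y \<in> \<B> \<inter> \<Z>" and f: "f \<in> Hom \<C> X (Sig Y)" for X Y f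
  proof (rule mt.hom_null_iso[OF tw.isoJ_sym[OF sigma_iso_self] _ _ f])
    show "X \<in> \<Z>" using X by blast
    have YZ: "Y \<in> \<Z>" "omega_obj Y \<in> \<Z>" using Y omega_Z Z_obj(2) by blast+
    show "tw.isoJ (Sig Y) (Sig (omega_obj Y))"
      by (rule Sig_iso[OF tw.isoJ_sym[OF omega_iso_self[OF YZ(1)]] YZ])
    show "tw.null (sigma_obj X) (Sig (omega_obj Y)) g" if "g \<in> Hom \<C> (sigma_obj X) (Sig (omega_obj Y))" for g
      using E[OF _ _ that] X Y by blast
  qed
  then show ?thesis using Ext1_vanishes_Z_I[of "\<A> \<inter> \<Z>" "\<B> \<inter> \<Z>"] by blast
qed

text \<open>In the triangle B -> A -> Z -> B[1] given by the cotorsion pair, B[1] need not lie in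
  \<U>. Composing B -> A with a hull A -> J gives a cone U2 in \<U> with \<sigma>(U2) isomorphic to
  \<Sigma>\<omega>(B).\<close>

lemma R_map_star: assumes Z: "Z \<in> \<Z>" shows "Z \<in> star Z_I (\<A> \<inter> \<Z>) (sh_subcat Z_I (\<B> \<inter> \<Z>))"
proof -
  note Zm = Z_obj[OF Z]
  obtain B b A a where t: "B \<in> \<B>" "A \<in> \<A>" "tri B b A a Z" using cotorsion_cover[OF MD(1) Zm(1)] by blast
  have BT: "B \<in> \<T>" and AU: "A \<in> \<U>" using t MD by blast+
  have AZ: "A \<in> \<Z>" unfolding \<Z>_def using tw.T_extension[OF t(3) BT Zm(2)] AU by blast
  obtain i J p A1 where J: "A1 \<in> \<U>" "J \<in> \<I>" "tri A i J p A1" using tw.J_hull[OF AU] .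
  obtain U2 y f' g' where U2: "tri B (i \<cdot> b) J y U2" "tri Z f' U2 g' A1" using tw.oct_comp_op[OF J(3) t(3)] by blast
  have U2U: "U2 \<in> \<U>" by (rule tw.U_extension[OF U2(2) Zm(3) J(1)])
  \<comment> \<open>The pull-back of J and U2 over A1 is an extension of J by Z, hence Z modulo
    \<I>, and it fits into a triangle A -> P -> U2 of standard shape.\<close>
  obtain P f g k x where P: "tri A f P g U2" "tri Z k P x J" using tw.oct_pull[OF J(3) U2(2)] by blast
  have iso: "tw.isoJ P Z" by (rule tw.split_isoJ_op[OF P(2) J(2) tw.J_ext(1)[OF J(2) Zm(2)]])
  have oB: "B \<in> Obj \<C>" using BT tw.mem_obj by blast
  have "omega_obj B \<in> \<B> \<inter> \<Z>"
    using omega_Z[OF BT] t(1) omega_bar_eq Z_I_isomorphic tw.isoJ_refl[OF omega_Obj[OF oB]]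
    unfolding omega_bar_def by blast
  moreover have "tw.isoJ (sigma_obj U2) (Sig (omega_obj B))"
    by (rule mt.Srel_hull[OF U2(1) BT tw.J_mem(4)[OF J(2)] U2U wrel_omega[OF oB]
          srel_sigma[OF tw.mem_obj(3)[OF U2U]] Srel_Sig[OF omega_Z[OF BT]]])
  ultimately show ?thesis
    using star_Z_I_I[OF P(1) AZ Z_iso[OF tw.isoJ_sym[OF iso] Z] U2U _ _ _ iso] t(2) AZ by blast
qed

lemma R_map_cotorsion: "R_map (\<A>, \<B>) \<in> cotorsion_pairs Z_I"
proof -
  have "Obj Z_I = star Z_I (\<A> \<inter> \<Z>) (sh_subcat Z_I (\<B> \<inter> \<Z>))"
    using R_map_star unfolding Z_I_fields(1) star_def by blast
  then show ?thesis
    unfolding R_map_def cotorsion_pairs_def prod.case sigma_bar_eq omega_bar_eq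
    using additive_sigma_bar additive_omega_bar R_map_ext by blast
qed

end

section \<open>From cotorsion pairs of the quotient to mutable pairs\<close>

context
  fixes L R
  assumes LR: "(L, R) \<in> cotorsion_pairs Z_I"
begin

lemma quotient_pair: "additive_subcat Z_I L" "additive_subcat Z_I R" "Ext1_vanishes Z_I L R"
    "Z \<in> \<Z> \<Longrightarrow> Z \<in> star Z_I L (sh_subcat Z_I R)"
  using LR unfolding cotorsion_pairs_def Z_I_fields(1) by blast+

lemma quotient_classes: "mutable_classes \<C> \<I> tri \<S> \<T> \<U> \<V> L R"
  by (intro mutable_classes.intro mutable_classes_axioms.intro mt.mutable_twin_axioms)
    (fact additive_Z_I_D[OF quotient_pair(1)] additive_Z_I_D[OF quotient_pair(2)])+

interpretation mc: mutable_classes \<C> \<I> tri \<S> \<T> \<U> \<V> L R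
  by (rule quotient_classes)

lemma sigma_bar_inv_eq: "sigma_bar_inv L = mc.sL"
  unfolding sigma_bar_inv_def
  using mc.sLI[OF _ srel_sigma] mc.sLD[OF _ srel_sigma] mc.sL_U tw.mem_obj(3) by blast

lemma omega_bar_inv_eq: "omega_bar_inv R = mc.wR"
  unfolding omega_bar_inv_def
  using mc.wRI[OF _ wrel_omega] mc.wRD[OF _ wrel_omega] mc.wR_T tw.mem_obj(2) by blast

lemma quotient_enough: "mc.enough"
  unfolding mc.enough_def
proof
  fix Z assume "Z \<in> \<T> \<inter> \<U>"
  then have Z: "Z \<in> \<Z>" unfolding \<Z>_def .
  obtain X0 R0 X f Y g D where t: "X0 \<in> L" "R0 \<in> R" "tri X f Y g D" "X \<in> \<Z>" "Y \<in> \<Z>" "D \<in> \<U>"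
    and i: "isomorphic Z_I X X0" "isomorphic Z_I Y Z" "isomorphic Z_I (sigma_obj D) (Sig R0)"
    using star_Z_I_D[OF quotient_pair(4)[OF Z]] .
  have R0: "R0 \<in> \<Z>" using t(2) quotient_pair(2) unfolding additive_Z_I_iff by blast
  have iso: "tw.isoJ X X0" "tw.isoJ Y Z" "tw.isoJ (sigma_obj D) (Sig R0)" using i isomorphic_Z_I_D by blast+
  obtain B b X' p R' where B: "tri B b X' p Z" "tw.isoJ X' X" "B \<in> \<T>" "tw.wrel B R'" "tw.isoJ R' R0"
    using mt.triangle_cover[OF t(3) Z_obj(3)[OF t(4)] t(6) iso(2) Z_obj(2)[OF Z] Z_obj(2)[OF t(4)]
        srel_sigma[OF tw.mem_obj(3)[OF t(6)]] Srel_Sig[OF R0] iso(3) Z_obj(2,3)[OF R0]] .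
  have "X' \<in> L" using mc.L_iso tw.isoJ_sym tw.isoJ_trans[OF B(2) iso(1)] t(1) by blast
  moreover have "B \<in> mc.wR" using mc.wRI[OF B(3,4)] mc.R_iso tw.isoJ_sym[OF B(5)] t(2) by blast
  ultimately show "\<exists>B f X g. B \<in> mc.wR \<and> X \<in> L \<and> tri B f X g Z" using B(1) by blast
qed

lemma I_map_mutable: "I_map (L, R) \<in> mutable_pairs"
proof -
  have LZ: "L \<subseteq> \<Z>" "R \<subseteq> \<Z>" using mc.L_Z mc.R_Z unfolding \<Z>_def .
  \<comment> \<open>The vanishing is given for the chosen shift \<open>Sig Y\<close> and is
    transported to an arbitrary value Y' of the relation.\<close>
  have orth: "tw.null X Y' f" if "X \<in> L" "Y \<in> R" "tw.Srel Y Y'" "f \<in> Hom \<C> X Y'" for X Y Y' f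
  proof (rule mt.hom_null_iso[OF tw.isoJ_refl _ _ that(4)])
    show "X \<in> Obj \<C>" using hom_obj(1)[OF that(4)] .
    have Y: "Y \<in> \<Z>" using LZ that(2) by blast
    show "tw.isoJ Y' (Sig Y)" by (rule tw.Srel_unique[OF Z_obj(3)[OF Y] that(3) Srel_Sig[OF Y]])
    show "tw.null X (Sig Y) g" if "g \<in> Hom \<C> X (Sig Y)" for g
      using Ext1_vanishes_Z_I[OF LZ] quotient_pair(3) \<open>X \<in> L\<close> \<open>Y \<in> R\<close> that by blast
  qed
  have vanish: "all.ext0 A B" if "A \<in> mc.sL" "B \<in> mc.wR" for A B
    by (rule mc.ext_sL_wR[OF orth that])
  have "(mc.sL, mc.wR) \<in> cotorsion_pairs \<C>"
  proof (rule cotorsion_pairsI[OF mc.sL_additive mc.wR_additive vanish])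
    fix X assume X: "X \<in> Obj \<C>"
    obtain B f A g where "B \<in> mc.wR" "A \<in> mc.sL" "tri B f A g X"
      by (rule mc.resolution[OF quotient_enough vanish X])
    then show "\<exists>B f A g. B \<in> mc.wR \<and> A \<in> mc.sL \<and> tri B f A g X" by blast
  qed
  moreover have "Ext1_vanishes Z_I (sigma_obj ` mc.sL) (omega_obj ` mc.wR)"
  proof -
    have "sigma_obj ` mc.sL \<subseteq> L" "omega_obj ` mc.wR \<subseteq> R"
      unfolding sigma_bar_inv_eq[symmetric] omega_bar_inv_eq[symmetric] sigma_bar_inv_def omega_bar_inv_def by blast+
    then show ?thesis using quotient_pair(3) unfolding Ext1_vanishes_def by blast
  qed
  ultimately show ?thesis
    unfolding I_map_def mutable_pairs_def prod.case sigma_bar_inv_eq omega_bar_inv_eq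
    using mc.S_sL mc.V_wR mc.sL_U mc.wR_T by blast
qed

lemma R_I_map: "R_map (I_map (L, R)) = (L, R)"
proof -
  have LZ: "L \<subseteq> \<Z>" "R \<subseteq> \<Z>" using mc.L_Z mc.R_Z unfolding \<Z>_def .
  have "sigma_bar (sigma_bar_inv L) = L"
  proof (intro equalityI subsetI)
    fix Z assume "Z \<in> sigma_bar (sigma_bar_inv L)"
    then show "Z \<in> L" unfolding sigma_bar_def sigma_bar_inv_def using isomorphic_Z_I_D mc.L_iso by blast
  next
    fix Z assume Z: "Z \<in> L"
    then have z: "Z \<in> \<Z>" using LZ by blast
    have "sigma_obj Z \<in> L" using mc.L_iso[OF tw.isoJ_sym[OF sigma_iso_self[OF z]] Z] .
    moreover have "isomorphic Z_I (sigma_obj Z) Z"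
      using Z_I_isomorphic[OF sigma_Z[OF Z_obj(3)[OF z]] z] sigma_iso_self[OF z] by blast
    ultimately show "Z \<in> sigma_bar (sigma_bar_inv L)"
      unfolding sigma_bar_def sigma_bar_inv_def using z Z_obj(3) by blast
  qed
  moreover have "omega_bar (omega_bar_inv R) = R"
  proof (intro equalityI subsetI)
    fix Z assume "Z \<in> omega_bar (omega_bar_inv R)"
    then show "Z \<in> R" unfolding omega_bar_def omega_bar_inv_def using isomorphic_Z_I_D mc.R_iso by blast
  next
    fix Z assume Z: "Z \<in> R"
    then have z: "Z \<in> \<Z>" using LZ by blast
    have "omega_obj Z \<in> R" using mc.R_iso[OF tw.isoJ_sym[OF omega_iso_self[OF z]] Z] .
    moreover have "isomorphic Z_I (omega_obj Z) Z"
      using Z_I_isomorphic[OF omega_Z[OF Z_obj(2)[OF z]] z] omega_iso_self[OF z] by blast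
    ultimately show "Z \<in> omega_bar (omega_bar_inv R)"
      unfolding omega_bar_def omega_bar_inv_def using z Z_obj(2) by blast
  qed
  ultimately show ?thesis unfolding R_map_def I_map_def by simp
qed

end

text \<open>Both pairs are cotorsion pairs, so the inclusion in each component forces equality.\<close>

lemma I_R_map: assumes M: "(\<A>, \<B>) \<in> mutable_pairs" shows "I_map (R_map (\<A>, \<B>)) = (\<A>, \<B>)"
proof -
  note MD = mutable_pairsD[OF M]
  obtain \<A>' \<B>' where P: "I_map (R_map (\<A>, \<B>)) = (\<A>', \<B>')" by (cases "I_map (R_map (\<A>, \<B>))")
  have eq: "\<A>' = sigma_bar_inv (sigma_bar \<A>)" "\<B>' = omega_bar_inv (omega_bar \<B>)"
    using P unfolding I_map_def R_map_def by auto
  have "(\<A>', \<B>') \<in> mutable_pairs"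
    using I_map_mutable[of "fst (R_map (\<A>, \<B>))" "snd (R_map (\<A>, \<B>))"] R_map_cotorsion[OF M] P by simp
  then have C: "(\<A>', \<B>') \<in> cotorsion_pairs \<C>" by (rule mutable_pairsD)
  have A: "\<A> \<subseteq> \<A>'"
  proof
    fix A assume A: "A \<in> \<A>"
    then have AU: "A \<in> \<U>" using MD(3) by blast
    note z = sigma_Z[OF AU]
    have "isomorphic Z_I (sigma_obj A) (sigma_obj A)" using Z_I_isomorphic[OF z z] tw.isoJ_refl[OF Z_obj(1)[OF z]] by blast
    then show "A \<in> \<A>'" unfolding eq sigma_bar_inv_def sigma_bar_def using AU A z by blast
  qed
  have B: "\<B> \<subseteq> \<B>'"
  proof
    fix B assume B: "B \<in> \<B>"
    then have BT: "B \<in> \<T>" using MD(5) by blast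
    note z = omega_Z[OF BT]
    have "isomorphic Z_I (omega_obj B) (omega_obj B)" using Z_I_isomorphic[OF z z] tw.isoJ_refl[OF Z_obj(1)[OF z]] by blast
    then show "B \<in> \<B>'" unfolding eq omega_bar_inv_def omega_bar_def using BT B z by blast
  qed
  have "\<A>' \<subseteq> \<A>" using cotorsion_left_iff[OF C] cotorsion_left_iff[OF MD(1)] B by blast
  moreover have "\<B>' \<subseteq> \<B>" using cotorsion_right_iff[OF C] cotorsion_right_iff[OF MD(1)] A by blast
  ultimately show ?thesis using P A B by simp
qed

end

theorem theorem5p17:
  fixes \<C> :: "('o, 'm) tri_cat_data"
    and \<S> \<T> \<U> \<V> :: "'o set"
    and triU triT triI :: "'o \<Rightarrow> 'm triangle"
  assumes "concentric_tcp_choice \<C> \<S> \<T> \<U> \<V> triU triT triI"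
    and "concentric_tcp_choice.condition_I \<C> \<S> \<T> \<U> triU triT"
    and "concentric_tcp_choice.condition_II \<C> \<S> \<T> \<U> \<V>"
  shows "let M = concentric_tcp_choice.mutable_pairs \<C> \<S> \<T> \<U> \<V> triU triT triI;
             CP = cotorsion_pairs (concentric_tcp_choice.Z_I \<C> \<S> \<T> \<U> triT triI);
             R = concentric_tcp_choice.R_map \<C> \<S> \<T> \<U> triU triT triI;
             I = concentric_tcp_choice.I_map \<C> \<T> \<U> triU triT
         in bij_betw R M CP \<and> bij_betw I CP M \<and> (\<forall>p \<in> M. I (R p) = p) \<and> (\<forall>q \<in> CP. R (I q) = q)"
proof -
  interpret mutable_tcp \<C> \<S> \<T> \<U> \<V> triU triT triI
    using assms by (intro mutable_tcp.intro mutable_tcp_axioms.intro)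
  have IR: "I_map (R_map p) = p" "R_map p \<in> cotorsion_pairs Z_I" if "p \<in> mutable_pairs" for p
    using I_R_map R_map_cotorsion that by (cases p; blast)+
  have RI: "R_map (I_map q) = q" "I_map q \<in> mutable_pairs" if "q \<in> cotorsion_pairs Z_I" for q
    using R_I_map I_map_mutable that by (cases q; blast)+
  have "bij_betw R_map mutable_pairs (cotorsion_pairs Z_I)"
    by (rule bij_betw_byWitness[where f' = I_map]) (use IR RI in auto)
  moreover have "bij_betw I_map (cotorsion_pairs Z_I) mutable_pairs"
    by (rule bij_betw_byWitness[where f' = R_map]) (use IR RI in auto)
  ultimately show ?thesis unfolding Let_def using IR(1) RI(1) by blast
qed

end
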